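(* Let $\mathcal{A}=\bigcup_{i=1}^d V(\alpha_i)\subseteq\mathbb{P}^n$ be an arrangement of $d\ge 1$ distinct hyperplanes. Then the Orlik–Terao algebra $C(\mathcal{A})$, as a graded module over $R=\mathbb{C}[y_1,\dots,y_d]$, is $n$-regular; that is, $\mathrm{Tor}_i^R(C(\mathcal{A}),\mathbb{C})_{i+j}=0$ for all $i\ge 0$ and all $j>n$.
   Context: $\alpha_1,\dots,\alpha_d\in\mathbb{C}[x_0,\dots,x_n]$ are pairwise non-proportional nonzero linear forms. Orlik–Terao algebra: let $R=\mathbb{C}[y_1,\dots,y_d]$ with the standard grading. For each linear dependency $\Lambda:\ \sum_{j=1}^k c_{i_j}\alpha_{i_j}=0$ put $f_\Lambda=\sum_{j=1}^k c_{i_j}\,(y_{i_1}\cdots\widehat{y_{i_j}}\cdots y_{i_k})$, and let $I$ be the ideal generated by all the $f_\Lambda$. Then $C(\mathcal{A})=R/I$. *)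

theory Defs
  imports Complex_Main "HOL-Library.Poly_Mapping" "HOL-Algebra.Module" "HOL-Algebra.QuotRing"
    "HOL-Algebra.Free_Abelian_Groups"
begin

section \<open>Polynomial rings over the complex numbers\<close>

text \<open>Polynomials in the indeterminates \<open>X\<^sub>0, X\<^sub>1, \<dots>\<close>: finitely supported functions from
  monomials (exponent vectors) to coefficients. The type class multiplication of
  \<^theory>\<open>HOL-Library.Poly_Mapping\<close> is the convolution product.\<close>

type_synonym cpoly = "(nat \<Rightarrow>\<^sub>0 nat) \<Rightarrow>\<^sub>0 complex"

definition Var :: "nat \<Rightarrow> cpoly" where
  "Var i = Poly_Mapping.single (Poly_Mapping.single i 1) 1"

definition Const :: "complex \<Rightarrow> cpoly" where
  "Const c = Poly_Mapping.single 0 c"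

definition polys_in :: "nat set \<Rightarrow> cpoly set" where
  "polys_in V = {p. \<forall>m \<in> Poly_Mapping.keys p. Poly_Mapping.keys m \<subseteq> V}"

definition mdeg :: "(nat \<Rightarrow>\<^sub>0 nat) \<Rightarrow> nat" where
  "mdeg m = (\<Sum>i \<in> Poly_Mapping.keys m. Poly_Mapping.lookup m i)"

definition hom_polys :: "nat set \<Rightarrow> int \<Rightarrow> cpoly set" where
  "hom_polys V k = {p \<in> polys_in V. \<forall>m \<in> Poly_Mapping.keys p. int (mdeg m) = k}"

definition poly_ring :: "nat set \<Rightarrow> cpoly ring" where
  "poly_ring V =
    \<lparr>carrier = polys_in V, monoid.mult = (*), monoid.one = 1, ring.zero = 0, ring.add = (+)\<rparr>"


section \<open>Graded modules over \<open>\<complex>[X\<^sub>v | v \<in> V]\<close>\<close>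

text \<open>A module together with its homogeneous components. As for the library's record of modules,
  the fields \<open>mult\<close> and \<open>one\<close> inherited from rings are irrelevant to the module
  structure.\<close>

record ('a, 'm) graded_module = "('a, 'm) module" +
  piece :: "int \<Rightarrow> 'm set"

definition quotient_module :: "nat set \<Rightarrow> cpoly set \<Rightarrow> (cpoly, cpoly set) graded_module" where
  "quotient_module V J =
    (let R = poly_ring V; Q = R Quot J in
     \<lparr>carrier = carrier Q, monoid.mult = monoid.mult Q, monoid.one = monoid.one Q,
      ring.zero = ring.zero Q, ring.add = ring.add Q,
      smult = (\<lambda>p Y. (J +>\<^bsub>R\<^esub> p) \<otimes>\<^bsub>Q\<^esub> Y),
      piece = (\<lambda>k. (\<lambda>p. J +>\<^bsub>R\<^esub> p) ` hom_polys V k)\<rparr>)"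

text \<open>The residue field \<open>\<complex> = R/(X\<^sub>v | v \<in> V)\<close>, concentrated in degree 0; a polynomial acts through
  its constant term.\<close>

definition residue_field :: "(cpoly, complex) graded_module" where
  "residue_field =
    \<lparr>carrier = UNIV, monoid.mult = (*), monoid.one = 1, ring.zero = 0, ring.add = (+),
     smult = (\<lambda>p z. Poly_Mapping.lookup p 0 * z),
     piece = (\<lambda>k. if k = 0 then UNIV else {0})\<rparr>"

text \<open>The graded free module \<open>\<Oplus>\<^bsub>b \<in> B\<^esub> R(- bdeg b)\<close>: the basis element \<open>b\<close> has degree
  \<open>bdeg b\<close>.\<close>

definition free_module ::
  "nat set \<Rightarrow> 'b set \<Rightarrow> ('b \<Rightarrow> int) \<Rightarrow> (cpoly, 'b \<Rightarrow>\<^sub>0 cpoly) graded_module" where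
  "free_module V B bdeg =
    \<lparr>carrier = {f. Poly_Mapping.keys f \<subseteq> B \<and> (\<forall>b. Poly_Mapping.lookup f b \<in> polys_in V)},
     monoid.mult = undefined, monoid.one = undefined, ring.zero = 0, ring.add = (+),
     smult = (\<lambda>p. Poly_Mapping.map (\<lambda>q. p * q)),
     piece = (\<lambda>k. {f. Poly_Mapping.keys f \<subseteq> B \<and>
                      (\<forall>b. Poly_Mapping.lookup f b \<in> hom_polys V (k - bdeg b))})\<rparr>"

definition graded_hom ::
  "nat set \<Rightarrow> (cpoly, 'm) graded_module \<Rightarrow> (cpoly, 'n) graded_module \<Rightarrow> ('m \<Rightarrow> 'n) set" where
  "graded_hom V M N =
    {f. f \<in> carrier M \<rightarrow> carrier N \<and>
        (\<forall>x \<in> carrier M. \<forall>y \<in> carrier M. f (x \<oplus>\<^bsub>M\<^esub> y) = f x \<oplus>\<^bsub>N\<^esub> f y) \<and>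
        (\<forall>p \<in> polys_in V. \<forall>x \<in> carrier M. f (p \<odot>\<^bsub>M\<^esub> x) = p \<odot>\<^bsub>N\<^esub> f x) \<and>
        (\<forall>k. f ` piece M k \<subseteq> piece N k)}"

text \<open>\<open>\<dots> \<rightarrow> F\<^sub>2 \<rightarrow> F\<^sub>1 \<rightarrow> F\<^sub>0 \<rightarrow> M \<rightarrow> 0\<close> is exact, where \<open>F\<^sub>i\<close> is the graded free module
  with basis \<open>B i\<close> in degrees \<open>bdeg i\<close>, the map \<open>F\<^sub>0 \<rightarrow> M\<close> is \<open>\<epsilon>\<close>, and
  \<open>\<delta> i\<close> is the map from \<open>F\<^bsub>i+1\<^esub>\<close> to \<open>F\<^sub>i\<close>.\<close>

definition graded_free_resolution ::
  "nat set \<Rightarrow> (cpoly, 'm) graded_module \<Rightarrow> (nat \<Rightarrow> 'b set) \<Rightarrow> (nat \<Rightarrow> 'b \<Rightarrow> int) \<Rightarrow>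
   (nat \<Rightarrow> ('b \<Rightarrow>\<^sub>0 cpoly) \<Rightarrow> ('b \<Rightarrow>\<^sub>0 cpoly)) \<Rightarrow> (('b \<Rightarrow>\<^sub>0 cpoly) \<Rightarrow> 'm) \<Rightarrow> bool" where
  "graded_free_resolution V M B bdeg \<delta> \<epsilon> \<longleftrightarrow>
    (let F = (\<lambda>i. free_module V (B i) (bdeg i)) in
     \<epsilon> \<in> graded_hom V (F 0) M \<and>
     (\<forall>i. \<delta> i \<in> graded_hom V (F (Suc i)) (F i)) \<and>
     \<epsilon> ` carrier (F 0) = carrier M \<and>
     \<delta> 0 ` carrier (F 1) = {x \<in> carrier (F 0). \<epsilon> x = \<zero>\<^bsub>M\<^esub>} \<and>
     (\<forall>i. \<delta> (Suc i) ` carrier (F (Suc (Suc i))) =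
          {x \<in> carrier (F (Suc i)). \<delta> i x = \<zero>\<^bsub>F i\<^esub>}))"


section \<open>Tensor products and Tor\<close>

text \<open>\<open>M \<otimes>\<^sub>R N\<close> is the quotient of the free abelian group on pairs \<open>(x, y)\<close> by the
  bilinearity and balancing relations. It is a group in the library's multiplicative notation;
  its elements are cosets.\<close>

definition tensor_free ::
  "(cpoly, 'm) graded_module \<Rightarrow> (cpoly, 'n) graded_module \<Rightarrow> ('m \<times> 'n \<Rightarrow>\<^sub>0 int) monoid" where
  "tensor_free M N = free_Abelian_group (carrier M \<times> carrier N)"

definition tensor_relations ::
  "nat set \<Rightarrow> (cpoly, 'm) graded_module \<Rightarrow> (cpoly, 'n) graded_module \<Rightarrow> ('m \<times> 'n \<Rightarrow>\<^sub>0 int) set" where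
  "tensor_relations V M N = generate (tensor_free M N)
    ({frag_of (x \<oplus>\<^bsub>M\<^esub> x', y) - frag_of (x, y) - frag_of (x', y) | x x' y.
        x \<in> carrier M \<and> x' \<in> carrier M \<and> y \<in> carrier N} \<union>
     {frag_of (x, y \<oplus>\<^bsub>N\<^esub> y') - frag_of (x, y) - frag_of (x, y') | x y y'.
        x \<in> carrier M \<and> y \<in> carrier N \<and> y' \<in> carrier N} \<union>
     {frag_of (p \<odot>\<^bsub>M\<^esub> x, y) - frag_of (x, p \<odot>\<^bsub>N\<^esub> y) | p x y.
        p \<in> polys_in V \<and> x \<in> carrier M \<and> y \<in> carrier N})"

definition tensor_class ::
  "nat set \<Rightarrow> (cpoly, 'm) graded_module \<Rightarrow> (cpoly, 'n) graded_module \<Rightarrow>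
   ('m \<times> 'n \<Rightarrow>\<^sub>0 int) \<Rightarrow> ('m \<times> 'n \<Rightarrow>\<^sub>0 int) set" where
  "tensor_class V M N z = tensor_relations V M N #>\<^bsub>tensor_free M N\<^esub> z"

definition tensor ::
  "nat set \<Rightarrow> (cpoly, 'm) graded_module \<Rightarrow> (cpoly, 'n) graded_module \<Rightarrow>
   ('m \<times> 'n \<Rightarrow>\<^sub>0 int) set monoid" where
  "tensor V M N = tensor_free M N Mod tensor_relations V M N"

definition tensor_piece ::
  "nat set \<Rightarrow> (cpoly, 'm) graded_module \<Rightarrow> (cpoly, 'n) graded_module \<Rightarrow> int \<Rightarrow>
   ('m \<times> 'n \<Rightarrow>\<^sub>0 int) set set" where
  "tensor_piece V M N t = generate (tensor V M N)
    {tensor_class V M N (frag_of (x, y)) | x y k l. x \<in> piece M k \<and> y \<in> piece N l \<and> k + l = t}"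

text \<open>The map \<open>f \<otimes> id : M \<otimes> N \<rightarrow> M' \<otimes> N\<close> induced by \<open>f : M \<rightarrow> M'\<close>. The image of a
  coset is the common class of the images of its representatives.\<close>

definition tensor_map ::
  "nat set \<Rightarrow> (cpoly, 'm') graded_module \<Rightarrow> (cpoly, 'n) graded_module \<Rightarrow> ('m \<Rightarrow> 'm') \<Rightarrow>
   ('m \<times> 'n \<Rightarrow>\<^sub>0 int) set \<Rightarrow> ('m' \<times> 'n \<Rightarrow>\<^sub>0 int) set" where
  "tensor_map V M' N f T =
    the_elem ((\<lambda>z. tensor_class V M' N (frag_extend (\<lambda>(x, y). frag_of (f x, y)) z)) ` T)"

text \<open>\<open>Tor\<^sub>i\<^sup>R(M, N)\<^sub>t\<close>, computed from a graded free resolution \<open>(B, bdeg, \<delta>)\<close> of \<open>M\<close>: the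
  homology of \<open>(F\<^bsub>i+1\<^esub> \<otimes> N)\<^sub>t \<rightarrow> (F\<^sub>i \<otimes> N)\<^sub>t \<rightarrow> (F\<^bsub>i-1\<^esub> \<otimes> N)\<^sub>t\<close>, with
  \<open>F\<^bsub>-1\<^esub> = 0\<close>. Up to isomorphism the result does not depend on the resolution; to avoid choosing
  one, statements about \<open>Tor\<close> quantify over all graded free resolutions of \<open>M\<close>.\<close>

definition Tor_cycles ::
  "nat set \<Rightarrow> (nat \<Rightarrow> 'b set) \<Rightarrow> (nat \<Rightarrow> 'b \<Rightarrow> int) \<Rightarrow>
   (nat \<Rightarrow> ('b \<Rightarrow>\<^sub>0 cpoly) \<Rightarrow> ('b \<Rightarrow>\<^sub>0 cpoly)) \<Rightarrow> (cpoly, 'n) graded_module \<Rightarrow> nat \<Rightarrow> int \<Rightarrow>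
   (('b \<Rightarrow>\<^sub>0 cpoly) \<times> 'n \<Rightarrow>\<^sub>0 int) set set" where
  "Tor_cycles V B bdeg \<delta> N i t =
    (let F = (\<lambda>i. free_module V (B i) (bdeg i)) in
     case i of
       0 \<Rightarrow> tensor_piece V (F 0) N t
     | Suc h \<Rightarrow> {T \<in> tensor_piece V (F (Suc h)) N t.
                  tensor_map V (F h) N (\<delta> h) T = \<one>\<^bsub>tensor V (F h) N\<^esub>})"

definition Tor_boundaries ::
  "nat set \<Rightarrow> (nat \<Rightarrow> 'b set) \<Rightarrow> (nat \<Rightarrow> 'b \<Rightarrow> int) \<Rightarrow>
   (nat \<Rightarrow> ('b \<Rightarrow>\<^sub>0 cpoly) \<Rightarrow> ('b \<Rightarrow>\<^sub>0 cpoly)) \<Rightarrow> (cpoly, 'n) graded_module \<Rightarrow> nat \<Rightarrow> int \<Rightarrow>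
   (('b \<Rightarrow>\<^sub>0 cpoly) \<times> 'n \<Rightarrow>\<^sub>0 int) set set" where
  "Tor_boundaries V B bdeg \<delta> N i t =
    (let F = (\<lambda>i. free_module V (B i) (bdeg i)) in
     tensor_map V (F i) N (\<delta> i) ` tensor_piece V (F (Suc i)) N t)"

definition Tor ::
  "nat set \<Rightarrow> (nat \<Rightarrow> 'b set) \<Rightarrow> (nat \<Rightarrow> 'b \<Rightarrow> int) \<Rightarrow>
   (nat \<Rightarrow> ('b \<Rightarrow>\<^sub>0 cpoly) \<Rightarrow> ('b \<Rightarrow>\<^sub>0 cpoly)) \<Rightarrow> (cpoly, 'n) graded_module \<Rightarrow> nat \<Rightarrow> int \<Rightarrow>
   (('b \<Rightarrow>\<^sub>0 cpoly) \<times> 'n \<Rightarrow>\<^sub>0 int) set set monoid" where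
  "Tor V B bdeg \<delta> N i t =
    (tensor V (free_module V (B i) (bdeg i)) N)\<lparr>carrier := Tor_cycles V B bdeg \<delta> N i t\<rparr>
      Mod Tor_boundaries V B bdeg \<delta> N i t"


section \<open>The Orlik--Terao algebra\<close>

text \<open>The polynomial attached to the dependency \<open>\<Sum>\<^bsub>i \<in> S\<^esub> c\<^sub>i \<alpha>\<^sub>i = 0\<close> among the distinct forms
  indexed by \<open>S\<close>.\<close>

definition ot_relation :: "nat set \<Rightarrow> (nat \<Rightarrow> complex) \<Rightarrow> cpoly" where
  "ot_relation S c = (\<Sum>j \<in> S. Const (c j) * (\<Prod>i \<in> S - {j}. Var i))"

definition orlik_terao_ideal :: "nat \<Rightarrow> (nat \<Rightarrow> cpoly) \<Rightarrow> cpoly set" where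
  "orlik_terao_ideal d \<alpha> = genideal (poly_ring {1..d})
    {ot_relation S c | S c. S \<subseteq> {1..d} \<and> (\<Sum>i \<in> S. Const (c i) * \<alpha> i) = 0}"

definition orlik_terao_algebra :: "nat \<Rightarrow> (nat \<Rightarrow> cpoly) \<Rightarrow> (cpoly, cpoly set) graded_module" where
  "orlik_terao_algebra d \<alpha> = quotient_module {1..d} (orlik_terao_ideal d \<alpha>)"

text \<open>The forms \<open>\<alpha>\<^sub>1, \<dots>, \<alpha>\<^sub>d\<close> define \<open>d\<close> distinct hyperplanes in projective \<open>n\<close>-space.\<close>

definition hyperplane_arrangement :: "nat \<Rightarrow> nat \<Rightarrow> (nat \<Rightarrow> cpoly) \<Rightarrow> bool" where
  "hyperplane_arrangement n d \<alpha> \<longleftrightarrow>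
    (\<forall>i \<in> {1..d}. \<alpha> i \<in> hom_polys {0..n} 1 \<and> \<alpha> i \<noteq> 0) \<and>
    (\<forall>i \<in> {1..d}. \<forall>j \<in> {1..d}. i \<noteq> j \<longrightarrow> (\<forall>c. \<alpha> i \<noteq> Const c * \<alpha> j))"

end

theory Submission
  imports Defs "HOL-Library.Function_Algebras" "HOL-Computational_Algebra.Polynomial"
begin

text \<open>The algebra \<open>C(\<A>)\<close> is the ring of polynomial functions on the set of points
  \<open>(1/\<alpha>\<^sub>1(v), \<dots>, 1/\<alpha>\<^sub>d(v))\<close>. Let \<open>C'\<close> and \<open>C''\<close> be the rings of the arrangements obtained by deleting
  \<open>\<alpha>\<^sub>d\<close> and by restricting to \<open>\<alpha>\<^sub>d = 0\<close>; the restricted forms may be zero or parallel, which is harmless: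
  a zero form makes the ring vanish. With \<open>L = ker (C' \<rightarrow> C'')\<close> there are exact sequences
  \<open>0 \<rightarrow> L \<rightarrow> C' \<rightarrow> C'' \<rightarrow> 0\<close> and \<open>0 \<rightarrow> L[y\<^sub>d](-1) \<rightarrow> C'[y\<^sub>d] \<rightarrow> C \<rightarrow> 0\<close>, the first map of the second one being
  multiplication by \<open>y\<^sub>d - 1/\<alpha>\<^sub>d\<close>. Restriction lowers the dimension of the ambient space, so by induction \<open>C'\<close>
  is \<open>n\<close>-regular and \<open>C''\<close> is \<open>(n-1)\<close>-regular; hence \<open>L\<close> is \<open>n\<close>-regular, and so is \<open>C\<close>. Regularity is
  measured by Koszul homology, which is then compared with Tor along an arbitrary free resolution.\<close>

text \<open>Degree count: in the long exact sequences the homology of L in degree i lies between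
  that of C'' in degree i + 1, with bound (i + 1) + (n - 1) = i + n, and that of C' in degree i. The
  homology of C in degree i lies between that of C'[y_d] in degree i and that of the shifted module
  in degree i - 1, with bound (i - 1) + (n + 1) = i + n. So the dimension lost by restricting pays
  for the shift. The obstacle is that 1/\<alpha>_d does not lie in C', so multiplication by y_d -
  1/\<alpha>_d makes sense only if l/\<alpha>_d is polynomial for every l in L. It is, because such
  an l is a combination of the relations of the restriction, and each of these is the leading
  coefficient in y_d of a relation through \<alpha>_d. This needs every polynomial that vanishes on
  the reciprocal points to lie in the relation ideal; that is proved first, again by deletion and
  restriction, and it also identifies C(A) with the ring of functions.\<close>

section \<open>Koszul complexes\<close>

text \<open>A graded module is given by its pieces \<open>M t\<close>, all inside one abelian group, on which the operator \<open>Y j\<close>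
  plays the role of multiplication by the variable \<open>j\<close>.\<close>

definition graded_submodule :: "nat set \<Rightarrow> (nat \<Rightarrow> 'm \<Rightarrow> 'm::ab_group_add) \<Rightarrow> (int \<Rightarrow> 'm set) \<Rightarrow> bool" where
  "graded_submodule V Y M \<longleftrightarrow>
    (\<forall>t. 0 \<in> M t \<and> (\<forall>x \<in> M t. \<forall>y \<in> M t. x - y \<in> M t)) \<and>
    (\<forall>j \<in> V. \<forall>t. \<forall>x \<in> M t. Y j x \<in> M (t + 1))"

definition commuting_ops :: "(nat \<Rightarrow> 'm \<Rightarrow> 'm::ab_group_add) \<Rightarrow> bool" where
  "commuting_ops Y \<longleftrightarrow>
    (\<forall>j x y. Y j (x + y) = Y j x + Y j y) \<and> (\<forall>i j x. Y i (Y j x) = Y j (Y i x))"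

text \<open>The conditions concern the pieces only, because the maps of a resolution are
  unconstrained outside the carriers.\<close>

definition piecewise_hom :: "nat set \<Rightarrow> (nat \<Rightarrow> 'm \<Rightarrow> 'm::ab_group_add) \<Rightarrow> (int \<Rightarrow> 'm set) \<Rightarrow>
    (nat \<Rightarrow> 'n \<Rightarrow> 'n::ab_group_add) \<Rightarrow> (int \<Rightarrow> 'n set) \<Rightarrow> ('m \<Rightarrow> 'n) \<Rightarrow> bool" where
  "piecewise_hom V Y M Y' N \<phi> \<longleftrightarrow>
    (\<forall>t. \<forall>x \<in> M t. \<phi> x \<in> N t \<and> (\<forall>y \<in> M t. \<phi> (x + y) = \<phi> x + \<phi> y) \<and>
      (\<forall>j \<in> V. \<phi> (Y j x) = Y' j (\<phi> x)))"

lemma graded_submoduleD: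
  assumes "graded_submodule V Y M"
  shows "0 \<in> M t" "x \<in> M t \<Longrightarrow> y \<in> M t \<Longrightarrow> x - y \<in> M t"
    "x \<in> M t \<Longrightarrow> - x \<in> M t" "x \<in> M t \<Longrightarrow> y \<in> M t \<Longrightarrow> x + y \<in> M t"
    "j \<in> V \<Longrightarrow> x \<in> M t \<Longrightarrow> Y j x \<in> M (t + 1)"
proof -
  show 0: "0 \<in> M t" for t using assms by (auto simp: graded_submodule_def)
  show d: "x \<in> M t \<Longrightarrow> y \<in> M t \<Longrightarrow> x - y \<in> M t" for x y t
    using assms by (auto simp: graded_submodule_def)
  show n: "x \<in> M t \<Longrightarrow> - x \<in> M t" for x t using d[OF 0] by (metis diff_0)
  show "x \<in> M t \<Longrightarrow> y \<in> M t \<Longrightarrow> x + y \<in> M t" using d[OF _ n] by (metis diff_minus_eq_add)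
  show "j \<in> V \<Longrightarrow> x \<in> M t \<Longrightarrow> Y j x \<in> M (t + 1)"
    using assms by (auto simp: graded_submodule_def)
qed

lemma commuting_opsD:
  assumes "commuting_ops Y"
  shows "Y j (x + y) = Y j x + Y j y" "Y i (Y j x) = Y j (Y i x)" "Y j 0 = 0"
    "Y j (- x) = - Y j x" "Y j (x - y) = Y j x - Y j y"
proof -
  show a: "Y j (x + y) = Y j x + Y j y" for x y using assms by (auto simp: commuting_ops_def)
  show "Y i (Y j x) = Y j (Y i x)" using assms by (simp add: commuting_ops_def)
  show 0: "Y j 0 = 0" using a[of 0 0] by simp
  show m: "Y j (- x) = - Y j x" for x using a[of x "- x"] 0 by (simp add: eq_neg_iff_add_eq_0 add.commute)
  show "Y j (x - y) = Y j x - Y j y" using a[of x "- y"] m by simp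
qed

lemma piecewise_homD:
  assumes "piecewise_hom V Y M Y' N \<phi>"
  shows "x \<in> M t \<Longrightarrow> \<phi> x \<in> N t"
    "x \<in> M t \<Longrightarrow> y \<in> M t \<Longrightarrow> \<phi> (x + y) = \<phi> x + \<phi> y"
    "j \<in> V \<Longrightarrow> x \<in> M t \<Longrightarrow> \<phi> (Y j x) = Y' j (\<phi> x)"
  using assms by (auto simp: piecewise_hom_def)

lemma piecewise_homD_group:
  assumes "piecewise_hom V Y M Y' N \<phi>" "graded_submodule V Y M"
  shows "\<phi> 0 = 0" "x \<in> M t \<Longrightarrow> \<phi> (- x) = - \<phi> x"
    "x \<in> M t \<Longrightarrow> y \<in> M t \<Longrightarrow> \<phi> (x - y) = \<phi> x - \<phi> y"
proof -
  note h = piecewise_homD[OF assms(1)] and g = graded_submoduleD[OF assms(2)]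
  show 0: "\<phi> 0 = 0" using h(2)[OF g(1) g(1)] by simp
  show n: "x \<in> M t \<Longrightarrow> \<phi> (- x) = - \<phi> x" for x t
    using h(2)[of x t "- x"] g(3) 0 by (simp add: eq_neg_iff_add_eq_0 add.commute)
  show "x \<in> M t \<Longrightarrow> y \<in> M t \<Longrightarrow> \<phi> (x - y) = \<phi> x - \<phi> y"
    using h(2)[of x t "- y"] g(3) n by simp
qed

text \<open>The Koszul differential as an iterated mapping cone; the recursion over the list of variables fixes
  the signs. The value of a chain of homological degree \<open>i\<close> at an \<open>i\<close>-element set \<open>S\<close> is the coefficient
  of the exterior monomial \<open>e\<^sub>S\<close>, so a chain of internal degree \<open>t\<close> takes values in degree \<open>t - i\<close>.\<close>

primrec koszul :: "nat list \<Rightarrow> (nat \<Rightarrow> 'm \<Rightarrow> 'm::ab_group_add) \<Rightarrow> (nat set \<Rightarrow> 'm) \<Rightarrow> nat set \<Rightarrow> 'm" where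
  "koszul [] Y f S = 0"
| "koszul (j # js) Y f S =
    (if j \<in> S then - koszul js Y f S else koszul js Y f S + Y j (f (insert j S)))"

definition koszul_chains :: "nat set \<Rightarrow> (int \<Rightarrow> 'm::ab_group_add set) \<Rightarrow> nat \<Rightarrow> int \<Rightarrow> (nat set \<Rightarrow> 'm) set" where
  "koszul_chains V M i t =
    {f. \<forall>S. if S \<subseteq> V \<and> card S = i then f S \<in> M (t - int i) else f S = 0}"

text \<open>Vanishing of the Koszul homology in homological degree \<open>i\<close> and internal
  degree \<open>t\<close>; for an n-regular module this is needed for all t > i + n.\<close>

definition koszul_exact :: "nat list \<Rightarrow> (nat \<Rightarrow> 'm \<Rightarrow> 'm::ab_group_add) \<Rightarrow> (int \<Rightarrow> 'm set) \<Rightarrow> nat \<Rightarrow> int \<Rightarrow> bool" where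
  "koszul_exact js Y M i t \<longleftrightarrow>
    (\<forall>f \<in> koszul_chains (set js) M i t. (\<forall>S. koszul js Y f S = 0) \<longrightarrow>
      (\<exists>g \<in> koszul_chains (set js) M (Suc i) t. \<forall>S. koszul js Y g S = f S))"

section \<open>Algebra of the Koszul differential\<close>

lemma koszul_cong:
  "(\<And>i. i \<in> set js \<Longrightarrow> i \<notin> S \<Longrightarrow> f (insert i S) = g (insert i S)) \<Longrightarrow> koszul js Y f S = koszul js Y g S"
  by (induction js) auto

lemma koszul_zero: "commuting_ops Y \<Longrightarrow> koszul js Y (\<lambda>_. 0) S = 0"
  by (induction js) (auto simp: commuting_opsD)

lemma koszul_add: "commuting_ops Y \<Longrightarrow> koszul js Y (\<lambda>S. f S + g S) S = koszul js Y f S + koszul js Y g S"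
  by (induction js) (auto simp: commuting_opsD)

lemma koszul_diff: "commuting_ops Y \<Longrightarrow> koszul js Y (\<lambda>S. f S - g S) S = koszul js Y f S - koszul js Y g S"
  by (induction js) (auto simp: commuting_opsD)

lemma koszul_uminus: "commuting_ops Y \<Longrightarrow> koszul js Y (\<lambda>S. - f S) S = - koszul js Y f S"
  by (induction js) (auto simp: commuting_opsD)

lemma koszul_op: "commuting_ops Y \<Longrightarrow> koszul js Y (\<lambda>S. Y j (f S)) S = Y j (koszul js Y f S)"
  by (induction js) (auto simp: commuting_opsD(1,3,4,5) commuting_opsD(2)[of Y j])

lemma koszul_insert:
  "j \<notin> set js \<Longrightarrow> koszul js Y (\<lambda>S. f (insert j S)) S = koszul js Y f (insert j S)"
  by (induction js) (auto simp: insert_commute)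

text \<open>At a set without the head variable \<open>j\<close> two mixed terms appear. They cancel
  because \<open>Y j\<close> commutes with the rest of the differential and sets containing
  \<open>j\<close> carry the opposite sign.\<close>

lemma koszul_koszul:
  assumes "commuting_ops Y" "distinct js"
  shows "koszul js Y (koszul js Y f) S = 0"
  using assms(2)
proof (induction js arbitrary: S)
  case Nil
  then show ?case by simp
next
  case (Cons j js)
  show ?case
  proof (cases "j \<in> S")
    case True
    then have "koszul js Y (koszul (j # js) Y f) S = koszul js Y (\<lambda>S. - koszul js Y f S) S"
      by (intro koszul_cong) auto
    also have "\<dots> = 0" using Cons by (simp add: koszul_uminus[OF assms(1)])
    finally show ?thesis using True by (subst koszul.simps(2)) (simp del: koszul.simps(2))
  next
    case False
    then have "koszul js Y (koszul (j # js) Y f) S =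
        koszul js Y (\<lambda>S. koszul js Y f S + Y j (f (insert j S))) S"
      using Cons.prems by (intro koszul_cong) auto
    also have "\<dots> = Y j (koszul js Y f (insert j S))"
      using Cons by (simp add: koszul_add[OF assms(1)] koszul_op[OF assms(1)] koszul_insert)
    finally have *: "koszul js Y (koszul (j # js) Y f) S = Y j (koszul js Y f (insert j S))" .
    have "koszul (j # js) Y (koszul (j # js) Y f) S =
        koszul js Y (koszul (j # js) Y f) S + Y j (koszul (j # js) Y f (insert j S))"
      using False by (subst koszul.simps(2)) simp
    also have "\<dots> = 0" unfolding * using False by (simp add: commuting_opsD[OF assms(1)])
    finally show ?thesis .
  qed
qed

lemma koszul_mem:
  assumes "graded_submodule V Y M"
  shows "set js \<subseteq> V \<Longrightarrow> (\<And>i. i \<in> set js \<Longrightarrow> i \<notin> S \<Longrightarrow> f (insert i S) \<in> M k) \<Longrightarrow> koszul js Y f S \<in> M (k + 1)"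
  by (induction js) (auto intro!: graded_submoduleD[OF assms])

lemma koszul_hom:
  assumes "graded_submodule V Y M" "piecewise_hom V Y M Y' N \<phi>"
  shows "set js \<subseteq> V \<Longrightarrow> (\<And>i. i \<in> set js \<Longrightarrow> i \<notin> S \<Longrightarrow> f (insert i S) \<in> M k) \<Longrightarrow>
    \<phi> (koszul js Y f S) = koszul js Y' (\<lambda>S. \<phi> (f S)) S"
proof (induction js)
  case Nil
  then show ?case using piecewise_homD_group[OF assms(2,1)] by simp
next
  case (Cons j js)
  have m: "koszul js Y f S \<in> M (k + 1)"
    using Cons.prems by (intro koszul_mem[OF assms(1)]) auto
  show ?case
  proof (cases "j \<in> S")
    case True
    then show ?thesis using Cons piecewise_homD_group(2)[OF assms(2,1) m] by simp
  next
    case False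
    then have f: "f (insert j S) \<in> M k" using Cons.prems by simp
    have "\<phi> (koszul js Y f S + Y j (f (insert j S))) = \<phi> (koszul js Y f S) + \<phi> (Y j (f (insert j S)))"
      using Cons.prems f by (intro piecewise_homD(2)[OF assms(2) m] graded_submoduleD[OF assms(1)]) auto
    with False Cons f piecewise_homD(3)[OF assms(2) _ f, of j] show ?thesis by simp
  qed
qed

lemma koszul_chainsD:
  assumes "f \<in> koszul_chains V M i t"
  shows "S \<subseteq> V \<Longrightarrow> card S = i \<Longrightarrow> f S \<in> M (t - int i)" "\<not> (S \<subseteq> V \<and> card S = i) \<Longrightarrow> f S = 0"
proof -
  have *: "if S \<subseteq> V \<and> card S = i then f S \<in> M (t - int i) else f S = 0"
    using assms unfolding koszul_chains_def by blast
  show "S \<subseteq> V \<Longrightarrow> card S = i \<Longrightarrow> f S \<in> M (t - int i)" using * by simp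
  show "\<not> (S \<subseteq> V \<and> card S = i) \<Longrightarrow> f S = 0" using * by (simp split: if_splits)
qed

lemma koszul_chains_mem:
  assumes "graded_submodule V Y M" "f \<in> koszul_chains U M i t"
  shows "f S \<in> M (t - int i)"
  using assms(2) graded_submoduleD(1)[OF assms(1)] unfolding koszul_chains_def
  by (cases "S \<subseteq> U \<and> card S = i") auto

lemma koszul_chains_hom:
  assumes "graded_submodule V Y M" "piecewise_hom V Y M Y' N \<phi>" "f \<in> koszul_chains U M i t"
  shows "(\<lambda>S. \<phi> (f S)) \<in> koszul_chains U N i t"
  using assms(3) piecewise_homD(1)[OF assms(2)] piecewise_homD_group(1)[OF assms(2,1)]
  unfolding koszul_chains_def by auto

lemma koszul_chains_diff:
  assumes "graded_submodule V Y M" "f \<in> koszul_chains U M i t" "g \<in> koszul_chains U M i t"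
  shows "(\<lambda>S. f S - g S) \<in> koszul_chains U M i t"
  using assms(2,3) graded_submoduleD(2)[OF assms(1)] unfolding koszul_chains_def by auto

lemma koszul_chains_add:
  assumes "graded_submodule V Y M" "f \<in> koszul_chains U M i t" "g \<in> koszul_chains U M i t"
  shows "(\<lambda>S. f S + g S) \<in> koszul_chains U M i t"
  using assms(2,3) graded_submoduleD(4)[OF assms(1)] unfolding koszul_chains_def by auto

lemma koszul_chains_lift:
  assumes "f \<in> koszul_chains U N i t" "\<And>x. x \<in> N (t - int i) \<Longrightarrow> \<exists>y \<in> M (t - int i). \<phi> y = x" "\<phi> 0 = 0"
  obtains g where "g \<in> koszul_chains U M i t" "\<And>S. \<phi> (g S) = f S"
proof -
  have "\<exists>y. (if S \<subseteq> U \<and> card S = i then y \<in> M (t - int i) else y = 0) \<and> \<phi> y = f S" for S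
    using assms(2)[of "f S"] assms(3) koszul_chainsD[OF assms(1), of S]
    by (cases "S \<subseteq> U \<and> card S = i") auto
  then obtain g where "\<And>S. (if S \<subseteq> U \<and> card S = i then g S \<in> M (t - int i) else g S = 0) \<and> \<phi> (g S) = f S"
    by metis
  then show ?thesis by (intro that[of g]) (auto simp: koszul_chains_def)
qed

lemma koszul_chain:
  assumes "commuting_ops Y" "graded_submodule V Y M" "set js \<subseteq> V" "f \<in> koszul_chains (set js) M (Suc i) t"
  shows "koszul js Y f \<in> koszul_chains (set js) M i t"
proof -
  have "koszul js Y f S \<in> M (t - int i)" for S
    using koszul_mem[OF assms(2,3), of S f "t - int (Suc i)"] koszul_chains_mem[OF assms(2,4)] by simp
  moreover have "koszul js Y f S = 0" if "\<not> (S \<subseteq> set js \<and> card S = i)" for S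
  proof -
    have "f (insert k S) = 0" if "k \<in> set js" "k \<notin> S" for k
    proof -
      have "\<not> (insert k S \<subseteq> set js \<and> card (insert k S) = Suc i)"
        using that \<open>\<not> (S \<subseteq> set js \<and> card S = i)\<close>
        by (metis card_insert_disjoint finite_subset insert_subset List.finite_set old.nat.inject)
      then show ?thesis by (rule koszul_chainsD(2)[OF assms(4)])
    qed
    then have "koszul js Y f S = koszul js Y (\<lambda>_. 0) S" by (intro koszul_cong) auto
    then show ?thesis by (simp add: koszul_zero[OF assms(1)])
  qed
  ultimately show ?thesis by (auto simp: koszul_chains_def)
qed

lemma koszul_chains_0:
  assumes "commuting_ops Y" "f \<in> koszul_chains (set js) M 0 t"
  shows "koszul js Y f S = 0"
proof -
  have "f (insert k S) = 0" if "k \<in> set js" "k \<notin> S" for k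
  proof -
    have "\<not> (insert k S \<subseteq> set js \<and> card (insert k S) = 0)"
      by (metis card_0_eq finite_subset insert_not_empty List.finite_set)
    then show ?thesis by (rule koszul_chainsD(2)[OF assms(2)])
  qed
  then have "koszul js Y f S = koszul js Y (\<lambda>_. 0) S" by (intro koszul_cong) auto
  then show ?thesis by (simp add: koszul_zero[OF assms(1)])
qed

lemma koszul_exactD:
  assumes "koszul_exact js Y M i t" "f \<in> koszul_chains (set js) M i t" "\<And>S. koszul js Y f S = 0"
  obtains g where "g \<in> koszul_chains (set js) M (Suc i) t" "\<And>S. koszul js Y g S = f S"
  using assms unfolding koszul_exact_def by metis

lemma koszul_exact_zero_module:
  assumes "\<And>s. M s = {0}" "commuting_ops Y"
  shows "koszul_exact js Y M i t"
  unfolding koszul_exact_def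
proof (intro ballI impI)
  fix f assume f: "f \<in> koszul_chains (set js) M i t"
  then have "f S = 0" for S using assms unfolding koszul_chains_def by (auto split: if_splits)
  then show "\<exists>g\<in>koszul_chains (set js) M (Suc i) t. \<forall>S. koszul js Y g S = f S"
    by (intro bexI[of _ "\<lambda>_. 0"]) (auto simp: koszul_zero assms koszul_chains_def)
qed

section \<open>Koszul homology along a surjection of graded modules\<close>

context
  fixes V :: "nat set" and js :: "nat list"
    and Y :: "nat \<Rightarrow> 'm \<Rightarrow> 'm::ab_group_add" and N :: "int \<Rightarrow> 'm set"
    and Y' :: "nat \<Rightarrow> 'n \<Rightarrow> 'n::ab_group_add" and P :: "int \<Rightarrow> 'n set" and \<psi> :: "'m \<Rightarrow> 'n"
  assumes V: "V = set js" and dist: "distinct js"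
    and Y: "commuting_ops Y" and Y': "commuting_ops Y'"
    and N: "graded_submodule V Y N" and hom: "piecewise_hom V Y N Y' P \<psi>"
    and surj: "\<And>t x. x \<in> P t \<Longrightarrow> \<exists>y \<in> N t. \<psi> y = x"
begin

private lemma js: "set js \<subseteq> V" by (simp add: V)

private lemma hom_koszul: "f \<in> koszul_chains V N i t \<Longrightarrow> \<psi> (koszul js Y f S) = koszul js Y' (\<lambda>S. \<psi> (f S)) S"
  by (rule koszul_hom[OF N hom js koszul_chains_mem[OF N]])

lemma koszul_chains_kernel:
  assumes "f \<in> koszul_chains V N i t" "\<And>S. \<psi> (f S) = 0"
  shows "f \<in> koszul_chains V (\<lambda>t. {x \<in> N t. \<psi> x = 0}) i t"
  using assms unfolding koszul_chains_def by auto

text \<open>The next three lemmas are fragments of the long exact Koszul homology sequence of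
  \<open>0 \<rightarrow> ker \<psi> \<rightarrow> N \<rightarrow> P \<rightarrow> 0\<close>.\<close>

lemma koszul_boundary_in_kernel:
  assumes P: "koszul_exact js Y' P (Suc i) t"
    and f: "f \<in> koszul_chains V N (Suc i) t" and 0: "\<And>S. \<psi> (koszul js Y f S) = 0"
  obtains g where "g \<in> koszul_chains V (\<lambda>t. {x \<in> N t. \<psi> x = 0}) (Suc i) t" "\<And>S. koszul js Y g S = koszul js Y f S"
proof -
  have "\<And>S. koszul js Y' (\<lambda>S. \<psi> (f S)) S = 0" using 0 hom_koszul[OF f] by simp
  then obtain p where p: "p \<in> koszul_chains V P (Suc (Suc i)) t" "\<And>S. koszul js Y' p S = \<psi> (f S)"
    using koszul_exactD[OF P koszul_chains_hom[OF N hom f, unfolded V]] unfolding V by blast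
  obtain q where q: "q \<in> koszul_chains V N (Suc (Suc i)) t" "\<And>S. \<psi> (q S) = p S"
    using koszul_chains_lift[where M = N and N = P and \<phi> = \<psi>, OF p(1) surj piecewise_homD_group(1)[OF hom N]] by blast
  \<comment> \<open>Subtracting the boundary of the lift \<open>q\<close> leaves the differential of
    \<open>f\<close> unchanged and moves its values into the kernel.\<close>
  let ?g = "\<lambda>S. f S - koszul js Y q S"
  have kq: "koszul js Y q \<in> koszul_chains V N (Suc i) t" using koszul_chain[OF Y N js] q(1) V by simp
  have "\<psi> (?g S) = 0" for S
    using piecewise_homD_group(3)[OF hom N koszul_chains_mem[OF N f] koszul_chains_mem[OF N kq]]
      hom_koszul[OF q(1)] q(2) p(2) by simp
  with koszul_chains_diff[OF N f kq] show ?thesis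
    by (intro that[of ?g] koszul_chains_kernel)
      (auto simp: koszul_diff[OF Y] koszul_koszul[OF Y dist])
qed

lemma koszul_exact_kernel:
  assumes P: "koszul_exact js Y' P (Suc i) t" and N': "koszul_exact js Y N i t"
  shows "koszul_exact js Y (\<lambda>t. {x \<in> N t. \<psi> x = 0}) i t"
  unfolding koszul_exact_def
proof (intro ballI impI)
  fix z assume z: "z \<in> koszul_chains (set js) (\<lambda>t. {x \<in> N t. \<psi> x = 0}) i t" and c: "\<forall>S. koszul js Y z S = 0"
  have zN: "z \<in> koszul_chains V N i t" using z unfolding koszul_chains_def V by (auto split: if_splits)
  have z0: "\<psi> (z S) = 0" for S
    using koszul_chainsD[OF z, of S] piecewise_homD_group(1)[OF hom N]
    by (cases "S \<subseteq> set js \<and> card S = i") auto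
  \<comment> \<open>The cycle bounds in \<open>N\<close>; the bounding chain is then replaced by one
    with values in the kernel.\<close>
  obtain f where f: "f \<in> koszul_chains V N (Suc i) t" "\<And>S. koszul js Y f S = z S"
    using koszul_exactD[OF N' zN[unfolded V]] c unfolding V by blast
  then show "\<exists>g\<in>koszul_chains (set js) (\<lambda>t. {x \<in> N t. \<psi> x = 0}) (Suc i) t. \<forall>S. koszul js Y g S = z S"
  proof -
    have "\<And>S. \<psi> (koszul js Y f S) = 0" using z0 f(2) by simp
    from koszul_boundary_in_kernel[OF P f(1) this] show ?thesis using f(2) V by (metis (no_types, lifting))
  qed
qed

lemma koszul_exact_cokernel:
  assumes N': "koszul_exact js Y N i t"
    and M: "\<And>h. i = Suc h \<Longrightarrow> koszul_exact js Y (\<lambda>t. {x \<in> N t. \<psi> x = 0}) h t"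
  shows "koszul_exact js Y' P i t"
  unfolding koszul_exact_def
proof (intro ballI impI)
  fix p assume p: "p \<in> koszul_chains (set js) P i t" and c: "\<forall>S. koszul js Y' p S = 0"
  obtain q where q: "q \<in> koszul_chains V N i t" "\<And>S. \<psi> (q S) = p S"
    using koszul_chains_lift[where M = N and N = P and \<phi> = \<psi>, OF p surj piecewise_homD_group(1)[OF hom N]]
    unfolding V by blast
  \<comment> \<open>The lift \<open>q\<close> of the cycle \<open>p\<close> has its differential in
    the kernel, where it is a cycle and hence bounds some \<open>m\<close>. In degree 0 the
    differential is zero and the zero chain will do.\<close>
  have "\<exists>m \<in> koszul_chains V (\<lambda>t. {x \<in> N t. \<psi> x = 0}) i t. \<forall>S. koszul js Y m S = koszul js Y q S"
  proof (cases i)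
    case 0
    then show ?thesis using q(1) koszul_chains_0[OF Y] V
      by (intro bexI[of _ "\<lambda>_. 0"])
        (auto simp: koszul_zero[OF Y] koszul_chains_def graded_submoduleD(1)[OF N] piecewise_homD_group(1)[OF hom N])
  next
    case (Suc h)
    have "koszul js Y q \<in> koszul_chains V N h t" using koszul_chain[OF Y N js] q(1) V Suc by simp
    moreover have "\<psi> (koszul js Y q S) = 0" for S using hom_koszul[OF q(1)] q(2) c by simp
    ultimately have "koszul js Y q \<in> koszul_chains (set js) (\<lambda>t. {x \<in> N t. \<psi> x = 0}) h t"
      using koszul_chains_kernel unfolding V by blast
    from koszul_exactD[OF M[OF Suc] this koszul_koszul[OF Y dist]] show ?thesis
      unfolding V Suc by blast
  qed
  then obtain m where m: "m \<in> koszul_chains V (\<lambda>t. {x \<in> N t. \<psi> x = 0}) i t" "\<And>S. koszul js Y m S = koszul js Y q S"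
    by blast
  have mN: "m \<in> koszul_chains V N i t" using m(1) unfolding koszul_chains_def by (auto split: if_splits)
  have m0: "\<psi> (m S) = 0" for S
    using koszul_chainsD[OF m(1), of S] piecewise_homD_group(1)[OF hom N]
    by (cases "S \<subseteq> V \<and> card S = i") auto
  have "koszul js Y (\<lambda>S. q S - m S) S = 0" for S by (simp add: koszul_diff[OF Y] m(2))
  then obtain n where n: "n \<in> koszul_chains V N (Suc i) t" "\<And>S. koszul js Y n S = q S - m S"
    using koszul_exactD[OF N' koszul_chains_diff[OF N q(1) mN, unfolded V]] unfolding V by blast
  have "koszul js Y' (\<lambda>S. \<psi> (n S)) S = p S" for S
    using hom_koszul[OF n(1), of S] n(2) q(2) m0
      piecewise_homD_group(3)[OF hom N koszul_chains_mem[OF N q(1)] koszul_chains_mem[OF N mN]] by simp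
  then show "\<exists>g\<in>koszul_chains (set js) P (Suc i) t. \<forall>S. koszul js Y' g S = p S"
    using koszul_chains_hom[OF N hom n(1)] unfolding V by blast
qed

text \<open>Lifting a bounding chain of the image gives a chain whose differential has the right
  image; injectivity on the pieces makes it the right differential.\<close>

lemma koszul_exact_iso:
  assumes inj: "\<And>t x. x \<in> N t \<Longrightarrow> \<psi> x = 0 \<Longrightarrow> x = 0" and P: "koszul_exact js Y' P i t"
  shows "koszul_exact js Y N i t"
  unfolding koszul_exact_def
proof (intro ballI impI)
  fix f assume "f \<in> koszul_chains (set js) N i t" and c: "\<forall>S. koszul js Y f S = 0"
  then have f: "f \<in> koszul_chains V N i t" by (simp add: V)
  have "\<And>S. koszul js Y' (\<lambda>S. \<psi> (f S)) S = 0"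
    using c hom_koszul[OF f] piecewise_homD_group(1)[OF hom N] by metis
  then obtain p where p: "p \<in> koszul_chains V P (Suc i) t" "\<And>S. koszul js Y' p S = \<psi> (f S)"
    using koszul_exactD[OF P koszul_chains_hom[OF N hom f, unfolded V]] unfolding V by blast
  obtain q where q: "q \<in> koszul_chains V N (Suc i) t" "\<And>S. \<psi> (q S) = p S"
    using koszul_chains_lift[where M = N and N = P and \<phi> = \<psi>, OF p(1) surj piecewise_homD_group(1)[OF hom N]] by blast
  have kq: "koszul js Y q \<in> koszul_chains V N i t" using koszul_chain[OF Y N js] q(1) V by simp
  have "koszul js Y q S = f S" for S
  proof -
    have "\<psi> (koszul js Y q S - f S) = 0"
      using hom_koszul[OF q(1), of S] p(2) q(2)
        piecewise_homD_group(3)[OF hom N koszul_chains_mem[OF N kq] koszul_chains_mem[OF N f]] by simp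
    with inj koszul_chains_mem[OF N koszul_chains_diff[OF N kq f], of S] show ?thesis by fastforce
  qed
  with q(1) show "\<exists>g\<in>koszul_chains (set js) N (Suc i) t. \<forall>S. koszul js Y g S = f S" unfolding V by blast
qed

end

text \<open>Adjoining a variable that acts injectively on \<open>N = M \<oplus> Y\<^sub>j N\<close> leaves the homology unchanged:
  modulo boundaries a cycle has all its values in \<open>M\<close>, and there the two summands of the differential
  vanish separately.\<close>

lemma koszul_exact_adjoin:
  assumes dist: "distinct (j # js)" and Y: "commuting_ops Y"
    and N: "graded_submodule (insert j (set js)) Y N" and M: "graded_submodule (set js) Y M"
    and MN: "\<And>t. M t \<subseteq> N t"
    and split: "\<And>t x. x \<in> N t \<Longrightarrow> \<exists>a \<in> M t. \<exists>b \<in> N (t - 1). x = a + Y j b"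
    and indep: "\<And>t a b. a \<in> M t \<Longrightarrow> b \<in> N (t - 1) \<Longrightarrow> a + Y j b = 0 \<Longrightarrow> a = 0 \<and> b = 0"
    and ex: "koszul_exact js Y M i t"
  shows "koszul_exact (j # js) Y N i t"
  unfolding koszul_exact_def
proof (intro ballI impI)
  let ?V = "insert j (set js)"
  fix f assume "f \<in> koszul_chains (set (j # js)) N i t" and c: "\<forall>S. koszul (j # js) Y f S = 0"
  then have f: "f \<in> koszul_chains ?V N i t" by simp
  have "\<exists>a b. (if S \<subseteq> set js \<and> card S = i then a \<in> M (t - int i) \<and> b \<in> N (t - int i - 1) else a = 0 \<and> b = 0)
      \<and> (j \<notin> S \<longrightarrow> f S = a + Y j b)" for S
  proof (cases "S \<subseteq> set js \<and> card S = i")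
    case True
    then show ?thesis using split[OF koszul_chains_mem[OF N f], of S] by auto
  next
    case False
    then have "j \<notin> S \<Longrightarrow> f S = 0" using f unfolding koszul_chains_def by (auto split: if_splits)
    with False show ?thesis by (auto simp: commuting_opsD[OF Y])
  qed
  then obtain a b where ab: "\<And>S. (if S \<subseteq> set js \<and> card S = i then a S \<in> M (t - int i) \<and> b S \<in> N (t - int i - 1) else a S = 0 \<and> b S = 0)"
    and fab: "\<And>S. j \<notin> S \<Longrightarrow> f S = a S + Y j (b S)" by metis
  \<comment> \<open>The chain \<open>h\<close> stores \<open>b S\<close> at
    \<open>insert j S\<close>, so at a set \<open>S\<close> without \<open>j\<close> its
    differential is exactly \<open>Y j (b S)\<close>. Subtracting this boundary from
    \<open>f\<close> leaves \<open>a\<close> on those sets.\<close>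
  define h where "h T = (if j \<in> T then b (T - {j}) else 0)" for T
  have h: "h \<in> koszul_chains ?V N (Suc i) t"
    unfolding koszul_chains_def
  proof (intro CollectI allI)
    fix S
    show "if S \<subseteq> ?V \<and> card S = Suc i then h S \<in> N (t - int (Suc i)) else h S = 0"
    proof (cases "j \<in> S")
      case True
      have "S \<subseteq> ?V \<and> card S = Suc i \<longleftrightarrow> S - {j} \<subseteq> set js \<and> card (S - {j}) = i"
      proof (cases "finite S")
        case True
        with \<open>j \<in> S\<close> show ?thesis using card_Suc_Diff1[of S j] by auto
      next
        case False
        then have "\<not> S - {j} \<subseteq> set js" by (meson List.finite_set finite_Diff_insert finite.emptyI finite_subset finite_Diff2)
        moreover have "\<not> S \<subseteq> ?V" using False by (meson List.finite_set finite_insert finite_subset)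
        ultimately show ?thesis by simp
      qed
      with True ab[of "S - {j}"] show ?thesis by (auto simp: h_def algebra_simps)
    qed (auto simp: h_def graded_submoduleD(1)[OF N])
  qed
  have hj: "koszul js Y h S = 0" if "j \<notin> S" for S
  proof -
    have "koszul js Y h S = koszul js Y (\<lambda>_. 0) S" using that dist by (intro koszul_cong) (auto simp: h_def)
    then show ?thesis by (simp add: koszul_zero[OF Y])
  qed
  define f' where "f' S = f S - koszul (j # js) Y h S" for S
  have f': "f' \<in> koszul_chains ?V N i t"
    unfolding f'_def using koszul_chain[OF Y N, of "j # js"] h f
    by (intro koszul_chains_diff[OF N]) (simp_all del: koszul.simps)
  have cyc: "koszul (j # js) Y f' S = 0" for S
    unfolding f'_def koszul_diff[OF Y] koszul_koszul[OF Y dist] using c by simp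
  have a: "f' S = a S" if "j \<notin> S" for S
  proof -
    have "j \<notin> S \<Longrightarrow> h (insert j S) = b S" by (simp add: h_def)
    with that show ?thesis by (simp add: f'_def fab hj)
  qed
  have aM: "a S \<in> M (t - int i)" for S using ab[of S] graded_submoduleD(1)[OF M] by (auto split: if_splits)
  have kM: "koszul js Y a S \<in> M (t - int i + 1)" for S by (rule koszul_mem[OF M]) (auto simp: aM)
  \<comment> \<open>At a set without \<open>j\<close> the cycle condition is a sum of an element of
    \<open>M\<close> and a value of \<open>Y j\<close>, so \<open>indep\<close> kills both.\<close>
  have z: "koszul js Y a S = 0 \<and> f' (insert j S) = 0" if "j \<notin> S" for S
  proof (rule indep[OF kM])
    show "f' (insert j S) \<in> N (t - int i + 1 - 1)" using koszul_chains_mem[OF N f'] by simp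
    have "koszul js Y f' S = koszul js Y a S" using that dist by (intro koszul_cong a) auto
    then show "koszul js Y a S + Y j (f' (insert j S)) = 0" using cyc[of S] that by simp
  qed
  have z': "koszul js Y a S = 0" for S
  proof (cases "j \<in> S")
    case True
    have "a (insert k S) = 0" for k using ab[of "insert k S"] True dist by (auto split: if_splits)
    then have "koszul js Y a S = koszul js Y (\<lambda>_. 0) S" by (intro koszul_cong) auto
    then show ?thesis by (simp add: koszul_zero[OF Y])
  qed (use z in auto)
  have a0: "a S = 0" if "j \<in> S" for S using ab[of S] that dist by (auto split: if_splits)
  have fa: "f' S = a S" for S
    using a[of S] z[of "S - {j}"] a0[of S] by (cases "j \<in> S") (auto simp: insert_absorb)
  have "a \<in> koszul_chains (set js) M i t" unfolding koszul_chains_def using ab by (auto split: if_splits)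
  then obtain g where g: "g \<in> koszul_chains (set js) M (Suc i) t" "\<And>S. koszul js Y g S = a S"
    using koszul_exactD[OF ex _ z'] by blast
  have gj: "g S = 0" if "j \<in> S" for S
    using g(1) that dist unfolding koszul_chains_def by (auto split: if_splits)
  have g': "g \<in> koszul_chains ?V N (Suc i) t"
    unfolding koszul_chains_def
  proof (intro CollectI allI)
    fix S
    show "if S \<subseteq> ?V \<and> card S = Suc i then g S \<in> N (t - int (Suc i)) else g S = 0"
    proof (cases "S \<subseteq> set js")
      case True
      then show ?thesis using g(1) MN unfolding koszul_chains_def by (auto split: if_splits)
    next
      case False
      then have "g S = 0" using g(1) unfolding koszul_chains_def by (auto split: if_splits)
      then show ?thesis using graded_submoduleD(1)[OF N] by simp
    qed
  qed
  have "koszul (j # js) Y (\<lambda>S. h S + g S) S = f S" for S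
  proof -
    have "koszul (j # js) Y g S = a S" using g(2) gj a0 by (auto simp: commuting_opsD[OF Y])
    moreover have "f S = koszul (j # js) Y h S + a S" using fa[of S] unfolding f'_def by (simp add: algebra_simps)
    ultimately show ?thesis unfolding koszul_add[OF Y] by simp
  qed
  then have "\<forall>S. koszul (j # js) Y (\<lambda>S. h S + g S) S = f S" by blast
  with koszul_chains_add[OF N h g']
  show "\<exists>g\<in>koszul_chains (set (j # js)) N (Suc i) t. \<forall>S. koszul (j # js) Y g S = f S"
    unfolding list.set by blast
qed

section \<open>Polynomials\<close>

abbreviation (input) lookup where "lookup \<equiv> Poly_Mapping.lookup"
abbreviation (input) keys where "keys \<equiv> Poly_Mapping.keys"

lemma keys_sum_expand: "(p :: 'a \<Rightarrow>\<^sub>0 'b::comm_monoid_add) = (\<Sum>m \<in> keys p. Poly_Mapping.single m (lookup p m))"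
proof (rule poly_mapping_eqI)
  fix k
  have "(\<Sum>m \<in> keys p. lookup (Poly_Mapping.single m (lookup p m)) k)
      = (\<Sum>m \<in> keys p. if m = k then lookup p m else 0)"
    by (intro sum.cong) (auto simp: lookup_single when_def)
  also have "\<dots> = lookup p k" by (simp add: in_keys_iff)
  finally show "lookup p k = lookup (\<Sum>m \<in> keys p. Poly_Mapping.single m (lookup p m)) k"
    by (simp add: lookup_sum)
qed

lemma sum_in_closed:
  assumes "Q 0" "\<And>a b. Q a \<Longrightarrow> Q b \<Longrightarrow> Q (a + b)" "\<And>i. i \<in> I \<Longrightarrow> Q (f i)"
  shows "Q (sum f I)"
  using assms(3) by (induction I rule: infinite_finite_induct) (auto intro: assms)

text \<open>Additive properties are checked on single terms. Only monomials of \<open>p\<close>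
  itself are considered, so what is known about its exponents stays available.\<close>

lemma keys_induct:
  fixes p :: "'a \<Rightarrow>\<^sub>0 'b::comm_monoid_add"
  assumes "Q 0" "\<And>a b. Q a \<Longrightarrow> Q b \<Longrightarrow> Q (a + b)"
    "\<And>m c. m \<in> keys p \<Longrightarrow> Q (Poly_Mapping.single m c)"
  shows "Q p"
  by (subst keys_sum_expand) (rule sum_in_closed, use assms in auto)

lemma mdeg_superset: "finite A \<Longrightarrow> keys m \<subseteq> A \<Longrightarrow> mdeg m = (\<Sum>i \<in> A. lookup m i)"
  unfolding mdeg_def by (intro sum.mono_neutral_left) (auto simp: in_keys_iff)

lemma mdeg_add: "mdeg (m + m') = mdeg m + mdeg m'"
proof -
  let ?A = "keys m \<union> keys m'"
  have "mdeg (m + m') = (\<Sum>i \<in> ?A. lookup (m + m') i)"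
    by (intro mdeg_superset) (auto dest: subsetD[OF keys_add])
  also have "\<dots> = (\<Sum>i \<in> ?A. lookup m i) + (\<Sum>i \<in> ?A. lookup m' i)"
    by (simp add: lookup_add sum.distrib)
  also have "\<dots> = mdeg m + mdeg m'" by (simp add: mdeg_superset[of ?A])
  finally show ?thesis .
qed

lemma mdeg_zero [simp]: "mdeg 0 = 0" by (simp add: mdeg_def)

lemma mdeg_single [simp]: "mdeg (Poly_Mapping.single i k) = k" by (cases "k = 0") (auto simp: mdeg_def)

lemma mdeg_eq_0_iff: "mdeg m = 0 \<longleftrightarrow> m = 0"
proof
  assume "mdeg m = 0"
  then have "\<And>i. i \<in> keys m \<Longrightarrow> lookup m i = 0" by (simp add: mdeg_def)
  then have "lookup m i = 0" for i by (cases "i \<in> keys m") (auto simp: in_keys_iff)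
  then show "m = 0" by (intro poly_mapping_eqI) simp
qed simp

lemma polys_in_0 [simp]: "0 \<in> polys_in V" by (simp add: polys_in_def)

lemma polys_in_add: "p \<in> polys_in V \<Longrightarrow> q \<in> polys_in V \<Longrightarrow> p + q \<in> polys_in V"
  unfolding polys_in_def by (auto dest!: subsetD[OF keys_add])

lemma polys_in_uminus: "p \<in> polys_in V \<Longrightarrow> - p \<in> polys_in V"
  unfolding polys_in_def by (auto simp: in_keys_iff)

lemma polys_in_mult: "p \<in> polys_in V \<Longrightarrow> q \<in> polys_in V \<Longrightarrow> p * q \<in> polys_in V"
  unfolding polys_in_def by (auto dest!: subsetD[OF keys_mult] subsetD[OF keys_add])

lemma polys_in_Const [simp]: "Const c \<in> polys_in V"
  by (auto simp: polys_in_def Const_def)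

lemma polys_in_1 [simp]: "1 \<in> polys_in V"
  using polys_in_Const[of 1] by (simp add: Const_def)

lemma hom_polys_subset: "p \<in> hom_polys V k \<Longrightarrow> p \<in> polys_in V" by (simp add: hom_polys_def)

lemma hom_polys_0 [simp]: "0 \<in> hom_polys V k" by (simp add: hom_polys_def)

lemma hom_polys_add: "p \<in> hom_polys V k \<Longrightarrow> q \<in> hom_polys V k \<Longrightarrow> p + q \<in> hom_polys V k"
  unfolding hom_polys_def using polys_in_add by (auto dest!: subsetD[OF keys_add])

lemma hom_polys_uminus: "p \<in> hom_polys V k \<Longrightarrow> - p \<in> hom_polys V k"
  unfolding hom_polys_def using polys_in_uminus by (auto simp: in_keys_iff)

lemma hom_polys_diff: "p \<in> hom_polys V k \<Longrightarrow> q \<in> hom_polys V k \<Longrightarrow> p - q \<in> hom_polys V k"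
  using hom_polys_add[OF _ hom_polys_uminus] by (metis diff_conv_add_uminus)

lemma hom_polys_sum: "(\<And>i. i \<in> I \<Longrightarrow> f i \<in> hom_polys V k) \<Longrightarrow> sum f I \<in> hom_polys V k"
  by (rule sum_in_closed[where Q = "\<lambda>p. p \<in> hom_polys V k"]) (auto intro: hom_polys_add)

lemma hom_polys_mult: "p \<in> hom_polys V k \<Longrightarrow> q \<in> hom_polys V l \<Longrightarrow> p * q \<in> hom_polys V (k + l)"
  unfolding hom_polys_def using polys_in_mult by (auto dest!: subsetD[OF keys_mult] simp: mdeg_add)

lemma hom_polys_Const [simp]: "Const c \<in> hom_polys V 0"
  by (auto simp: hom_polys_def Const_def polys_in_def split: if_splits)

lemma hom_polys_Var: "i \<in> V \<Longrightarrow> Var i \<in> hom_polys V 1"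
  by (auto simp: hom_polys_def Var_def polys_in_def)

lemma polys_in_Var: "i \<in> V \<Longrightarrow> Var i \<in> polys_in V"
  using hom_polys_Var hom_polys_subset by blast

lemma hom_polys_Var_mult: "i \<in> V \<Longrightarrow> p \<in> hom_polys V (k - 1) \<Longrightarrow> Var i * p \<in> hom_polys V k"
  using hom_polys_mult[OF hom_polys_Var] by fastforce

lemma hom_polys_Const_mult: "p \<in> hom_polys V k \<Longrightarrow> Const c * p \<in> hom_polys V k"
  using hom_polys_mult[OF hom_polys_Const] by fastforce

lemma hom_polys_power: "i \<in> V \<Longrightarrow> Var i ^ j \<in> hom_polys V (int j)"
proof (induction j)
  case 0
  then show ?case using hom_polys_Const[of 1] by (simp add: Const_def)
next
  case (Suc j)
  then show ?case using hom_polys_mult[OF hom_polys_Var, of i V "Var i ^ j" "int j"] by (simp add: add.commute)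
qed

lemma hom_polys_prod_Var: "finite S \<Longrightarrow> S \<subseteq> V \<Longrightarrow> (\<Prod>i \<in> S. Var i) \<in> hom_polys V (int (card S))"
proof (induction S rule: finite_induct)
  case empty
  then show ?case using hom_polys_Const[of 1] by (simp add: Const_def)
next
  case (insert i S)
  then show ?case using hom_polys_mult[OF hom_polys_Var, of i V "\<Prod>i \<in> S. Var i" "int (card S)"] by (simp add: add.commute)
qed

lemma hom_polys_mono: "p \<in> hom_polys U k \<Longrightarrow> U \<subseteq> V \<Longrightarrow> p \<in> hom_polys V k"
  by (auto simp: hom_polys_def polys_in_def)

lemma hom_polys_neg: "p \<in> hom_polys V k \<Longrightarrow> k < 0 \<Longrightarrow> p = 0"
  unfolding hom_polys_def keys_eq_empty[symmetric] by fastforce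

lemma hom_polys_degree_0:
  assumes "p \<in> hom_polys V 0" shows "p = Const (lookup p 0)"
proof -
  have "keys p \<subseteq> {0}" using assms by (auto simp: hom_polys_def mdeg_eq_0_iff)
  then show ?thesis
    unfolding Const_def by (intro poly_mapping_eqI) (auto simp: lookup_single when_def in_keys_iff)
qed

lemma hom_polys_empty:
  assumes "p \<in> hom_polys {} k" "k \<noteq> 0" shows "p = 0"
proof -
  have "keys p = {}" using assms by (fastforce simp: hom_polys_def polys_in_def)
  then show ?thesis by simp
qed

lemma hom_polys_split:
  assumes "p \<in> hom_polys (insert d V) k"
  shows "\<exists>a \<in> hom_polys V k. \<exists>b \<in> hom_polys (insert d V) (k - 1). p = a + Var d * b"
proof (rule keys_induct[of _ p])
  show "\<exists>a\<in>hom_polys V k. \<exists>b\<in>hom_polys (insert d V) (k - 1). 0 = a + Var d * b"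
    by (intro bexI[of _ 0]) auto
next
  fix p q
  assume "\<exists>a\<in>hom_polys V k. \<exists>b\<in>hom_polys (insert d V) (k - 1). p = a + Var d * b"
    and "\<exists>a\<in>hom_polys V k. \<exists>b\<in>hom_polys (insert d V) (k - 1). q = a + Var d * b"
  then obtain a b a' b' where "a \<in> hom_polys V k" "b \<in> hom_polys (insert d V) (k - 1)" "p = a + Var d * b"
    "a' \<in> hom_polys V k" "b' \<in> hom_polys (insert d V) (k - 1)" "q = a' + Var d * b'" by blast
  then show "\<exists>a\<in>hom_polys V k. \<exists>b\<in>hom_polys (insert d V) (k - 1). p + q = a + Var d * b"
    by (intro bexI[of _ "a + a'"] bexI[of _ "b + b'"]) (auto simp: algebra_simps intro: hom_polys_add)
next
  fix m :: "nat \<Rightarrow>\<^sub>0 nat" and c :: complex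
  assume "m \<in> keys p"
  with assms have m: "keys m \<subseteq> insert d V" "int (mdeg m) = k"
    by (auto simp: hom_polys_def polys_in_def)
  show "\<exists>a\<in>hom_polys V k. \<exists>b\<in>hom_polys (insert d V) (k - 1). Poly_Mapping.single m c = a + Var d * b"
  proof (cases "d \<in> keys m")
    case False
    then have "Poly_Mapping.single m c \<in> hom_polys V k" using m by (auto simp: hom_polys_def polys_in_def)
    then show ?thesis by (intro bexI[of _ "Poly_Mapping.single m c"] bexI[of _ 0]) auto
  next
    case True
    let ?m = "m - Poly_Mapping.single d 1"
    have e: "m = Poly_Mapping.single d 1 + ?m"
      using True by (intro poly_mapping_eqI) (auto simp: lookup_add lookup_minus lookup_single when_def in_keys_iff)
    have "int (mdeg ?m) = k - 1" using m(2) mdeg_add[of "Poly_Mapping.single d 1" ?m] e by simp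
    moreover have "keys ?m \<subseteq> insert d V"
      by (rule order_trans[OF _ m(1)]) (auto simp: in_keys_iff lookup_minus)
    ultimately have "Poly_Mapping.single ?m c \<in> hom_polys (insert d V) (k - 1)"
      by (auto simp: hom_polys_def polys_in_def)
    moreover have "Poly_Mapping.single m c = Var d * Poly_Mapping.single ?m c"
      using e by (simp add: Var_def mult_single)
    ultimately show ?thesis by (intro bexI[of _ 0] bexI[of _ "Poly_Mapping.single ?m c"]) auto
  qed
qed

lemma hom_polys_decompose:
  assumes "p \<in> hom_polys (insert d V) k"
  shows "\<exists>K q. (\<forall>j. q j \<in> hom_polys V (k - int j)) \<and> p = (\<Sum>j\<le>K. Var d ^ j * q j)"
  using assms
\<comment> \<open>The measure is 0 exactly in negative degrees, where the polynomial is zero; degree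
  0 is already an inductive case.\<close>
proof (induction "nat (k + 1)" arbitrary: k p)
  case 0
  then have "p = 0" using hom_polys_neg by auto
  then show ?case by (intro exI[of _ 0] exI[of _ "\<lambda>_. 0"]) simp
next
  case (Suc n)
  obtain a b where ab: "a \<in> hom_polys V k" "b \<in> hom_polys (insert d V) (k - 1)" "p = a + Var d * b"
    using hom_polys_split[OF Suc.prems] by blast
  have "n = nat (k - 1 + 1)" using Suc.hyps(2) by linarith
  from Suc.hyps(1)[OF this ab(2)] obtain K q where q: "\<And>j. q j \<in> hom_polys V (k - 1 - int j)" "b = (\<Sum>j\<le>K. Var d ^ j * q j)" by blast
  have "p = (\<Sum>j\<le>Suc K. Var d ^ j * case_nat a q j)"
    unfolding sum.atMost_Suc_shift using ab(3) q(2) by (simp add: sum_distrib_left mult.assoc)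
  moreover have "case_nat a q j \<in> hom_polys V (k - int j)" for j
    using ab(1) q(1) by (cases j) (auto simp: algebra_simps)
  ultimately show ?case by blast
qed

lemma lookup_single_mult:
  "lookup (Poly_Mapping.single m a * (p :: cpoly)) (m + k) = a * lookup p k"
  by (rule keys_induct[of "\<lambda>p. lookup (Poly_Mapping.single m a * p) (m + k) = a * lookup p k"])
    (auto simp: mult_single lookup_add algebra_simps lookup_single when_def)

text \<open>If k is a monomial of b, then X_d k has a nonzero coefficient in X_d b, which must be
  cancelled by \<open>a\<close>; but \<open>a\<close> does not involve X_d.\<close>

lemma Var_mult_indep:
  assumes "a \<in> polys_in V" "d \<notin> V" "a + Var d * b = 0"
  shows "a = 0 \<and> b = 0"
proof -
  have "b = 0"
  proof (rule ccontr)
    assume "b \<noteq> 0"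
    then obtain k where k: "lookup b k \<noteq> 0" by (auto simp: poly_mapping_eq_iff fun_eq_iff)
    let ?m = "Poly_Mapping.single d 1 + k"
    have "lookup (a + Var d * b) ?m = lookup a ?m + lookup b k"
      using lookup_single_mult[of "Poly_Mapping.single d 1" 1 b k] by (simp add: lookup_add Var_def)
    then have "lookup a ?m + lookup b k = 0" by (simp add: assms(3))
    then have "?m \<in> keys a" using k by (auto simp: in_keys_iff)
    then have "d \<in> V" using assms(1) unfolding polys_in_def
      by (auto simp: in_keys_iff lookup_add lookup_single subset_iff)
    with assms(2) show False by simp
  qed
  with assms(3) show ?thesis by simp
qed

text \<open>One variable is split off at a time. The multiple of X_d has no constant term, so the
  assumption passes to the part without X_d.\<close>

lemma hom_polys_ideal_of_vars:
  assumes "p \<in> hom_polys V k" "lookup p 0 = 0" "finite V"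
  shows "\<exists>q. (\<forall>j. q j \<in> hom_polys V (k - 1)) \<and> p = (\<Sum>j\<in>V. Var j * q j)"
  using assms(3,1,2)
proof (induction V arbitrary: p rule: finite_induct)
  case empty
  have "p = 0"
  proof (cases "k = 0")
    case True
    then show ?thesis using hom_polys_degree_0 empty by (metis Const_def single_zero)
  qed (use hom_polys_empty empty in auto)
  then show ?case by (intro exI[of _ "\<lambda>_. 0"]) simp
next
  case (insert d V)
  obtain a b where ab: "a \<in> hom_polys V k" "b \<in> hom_polys (insert d V) (k - 1)" "p = a + Var d * b"
    using hom_polys_split insert.prems(1) by blast
  have "lookup (Var d * b) 0 = 0"
  proof -
    have "(0 :: nat \<Rightarrow>\<^sub>0 nat) \<notin> keys (Var d * b)"
    proof
      assume "(0 :: nat \<Rightarrow>\<^sub>0 nat) \<in> keys (Var d * b)"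
      then obtain m where "Poly_Mapping.single d 1 + m = (0 :: nat \<Rightarrow>\<^sub>0 nat)"
        unfolding Var_def by (auto dest!: subsetD[OF keys_mult])
      then have "lookup (Poly_Mapping.single d 1 + m) d = 0" by simp
      then show False by (simp add: lookup_add)
    qed
    then show ?thesis by (simp add: in_keys_iff)
  qed
  then have "lookup a 0 = 0" using insert.prems(2) ab(3) by (simp add: lookup_add)
  then obtain q where q: "\<And>j. q j \<in> hom_polys V (k - 1)" "a = (\<Sum>j\<in>V. Var j * q j)"
    using insert.IH[OF ab(1)] by blast
  have "p = (\<Sum>j\<in>insert d V. Var j * (q(d := b)) j)"
    using ab(3) q(2) insert.hyps by (simp add: add.commute) (auto intro: sum.cong)
  moreover have "(q(d := b)) j \<in> hom_polys (insert d V) (k - 1)" for j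
    using ab(2) hom_polys_mono[OF q(1) subset_insertI] by auto
  ultimately show ?case by blast
qed

subsection \<open>Evaluation\<close>

definition evalp :: "cpoly \<Rightarrow> (nat \<Rightarrow> complex) \<Rightarrow> complex" where
  "evalp p y = (\<Sum>m \<in> keys p. lookup p m * (\<Prod>i \<in> keys m. y i ^ lookup m i))"

lemma evalp_0 [simp]: "evalp 0 y = 0" by (simp add: evalp_def)

lemma evalp_add: "evalp (p + q) y = evalp p y + evalp q y"
  unfolding evalp_def by (rule setsum_keys_plus_distrib) (auto simp: algebra_simps)

lemma evalp_single:
  "evalp (Poly_Mapping.single m c) y = c * (\<Prod>i \<in> keys m. y i ^ lookup m i)"
  by (cases "c = 0") (auto simp: evalp_def)

lemma evalp_Const [simp]: "evalp (Const c) y = c" by (simp add: Const_def evalp_single)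

lemma evalp_1 [simp]: "evalp 1 y = 1" using evalp_Const[of 1 y] by (simp add: Const_def)

lemma evalp_Var [simp]: "evalp (Var i) y = y i" by (simp add: Var_def evalp_single)

lemma evalp_sum: "evalp (sum f I) y = (\<Sum>i\<in>I. evalp (f i) y)"
  by (induction I rule: infinite_finite_induct) (auto simp: evalp_add)

lemma evalp_uminus [simp]: "evalp (- p) y = - evalp p y"
  using evalp_add[of p "- p" y] by (simp add: eq_neg_iff_add_eq_0 add.commute)

lemma evalp_diff: "evalp (p - q) y = evalp p y - evalp q y"
  using evalp_add[of p "- q" y] by simp

lemma monomial_value_add:
  fixes y :: "nat \<Rightarrow> complex"
  shows "(\<Prod>i \<in> keys (m + m'). y i ^ lookup (m + m') i)
    = (\<Prod>i \<in> keys m. y i ^ lookup m i) * (\<Prod>i \<in> keys m'. y i ^ lookup m' i)"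
proof -
  let ?A = "keys m \<union> keys m'"
  have *: "(\<Prod>i \<in> keys k. y i ^ lookup k i) = (\<Prod>i \<in> ?A. y i ^ lookup k i)"
    if "keys k \<subseteq> ?A" for k
    using that by (intro prod.mono_neutral_left) (auto simp: in_keys_iff)
  show ?thesis
    unfolding *[OF keys_add] *[OF Un_upper1] *[OF Un_upper2] by (simp add: lookup_add power_add prod.distrib)
qed

lemma evalp_mult: "evalp (p * q) y = evalp p y * evalp q y"
proof (rule keys_induct[of "\<lambda>p. evalp (p * q) y = evalp p y * evalp q y"])
  fix m :: "nat \<Rightarrow>\<^sub>0 nat" and c :: complex
  show "evalp (Poly_Mapping.single m c * q) y = evalp (Poly_Mapping.single m c) y * evalp q y"
    by (rule keys_induct[of "\<lambda>q. evalp (Poly_Mapping.single m c * q) y = evalp (Poly_Mapping.single m c) y * evalp q y"])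
      (auto simp: mult_single evalp_single monomial_value_add evalp_add algebra_simps)
qed (auto simp: evalp_add algebra_simps)

lemma evalp_power: "evalp (p ^ k) y = evalp p y ^ k"
  by (induction k) (auto simp: evalp_mult)

lemma evalp_prod: "evalp (prod f I) y = (\<Prod>i\<in>I. evalp (f i) y)"
  by (induction I rule: infinite_finite_induct) (auto simp: evalp_mult)

lemma evalp_cong:
  assumes "p \<in> polys_in V" "\<And>i. i \<in> V \<Longrightarrow> y i = y' i"
  shows "evalp p y = evalp p y'"
proof -
  have "(\<Prod>i \<in> keys m. y i ^ lookup m i) = (\<Prod>i \<in> keys m. y' i ^ lookup m i)"
    if "m \<in> keys p" for m
  proof (rule prod.cong)
    fix i assume "i \<in> keys m"
    then have "i \<in> V" using assms(1) that by (auto simp: polys_in_def)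
    then show "y i ^ lookup m i = y' i ^ lookup m i" using assms(2) by simp
  qed simp
  then show ?thesis unfolding evalp_def by (intro sum.cong) simp_all
qed

lemma evalp_scale:
  assumes "p \<in> hom_polys V k"
  shows "evalp p (\<lambda>i. s * y i) = s ^ nat k * evalp p y"
proof -
  have "(\<Prod>i \<in> keys m. (s * y i) ^ lookup m i)
      = s ^ nat k * (\<Prod>i \<in> keys m. y i ^ lookup m i)"
    if "m \<in> keys p" for m
  proof -
    have "mdeg m = nat k" using assms that by (auto simp: hom_polys_def)
    then show ?thesis by (simp add: power_mult_distrib prod.distrib mdeg_def flip: power_sum)
  qed
  then show ?thesis unfolding evalp_def by (simp add: sum_distrib_left mult.left_commute)
qed

lemma tendsto_evalp:
  assumes "p \<in> polys_in V" "\<And>i. i \<in> V \<Longrightarrow> ((\<lambda>s. f s i) \<longlongrightarrow> y i) F"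
  shows "((\<lambda>s. evalp p (f s)) \<longlongrightarrow> evalp p y) F"
  using assms unfolding evalp_def polys_in_def by (intro tendsto_intros) auto

text \<open>A monomial of degree one is a single variable. The second part serves to turn a
  dependency checked on unit vectors into an identity of polynomials.\<close>

lemma evalp_linear:
  assumes "p \<in> hom_polys V 1" "finite V"
  shows "evalp p y = (\<Sum>i\<in>V. lookup p (Poly_Mapping.single i 1) * y i)"
    and "(\<And>i. i \<in> V \<Longrightarrow> lookup p (Poly_Mapping.single i 1) = 0) \<Longrightarrow> p = 0"
proof -
  have *: "\<exists>i \<in> V. m = Poly_Mapping.single i 1" if "m \<in> keys p" for m
  proof -
    have m: "mdeg m = 1" "keys m \<subseteq> V" using assms(1) that by (auto simp: hom_polys_def polys_in_def)
    then have "m \<noteq> 0" by auto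
    then obtain i where i: "i \<in> keys m" by fastforce
    let ?m = "m - Poly_Mapping.single i 1"
    have e: "m = Poly_Mapping.single i 1 + ?m"
      using i by (intro poly_mapping_eqI) (auto simp: lookup_add lookup_minus lookup_single when_def in_keys_iff)
    have "mdeg ?m = 0" using m(1) mdeg_add[of "Poly_Mapping.single i 1" ?m] e by simp
    then have "?m = 0" by (simp add: mdeg_eq_0_iff)
    with e i m(2) show ?thesis by auto
  qed
  show "p = 0" if "\<And>i. i \<in> V \<Longrightarrow> lookup p (Poly_Mapping.single i 1) = 0"
  proof (rule poly_mapping_eqI)
    fix m show "lookup p m = lookup 0 m"
      using *[of m] that by (cases "m \<in> keys p") (auto simp: in_keys_iff)
  qed
  let ?s = "\<lambda>i. Poly_Mapping.single i 1 :: nat \<Rightarrow>\<^sub>0 nat"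
  have inj: "inj_on ?s V" 
  proof (rule inj_onI)
    fix i j :: nat assume "?s i = ?s j"
    then have "keys (?s i) = keys (?s j)" by simp
    then show "i = j" by simp
  qed
  have "evalp p y = (\<Sum>m \<in> ?s ` V. lookup p m * (\<Prod>i \<in> keys m. y i ^ lookup m i))"
    unfolding evalp_def
  proof (rule sum.mono_neutral_left)
    show "keys p \<subseteq> ?s ` V" using * by blast
  qed (use assms(2) in \<open>auto simp: in_keys_iff\<close>)
  also have "\<dots> = (\<Sum>i\<in>V. lookup p (?s i) * y i)"
    by (subst sum.reindex[OF inj]) simp
  finally show "evalp p y = (\<Sum>i\<in>V. lookup p (?s i) * y i)" .
qed

section \<open>Reciprocals of linear forms\<close>

text \<open>All forms are functions on one ambient space, so restricting to a hyperplane only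
  shrinks a subspace \<open>W\<close>; the forms stay the same and no coordinates are
  chosen.\<close>

definition linear_form :: "((nat \<Rightarrow> complex) \<Rightarrow> complex) \<Rightarrow> bool" where
  "linear_form g \<longleftrightarrow> (\<forall>u v. g (u + v) = g u + g v) \<and> (\<forall>s v. g (\<lambda>k. s * v k) = s * g v)"

definition fin_span :: "nat set \<Rightarrow> (nat \<Rightarrow> nat \<Rightarrow> complex) \<Rightarrow> (nat \<Rightarrow> complex) set" where
  "fin_span X w = {v. \<exists>t. v = (\<lambda>k. \<Sum>x\<in>X. t x * w x k)}"

text \<open>Only the number of spanning vectors is bounded; they may be dependent, so no bases are
  required.\<close>

definition dim_le :: "nat \<Rightarrow> (nat \<Rightarrow> complex) set \<Rightarrow> bool" where
  "dim_le m W \<longleftrightarrow> (\<exists>X w. finite X \<and> card X \<le> m \<and> W = fin_span X w)"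

definition lin_subspace :: "(nat \<Rightarrow> complex) set \<Rightarrow> bool" where
  "lin_subspace W \<longleftrightarrow> 0 \<in> W \<and> (\<forall>u \<in> W. \<forall>w \<in> W. \<forall>s. u + (\<lambda>k. s * w k) \<in> W)"

lemma linear_form_zero: "linear_form g \<Longrightarrow> g 0 = 0"
  unfolding linear_form_def by (metis add_cancel_right_right)

lemma linear_form_line: "linear_form g \<Longrightarrow> g (u + (\<lambda>k. s * w k)) = g u + s * g w"
  by (simp add: linear_form_def)

lemma linear_form_sum:
  assumes "linear_form g" "finite X"
  shows "g (\<lambda>k. \<Sum>x\<in>X. t x * w x k) = (\<Sum>x\<in>X. t x * g (w x))"
  using assms(2)
proof (induction X rule: finite_induct)
  case empty
  then show ?case using linear_form_zero[OF assms(1)] by (simp add: zero_fun_def)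
next
  case (insert x X)
  have "(\<lambda>k. \<Sum>x\<in>insert x X. t x * w x k) = (\<lambda>k. \<Sum>x\<in>X. t x * w x k) + (\<lambda>k. t x * w x k)"
    using insert by (auto simp: fun_eq_iff)
  with insert show ?case by (simp only: linear_form_line[OF assms(1)]) simp
qed

lemma lin_subspaceD:
  assumes "lin_subspace W"
  shows "0 \<in> W" "u \<in> W \<Longrightarrow> w \<in> W \<Longrightarrow> u + (\<lambda>k. s * w k) \<in> W" "w \<in> W \<Longrightarrow> (\<lambda>k. s * w k) \<in> W"
proof -
  show 0: "0 \<in> W" and a: "u \<in> W \<Longrightarrow> w \<in> W \<Longrightarrow> u + (\<lambda>k. s * w k) \<in> W" for u w s
    using assms by (auto simp: lin_subspace_def)
  show "w \<in> W \<Longrightarrow> (\<lambda>k. s * w k) \<in> W" using a[OF 0, of w s] by simp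
qed

lemma lin_subspace_kernel: "lin_subspace W \<Longrightarrow> linear_form g \<Longrightarrow> lin_subspace {v \<in> W. g v = 0}"
  unfolding lin_subspace_def by (auto simp: linear_form_zero) (auto simp: linear_form_def)

lemma lin_subspace_fin_span: "lin_subspace (fin_span X w)"
proof -
  have "0 \<in> fin_span X w" unfolding fin_span_def
    by (intro CollectI exI[of _ "\<lambda>_. 0"]) (simp add: fun_eq_iff)
  moreover have "u + (\<lambda>k. s * v k) \<in> fin_span X w" if "u \<in> fin_span X w" "v \<in> fin_span X w" for u v s
  proof -
    from that obtain t t' where "u = (\<lambda>k. \<Sum>x\<in>X. t x * w x k)" "v = (\<lambda>k. \<Sum>x\<in>X. t' x * w x k)"
      by (auto simp: fin_span_def)
    then have "u + (\<lambda>k. s * v k) = (\<lambda>k. \<Sum>x\<in>X. (t x + s * t' x) * w x k)"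
      by (simp add: fun_eq_iff sum.distrib sum_distrib_left algebra_simps)
    then show ?thesis unfolding fin_span_def by (intro CollectI exI[of _ "\<lambda>x. t x + s * t' x"])
  qed
  ultimately show ?thesis by (simp add: lin_subspace_def)
qed

lemma dim_le_kernel:
  assumes W: "dim_le (Suc m) W" and g: "linear_form g" and w0: "w0 \<in> W" "g w0 \<noteq> 0"
  shows "dim_le m {v \<in> W. g v = 0}"
proof -
  obtain X w where X: "finite X" "card X \<le> Suc m" "W = fin_span X w" using W by (auto simp: dim_le_def)
  obtain p where p: "p \<in> X" "g (w p) \<noteq> 0"
  proof (rule ccontr)
    assume "\<not> thesis"
    then have "\<And>p. p \<in> X \<Longrightarrow> g (w p) = 0" using that by blast
    then have "g w0 = 0" using w0(1) X(3) linear_form_sum[OF g X(1)] by (auto simp: fin_span_def)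
    with w0(2) show False by simp
  qed
  define w' where "w' x = (\<lambda>k. w x k - g (w x) / g (w p) * w p k)" for x
  have split: "(\<Sum>x\<in>X - {p}. t x * w' x k) =
      (\<Sum>x\<in>X. t x * w x k) - (\<Sum>x\<in>X. t x * g (w x)) / g (w p) * w p k" for t k
  proof -
    have "(\<Sum>x\<in>X - {p}. t x * w' x k) = (\<Sum>x\<in>X. t x * w' x k)"
      using X(1) p by (intro sum.mono_neutral_left) (auto simp: w'_def)
    also have "\<dots> = (\<Sum>x\<in>X. t x * w x k) - (\<Sum>x\<in>X. t x * g (w x)) / g (w p) * w p k"
      by (simp add: w'_def algebra_simps sum_subtractf sum_distrib_left sum_divide_distrib)
    finally show ?thesis .
  qed
  have "{v \<in> W. g v = 0} = fin_span (X - {p}) w'"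
  proof (intro equalityI subsetI)
    fix v assume "v \<in> {v \<in> W. g v = 0}"
    then obtain t where t: "v = (\<lambda>k. \<Sum>x\<in>X. t x * w x k)" "g v = 0" using X(3) by (auto simp: fin_span_def)
    then have "(\<Sum>x\<in>X. t x * g (w x)) = 0" using linear_form_sum[OF g X(1), of t w] by simp
    then have "v = (\<lambda>k. \<Sum>x\<in>X - {p}. t x * w' x k)" using t(1) split[of t] by simp
    then show "v \<in> fin_span (X - {p}) w'" by (auto simp: fin_span_def)
  next
    fix v assume "v \<in> fin_span (X - {p}) w'"
    then obtain t where t: "v = (\<lambda>k. \<Sum>x\<in>X - {p}. t x * w' x k)" by (auto simp: fin_span_def)
    let ?u = "\<lambda>k. \<Sum>x\<in>X. t x * w x k" and ?s = "- (\<Sum>x\<in>X. t x * g (w x)) / g (w p)"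
    have v: "v = ?u + (\<lambda>k. ?s * w p k)" unfolding t split by (simp add: fun_eq_iff)
    have u: "?u \<in> W" unfolding X(3) fin_span_def by blast
    have "w p = (\<lambda>k. \<Sum>x\<in>X. (if x = p then 1 else 0) * w x k)"
    proof
      fix k
      have "(\<Sum>x\<in>X. (if x = p then 1 else 0) * w x k) = (\<Sum>x\<in>X. if x = p then w x k else 0)"
        by (intro sum.cong) auto
      then show "w p k = (\<Sum>x\<in>X. (if x = p then 1 else 0) * w x k)" using X(1) p(1) by simp
    qed
    then have "w p \<in> W" unfolding X(3) fin_span_def by (intro CollectI exI[of _ "\<lambda>x. if x = p then 1 else 0"])
    with u have "v \<in> W" unfolding v using lin_subspaceD(2)[OF lin_subspace_fin_span] X(3) by blast
    moreover have "g v = 0" unfolding v linear_form_line[OF g] linear_form_sum[OF g X(1)] using p(2) by simp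
    ultimately show "v \<in> {v \<in> W. g v = 0}" by simp
  qed
  moreover have "card (X - {p}) \<le> m" using X p by simp
  ultimately show ?thesis unfolding dim_le_def using X(1) by blast
qed

lemma dim_le_0: "dim_le 0 W \<Longrightarrow> W = {0}"
  unfolding dim_le_def fin_span_def by (auto simp: fun_eq_iff)

lemma dim_le_subspace: "dim_le m W \<Longrightarrow> lin_subspace W"
  using lin_subspace_fin_span by (auto simp: dim_le_def)

text \<open>The coordinates outside \<open>V\<close> are unconstrained. Thus polynomial functions in the variables \<open>V \<union> {d}\<close>
  on \<open>recip_points A V W\<close> form the polynomial ring in \<open>y\<^sub>d\<close> over the coordinate ring of \<open>V\<close>.\<close>

definition recip_points :: "(nat \<Rightarrow> (nat \<Rightarrow> complex) \<Rightarrow> complex) \<Rightarrow> nat set \<Rightarrow> (nat \<Rightarrow> complex) set \<Rightarrow> (nat \<Rightarrow> complex) set" where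
  "recip_points A V W = {y. \<exists>v \<in> W. \<forall>i \<in> V. A i v \<noteq> 0 \<and> y i = inverse (A i v)}"

text \<open>The degree \<open>k\<close> piece of the relation ideal of the forms restricted to
  \<open>W\<close>: a dependency has to hold on \<open>W\<close> only. A relation on
  \<open>S\<close> has degree \<open>card S - 1\<close>, which fixes the degree of its
  cofactor.\<close>

inductive in_ot :: "(nat \<Rightarrow> (nat \<Rightarrow> complex) \<Rightarrow> complex) \<Rightarrow> nat set \<Rightarrow> (nat \<Rightarrow> complex) set \<Rightarrow> int \<Rightarrow> cpoly \<Rightarrow> bool"
  for A V W where
  zero: "in_ot A V W k 0"
| add: "in_ot A V W k p \<Longrightarrow> in_ot A V W k q \<Longrightarrow> in_ot A V W k (p + q)"
| gen: "S \<subseteq> V \<Longrightarrow> (\<And>v. v \<in> W \<Longrightarrow> (\<Sum>i\<in>S. c i * A i v) = 0) \<Longrightarrow> p \<in> hom_polys V (k - int (card S) + 1) \<Longrightarrow>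
    in_ot A V W k (p * ot_relation S c)"

section \<open>The relation ideal\<close>

lemma ot_relation_hom:
  assumes "S \<subseteq> V" "finite V" shows "ot_relation S c \<in> hom_polys V (int (card S) - 1)"
  unfolding ot_relation_def
proof (rule hom_polys_sum)
  fix j assume j: "j \<in> S"
  have S: "finite S" using assms finite_subset by blast
  have "(\<Prod>i\<in>S - {j}. Var i) \<in> hom_polys V (int (card (S - {j})))"
    using assms S by (intro hom_polys_prod_Var) auto
  moreover have "int (card (S - {j})) = int (card S) - 1" using card_Suc_Diff1[OF S j] by linarith
  ultimately show "Const (c j) * (\<Prod>i\<in>S - {j}. Var i) \<in> hom_polys V (int (card S) - 1)"
    by (intro hom_polys_Const_mult) simp
qed

lemma in_ot_hom:
  assumes "in_ot A V W k p" "finite V" shows "p \<in> hom_polys V k"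
  using assms(1)
proof induction
  case (gen S c p k)
  then show ?case using hom_polys_mult[OF gen(3) ot_relation_hom[OF gen(1) assms(2), of c]] by simp
qed (auto intro: hom_polys_add)

text \<open>Dividing by the product of all \<open>y i\<close> turns each omitted variable into its
  reciprocal \<open>a i\<close>, so the relation becomes the linear dependency itself.\<close>

lemma evalp_ot_relation:
  assumes "finite S" "\<And>i. i \<in> S \<Longrightarrow> y i * a i = 1"
  shows "evalp (ot_relation S c) y = (\<Sum>i\<in>S. c i * a i) * (\<Prod>i\<in>S. y i)"
proof -
  have "evalp (ot_relation S c) y = (\<Sum>j\<in>S. c j * (\<Prod>i\<in>S - {j}. y i))"
    by (simp add: ot_relation_def evalp_sum evalp_mult evalp_prod)
  also have "\<dots> = (\<Sum>j\<in>S. c j * a j * (\<Prod>i\<in>S. y i))"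
  proof (rule sum.cong)
    fix j assume j: "j \<in> S"
    have "c j * a j * (\<Prod>i\<in>S. y i) = c j * (y j * a j) * (\<Prod>i\<in>S - {j}. y i)"
      by (subst prod.remove[OF assms(1) j]) (simp add: algebra_simps)
    also have "\<dots> = c j * (\<Prod>i\<in>S - {j}. y i)" by (simp add: assms(2)[OF j])
    finally show "c j * (\<Prod>i\<in>S - {j}. y i) = c j * a j * (\<Prod>i\<in>S. y i)" by (rule sym)
  qed simp
  finally show ?thesis by (simp add: sum_distrib_right)
qed

lemma in_ot_vanishes:
  assumes "in_ot A V W k p" "finite V" "y \<in> recip_points A V W" shows "evalp p y = 0"
  using assms(1)
proof induction
  case (gen S c p k)
  obtain v where v: "v \<in> W" "\<And>i. i \<in> V \<Longrightarrow> A i v \<noteq> 0 \<and> y i = inverse (A i v)"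
    using assms(3) by (auto simp: recip_points_def)
  have "evalp (ot_relation S c) y = (\<Sum>i\<in>S. c i * A i v) * (\<Prod>i\<in>S. y i)"
    using gen(1) assms(2) v(2) finite_subset by (intro evalp_ot_relation) auto
  then show ?case using gen(2)[OF v(1)] by (simp add: evalp_mult)
qed (auto simp: evalp_add)

lemma in_ot_mult:
  assumes "in_ot A V W k p" "q \<in> hom_polys V l" shows "in_ot A V W (l + k) (q * p)"
  using assms
proof induction
  case (gen S c p k)
  have "q * p \<in> hom_polys V (l + k - int (card S) + 1)"
    using hom_polys_mult[OF gen(4,3)] by (simp add: algebra_simps)
  from in_ot.gen[OF gen(1,2) this] show ?case by (simp add: mult.assoc)
qed (auto simp: distrib_left intro: in_ot.intros)

lemma in_ot_mono: "in_ot A U W k p \<Longrightarrow> U \<subseteq> V \<Longrightarrow> in_ot A V W k p"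
proof (induction rule: in_ot.induct)
  case (gen S c p k)
  then show ?case by (intro in_ot.gen) (auto intro: hom_polys_mono)
qed (auto intro: in_ot.intros)

text \<open>The one-term dependency on the index \<open>i\<close> has the empty product 1 as its
  relation, so a form that is zero on \<open>W\<close> makes the ideal the whole ring.\<close>

lemma in_ot_loop:
  assumes "i \<in> V" "\<And>v. v \<in> W \<Longrightarrow> A i v = 0" "p \<in> hom_polys V k" shows "in_ot A V W k p"
proof -
  have "in_ot A V W k (p * ot_relation {i} (\<lambda>_. 1))" using assms by (intro in_ot.gen) auto
  moreover have "ot_relation {i} (\<lambda>_. 1) = 1" by (simp add: ot_relation_def Const_def)
  ultimately show ?thesis by simp
qed

text \<open>The relation of a dependency through \<open>\<alpha>\<^sub>d\<close> is linear in \<open>y\<^sub>d\<close>, and its leading coefficient is the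
  relation of the induced dependency on the hyperplane \<open>\<alpha>\<^sub>d = 0\<close>.\<close>

lemma in_ot_lift:
  assumes A: "\<And>i. linear_form (A i)" and W: "lin_subspace W" and w: "w \<in> W" "A d w = 1"
    and d: "d \<notin> U" and U: "finite U" and l: "in_ot A U {v \<in> W. A d v = 0} k l"
  shows "\<exists>r \<in> hom_polys U (k + 1). in_ot A (insert d U) W (k + 1) (r + Var d * l)"
  using l
proof induction
  case (zero k)
  show ?case by (intro bexI[of _ 0]) (auto intro: in_ot.intros)
next
  case (add k p q)
  then obtain r r' where "r \<in> hom_polys U (k + 1)" "in_ot A (insert d U) W (k + 1) (r + Var d * p)"
    "r' \<in> hom_polys U (k + 1)" "in_ot A (insert d U) W (k + 1) (r' + Var d * q)" by blast
  then have "in_ot A (insert d U) W (k + 1) ((r + Var d * p) + (r' + Var d * q))" "r + r' \<in> hom_polys U (k + 1)"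
    by (auto intro: in_ot.intros hom_polys_add)
  then show ?case by (intro bexI[of _ "r + r'"]) (auto simp: algebra_simps)
next
  case (gen S c p k)
  \<comment> \<open>The dependency on \<open>S\<close> is known only where \<open>A d\<close>
    vanishes. For \<open>v\<close> in \<open>W\<close> the vector \<open>v\<close> minus
    \<open>A d v\<close> times \<open>w\<close> is such a point, and linearity then dictates the
    coefficient at \<open>d\<close>.\<close>
  let ?c = "c(d := - (\<Sum>i\<in>S. c i * A i w))"
  have S: "finite S" "d \<notin> S" using gen(1) U d finite_subset by auto
  have dep: "(\<Sum>i\<in>insert d S. ?c i * A i v) = 0" if v: "v \<in> W" for v
  proof -
    let ?u = "v + (\<lambda>k. (- A d v) * w k)"
    have "?u \<in> W" using lin_subspaceD(2)[OF W v w(1)] .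
    moreover have "A d ?u = 0" by (simp only: linear_form_line[OF A]) (simp add: w(2))
    ultimately have "0 = (\<Sum>i\<in>S. c i * A i ?u)" using gen(2) by auto
    also have "\<dots> = (\<Sum>i\<in>S. c i * A i v) - A d v * (\<Sum>i\<in>S. c i * A i w)"
      by (simp only: linear_form_line[OF A]) (simp add: algebra_simps sum_subtractf sum_distrib_left)
    finally have "(\<Sum>i\<in>S. c i * A i v) = A d v * (\<Sum>i\<in>S. c i * A i w)" by simp
    moreover have "(\<Sum>i\<in>S. ?c i * A i v) = (\<Sum>i\<in>S. c i * A i v)" using S(2) by (intro sum.cong) auto
    ultimately show ?thesis using S by simp
  qed
  let ?r = "p * (Const (?c d) * (\<Prod>i\<in>S. Var i))"
  have "ot_relation (insert d S) ?c = Const (?c d) * (\<Prod>i\<in>S. Var i) + Var d * ot_relation S c"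
  proof -
    have "(\<Sum>j\<in>S. Const (?c j) * (\<Prod>i\<in>insert d S - {j}. Var i)) = (\<Sum>j\<in>S. Var d * (Const (c j) * (\<Prod>i\<in>S - {j}. Var i)))"
    proof (rule sum.cong)
      fix j assume "j \<in> S"
      then have "insert d S - {j} = insert d (S - {j})" "?c j = c j" using S(2) by auto
      with S show "Const (?c j) * (\<Prod>i\<in>insert d S - {j}. Var i) = Var d * (Const (c j) * (\<Prod>i\<in>S - {j}. Var i))"
        by (simp add: algebra_simps)
    qed simp
    moreover have "insert d S - {d} = S" using S(2) by auto
    ultimately show ?thesis using S by (simp add: ot_relation_def sum_distrib_left)
  qed
  then have "p * ot_relation (insert d S) ?c = ?r + Var d * (p * ot_relation S c)"
    by (simp add: algebra_simps)
  moreover have "in_ot A (insert d U) W (k + 1) (p * ot_relation (insert d S) ?c)"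
  proof (rule in_ot.gen)
    show "insert d S \<subseteq> insert d U" using gen(1) by auto
    show "p \<in> hom_polys (insert d U) (k + 1 - int (card (insert d S)) + 1)"
      using hom_polys_mono[OF gen(3) subset_insertI] S by simp
  qed (use dep in auto)
  moreover have "?r \<in> hom_polys U (k - int (card S) + 1 + int (card S))"
    using gen(1) S(1) by (intro hom_polys_mult gen(3) hom_polys_Const_mult hom_polys_prod_Var)
  ultimately show ?case by (intro bexI[of _ ?r]) (auto simp: algebra_simps)
qed

section \<open>Polynomials vanishing on the reciprocal points\<close>

lemma recip_points_insert:
  assumes "d \<notin> U"
  shows "y \<in> recip_points A (insert d U) W \<Longrightarrow> y \<in> recip_points A U W"
    and "y \<in> recip_points A U {v \<in> W. Q v} \<Longrightarrow> y \<in> recip_points A U W"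
    and "y(d := c) \<in> recip_points A U W \<longleftrightarrow> y \<in> recip_points A U W"
proof -
  show "y \<in> recip_points A (insert d U) W \<Longrightarrow> y \<in> recip_points A U W"
    and "y \<in> recip_points A U {v \<in> W. Q v} \<Longrightarrow> y \<in> recip_points A U W"
    by (auto simp: recip_points_def)
  have "\<And>i. i \<in> U \<Longrightarrow> (y(d := c)) i = y i" using assms by auto
  then show "y(d := c) \<in> recip_points A U W \<longleftrightarrow> y \<in> recip_points A U W"
    unfolding recip_points_def by (simp cong: ball_cong)
qed

text \<open>Approaching \<open>u\<close> along \<open>u + s w\<close> makes \<open>y\<^sub>d = 1/s\<close> blow up, so the leading coefficient in \<open>y\<^sub>d\<close> has to
  vanish in the limit.\<close>

lemma leading_coefficient_vanishes:
  assumes A: "\<And>i. linear_form (A i)" and W: "lin_subspace W" and w: "w \<in> W" "A d w = 1"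
    and d: "d \<notin> U" and U: "finite U" and q: "\<And>j. q j \<in> polys_in U"
    and van: "\<And>y. y \<in> recip_points A (insert d U) W \<Longrightarrow> evalp (\<Sum>j\<le>K. Var d ^ j * q j) y = 0"
    and y: "y \<in> recip_points A U {v \<in> W. A d v = 0}"
  shows "evalp (q K) y = 0"
proof -
  obtain u where u: "u \<in> W" "A d u = 0" "\<And>i. i \<in> U \<Longrightarrow> A i u \<noteq> 0 \<and> y i = inverse (A i u)"
    using y by (auto simp: recip_points_def)
  \<comment> \<open>The reciprocal point of u + s w; its coordinate \<open>d\<close> is 1/s because
    \<open>A d u = 0\<close> and \<open>A d w = 1\<close>.\<close>
  define f where "f s i = (if i = d then inverse s else inverse (A i u + s * A i w))" for s i
  \<comment> \<open>This is s^K times the value of the polynomial at \<open>f s\<close>. It vanishes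
    for small nonzero s, while in the limit only the summand j = K survives.\<close>
  let ?g = "\<lambda>s. \<Sum>j\<le>K. s ^ (K - j) * evalp (q j) (f s)"
  have lim: "((\<lambda>s. A i u + s * A i w) \<longlongrightarrow> A i u) (at 0)" for i
    by (auto intro!: tendsto_eq_intros)
  have "((\<lambda>s. f s i) \<longlongrightarrow> y i) (at 0)" if "i \<in> U" for i
  proof -
    have "i \<noteq> d" using that d by auto
    then show ?thesis using tendsto_inverse[OF lim[of i]] u(3)[OF that] by (simp add: f_def)
  qed
  then have "((\<lambda>s. evalp (q j) (f s)) \<longlongrightarrow> evalp (q j) y) (at 0)" for j
    using tendsto_evalp[OF q] by blast
  then have "(?g \<longlongrightarrow> (\<Sum>j\<le>K. 0 ^ (K - j) * evalp (q j) y)) (at 0)"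
    by (intro tendsto_intros) auto
  moreover have "(\<Sum>j\<le>K. 0 ^ (K - j) * evalp (q j) y) = (\<Sum>j\<in>{K}. 0 ^ (K - j) * evalp (q j) y)"
    by (intro sum.mono_neutral_right) auto
  ultimately have "(?g \<longlongrightarrow> evalp (q K) y) (at 0)" by simp
  moreover have "eventually (\<lambda>s. ?g s = 0) (at 0)"
  proof -
    have "eventually (\<lambda>s. \<forall>i\<in>U. A i u + s * A i w \<noteq> 0) (at 0)"
      using tendsto_imp_eventually_ne[OF lim] u(3) U by (intro eventually_ball_finite) auto
    moreover have "eventually (\<lambda>s::complex. s \<noteq> 0) (at 0)" by (simp add: eventually_at_filter)
    ultimately show ?thesis
    proof eventually_elim
      case (elim s)
      let ?v = "u + (\<lambda>k. s * w k)"
      have "?v \<in> W" using lin_subspaceD(2)[OF W u(1) w(1)] .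
      moreover have "A i ?v = A i u + s * A i w" for i by (rule linear_form_line[OF A])
      ultimately have "f s \<in> recip_points A (insert d U) W"
        using elim u(2) w(2) unfolding recip_points_def f_def by (intro CollectI bexI[of _ ?v]) auto
      from van[OF this] have "(\<Sum>j\<le>K. inverse s ^ j * evalp (q j) (f s)) = 0"
        by (simp add: evalp_sum evalp_mult evalp_power f_def)
      then have "0 = s ^ K * (\<Sum>j\<le>K. inverse s ^ j * evalp (q j) (f s))" by simp
      also have "\<dots> = ?g s"
      proof -
        have "s ^ K * (inverse s ^ j * e) = s ^ (K - j) * e" if "j \<le> K" for j e
        proof -
          have "s ^ K = s ^ (K - j) * s ^ j" using that by (simp flip: power_add)
          then show ?thesis using elim(2) by (simp add: field_simps)
        qed
        then show ?thesis unfolding sum_distrib_left by (intro sum.cong) simp_all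
      qed
      finally show ?case by simp
    qed
  qed
  ultimately show ?thesis
    using tendsto_unique[OF _ _ tendsto_eventually, of "at 0" ?g "evalp (q K) y" 0] by simp
qed

text \<open>A point of the deletion with \<open>A d v \<noteq> 0\<close> extends to the full
  arrangement. The others are limits of such points, which is
  \<open>leading_coefficient_vanishes\<close> for a polynomial of degree K = 0 in y_d.\<close>

lemma vanishes_without:
  assumes A: "\<And>i. linear_form (A i)" and W: "lin_subspace W" and w: "w \<in> W" "A d w = 1"
    and d: "d \<notin> U" and U: "finite U" and p: "p \<in> polys_in U"
    and van: "\<And>y. y \<in> recip_points A (insert d U) W \<Longrightarrow> evalp p y = 0"
    and y: "y \<in> recip_points A U W"
  shows "evalp p y = 0"
proof -
  obtain v where v: "v \<in> W" "\<And>i. i \<in> U \<Longrightarrow> A i v \<noteq> 0 \<and> y i = inverse (A i v)"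
    using y by (auto simp: recip_points_def)
  show ?thesis
  proof (cases "A d v = 0")
    case True
    then have "y \<in> recip_points A U {v \<in> W. A d v = 0}" using v unfolding recip_points_def by blast
    then show ?thesis
      using leading_coefficient_vanishes[where A = A, OF A W w d U, of "\<lambda>_. p" 0 y] p van by simp
  next
    case False
    let ?y = "y(d := inverse (A d v))"
    have "?y \<in> recip_points A (insert d U) W"
      using v False d unfolding recip_points_def by (intro CollectI bexI[of _ v]) auto
    from van[OF this] show ?thesis
      using evalp_cong[OF p, of y ?y] d by (metis fun_upd_other)
  qed
qed

text \<open>The leading coefficient in y_d vanishes on the restriction, so by \<open>ot\<close> it
  lifts to a relation linear in y_d. Subtracting multiples of such relations lowers the degree in
  y_d to at most one. The hypothesis \<open>ot\<close> is the induction hypothesis in the proof that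
  vanishing polynomials lie in the relation ideal, and that theorem itself later on.\<close>

lemma vanishing_split:
  assumes A: "\<And>i. linear_form (A i)" and W: "lin_subspace W" and w: "w \<in> W" "A d w = 1"
    and d: "d \<notin> U" and U: "finite U"
    and ot: "\<And>k p. p \<in> hom_polys U k \<Longrightarrow> (\<And>y. y \<in> recip_points A U {v \<in> W. A d v = 0} \<Longrightarrow> evalp p y = 0) \<Longrightarrow>
      in_ot A U {v \<in> W. A d v = 0} k p"
    and p: "p \<in> hom_polys (insert d U) k"
    and van: "\<And>y. y \<in> recip_points A (insert d U) W \<Longrightarrow> evalp p y = 0"
  shows "\<exists>r l p'. r \<in> hom_polys U k \<and> l \<in> hom_polys U (k - 1) \<and> p' \<in> hom_polys (insert d U) (k - 1) \<and>
    p = r + Var d * l + Var d * p' \<and>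
    (\<forall>y \<in> recip_points A (insert d U) W. evalp (r + Var d * l) y = 0 \<and> evalp p' y = 0)"
proof -
  let ?E = "recip_points A (insert d U) W"
  let ?Q = "\<lambda>p k. \<exists>r l p'. r \<in> hom_polys U k \<and> l \<in> hom_polys U (k - 1) \<and> p' \<in> hom_polys (insert d U) (k - 1) \<and>
    p = r + Var d * l + Var d * p' \<and> (\<forall>y \<in> ?E. evalp (r + Var d * l) y = 0 \<and> evalp p' y = 0)"
  have Var_nz: "y d \<noteq> 0" if "y \<in> ?E" for y using that by (auto simp: recip_points_def)
  have "?Q (\<Sum>j\<le>K. Var d ^ j * q j) k"
    if "\<And>j. q j \<in> hom_polys U (k - int j)" "\<And>y. y \<in> ?E \<Longrightarrow> evalp (\<Sum>j\<le>K. Var d ^ j * q j) y = 0" for q K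
    using that
  proof (induction K arbitrary: q)
    case 0
    then show ?case by (intro exI[of _ "q 0"] exI[of _ 0]) (use 0(1)[of 0] in auto)
  next
    case (Suc K)
    let ?l = "q (Suc K)"
    have "?l \<in> hom_polys U (k - int (Suc K))" by (rule Suc.prems)
    moreover have "evalp ?l y = 0" if "y \<in> recip_points A U {v \<in> W. A d v = 0}" for y
      using leading_coefficient_vanishes[where A = A, OF A W w d U hom_polys_subset[OF Suc.prems(1)] Suc.prems(2) that] by simp
    ultimately obtain r where r: "r \<in> hom_polys U (k - int K)" "in_ot A (insert d U) W (k - int K) (r + Var d * ?l)"
      using in_ot_lift[where A = A, OF A W w d U ot] by fastforce
    have rv: "evalp (r + Var d * ?l) y = 0" if "y \<in> ?E" for y
      using in_ot_vanishes[OF r(2) _ that] U by simp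
    \<comment> \<open>For K = 0 the degree in y_d is at most one and p' = 0 serves. Otherwise y_d^K
      times the relation is a multiple of y_d and is absorbed by p'.\<close>
    show ?case
    proof (cases K)
      case 0
      then show ?thesis
        using Suc.prems(1)[of 0] Suc.prems(1)[of 1] Suc.prems(2)
        by (intro exI[of _ "q 0"] exI[of _ "q 1"] exI[of _ 0]) (auto simp: evalp_add evalp_mult)
    next
      case (Suc K')
      \<comment> \<open>Subtracting y_d^K (r + y_d l) removes the top coefficient l and changes the
        next one by r.\<close>
      define q' where "q' = q(K := q K - r)"
      have sum': "(\<Sum>j\<le>Suc K. Var d ^ j * q j) = (\<Sum>j\<le>K. Var d ^ j * q' j) + Var d ^ K * (r + Var d * ?l)"
        by (simp add: q'_def Suc algebra_simps)
      have "?Q (\<Sum>j\<le>K. Var d ^ j * q' j) k"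
      proof (rule Suc.IH)
        show "q' j \<in> hom_polys U (k - int j)" for j
          using Suc.prems(1) r(1) by (auto simp: q'_def intro: hom_polys_diff)
        show "evalp (\<Sum>j\<le>K. Var d ^ j * q' j) y = 0" if "y \<in> ?E" for y
          using Suc.prems(2)[OF that] rv[OF that] unfolding sum' by (simp only: evalp_add evalp_mult) simp
      qed
      then obtain r' l' p' where h: "r' \<in> hom_polys U k" "l' \<in> hom_polys U (k - 1)" "p' \<in> hom_polys (insert d U) (k - 1)"
        "(\<Sum>j\<le>K. Var d ^ j * q' j) = r' + Var d * l' + Var d * p'"
        "\<And>y. y \<in> ?E \<Longrightarrow> evalp (r' + Var d * l') y = 0 \<and> evalp p' y = 0" by blast
      let ?p = "p' + Var d ^ K' * (r + Var d * ?l)"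
      have "Var d ^ K' * (r + Var d * ?l) \<in> hom_polys (insert d U) (int K' + (k - int K))"
        using in_ot_hom[OF r(2)] U by (intro hom_polys_mult hom_polys_power) auto
      then have "?p \<in> hom_polys (insert d U) (k - 1)" using h(3) Suc by (auto intro: hom_polys_add)
      moreover have "(\<Sum>j\<le>Suc K. Var d ^ j * q j) = r' + Var d * l' + Var d * ?p"
        unfolding sum' h(4) by (simp add: Suc algebra_simps)
      moreover have "\<forall>y \<in> ?E. evalp (r' + Var d * l') y = 0 \<and> evalp ?p y = 0"
        using h(5) rv by (simp add: evalp_add evalp_mult)
      ultimately show ?thesis using h(1,2) by blast
    qed
  qed
  note step = this
  obtain K q where q: "\<And>j. q j \<in> hom_polys U (k - int j)" "p = (\<Sum>j\<le>K. Var d ^ j * q j)"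
    using hom_polys_decompose[OF p] by blast
  show ?thesis unfolding q(2) by (rule step[OF q(1) van[unfolded q(2)]])
qed

lemma linear_form_normalize:
  assumes "linear_form g" "lin_subspace W" "\<not> (\<forall>v\<in>W. g v = 0)"
  obtains w where "w \<in> W" "g w = 1"
proof -
  obtain v where v: "v \<in> W" "g v \<noteq> 0" using assms(3) by blast
  have "g (\<lambda>k. inverse (g v) * v k) = inverse (g v) * g v" using assms(1) by (auto simp: linear_form_def)
  with v lin_subspaceD(3)[OF assms(2) v(1)] show ?thesis by (intro that) auto
qed

text \<open>After \<open>vanishing_split\<close> the part p' is settled by induction on the degree.
  The rest r + y_d l is compared with a relation s + y_d l lifted from the restriction: r - s is
  free of y_d and vanishes on the deletion. The outer induction keeps \<open>W\<close> arbitrary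
  because restriction changes it.\<close>

theorem vanishing_imp_in_ot:
  assumes A: "\<And>i. linear_form (A i)" and "finite V" "lin_subspace W" "p \<in> hom_polys V k"
    "\<And>y. y \<in> recip_points A V W \<Longrightarrow> evalp p y = 0"
  shows "in_ot A V W k p"
  using assms(2-)
proof (induction V arbitrary: W k p rule: finite_induct)
  case empty
  \<comment> \<open>With no forms every \<open>y\<close> is a reciprocal point, witnessed by the
    zero vector; so \<open>p\<close> vanishes everywhere.\<close>
  have "0 \<in> W" using lin_subspaceD(1)[OF empty(1)] .
  then have ev: "evalp p y = 0" for y using empty(3)[of y] unfolding recip_points_def by blast
  have "p = 0"
  proof (cases "k = 0")
    case True
    then obtain c where "p = Const c" using hom_polys_degree_0 empty(2) by blast
    moreover from this have "c = 0" using ev by simp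
    ultimately show ?thesis by (simp add: Const_def)
  qed (use empty(2) hom_polys_empty in auto)
  then show ?case by (simp add: in_ot.zero)
next
  case (insert d U)
  note W = \<open>lin_subspace W\<close> and p = \<open>p \<in> hom_polys (insert d U) k\<close>
  let ?E = "recip_points A (insert d U) W"
  show ?case
  proof (cases "\<forall>v\<in>W. A d v = 0")
    case True
    then show ?thesis by (intro in_ot_loop[of d] p) auto
  next
    case False
    then obtain w where w: "w \<in> W" "A d w = 1" using linear_form_normalize[OF A W] by blast
    have ker: "lin_subspace {v \<in> W. A d v = 0}" by (rule lin_subspace_kernel[OF W A])
    have ot: "in_ot A U {v \<in> W. A d v = 0} k p" if "p \<in> hom_polys U k"
      "\<And>y. y \<in> recip_points A U {v \<in> W. A d v = 0} \<Longrightarrow> evalp p y = 0" for k p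
      by (rule insert.IH[OF ker that])
    have "in_ot A (insert d U) W k p" if "p \<in> hom_polys (insert d U) k" "\<And>y. y \<in> ?E \<Longrightarrow> evalp p y = 0" for k p
      using that
    proof (induction "nat (k + 1)" arbitrary: k p)
      case 0
      then have "p = 0" using hom_polys_neg by auto
      then show ?case by (simp add: in_ot.zero)
    next
      case (Suc n)
      obtain r l p' where h: "r \<in> hom_polys U k" "l \<in> hom_polys U (k - 1)" "p' \<in> hom_polys (insert d U) (k - 1)"
        "p = r + Var d * l + Var d * p'" "\<And>y. y \<in> ?E \<Longrightarrow> evalp (r + Var d * l) y = 0 \<and> evalp p' y = 0"
        using vanishing_split[where A = A, OF A W w insert(2,1) ot Suc.prems] by blast
      have "n = nat (k - 1 + 1)" using Suc.hyps(2) by linarith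
      then have p': "in_ot A (insert d U) W (k - 1) p'" using Suc.hyps(1) h(3,5) by blast
      \<comment> \<open>Here l is the leading coefficient of r + y_d l, taken with K = 1.\<close>
      have "evalp l y = 0" if "y \<in> recip_points A U {v \<in> W. A d v = 0}" for y
        using leading_coefficient_vanishes[where A = A, OF A W w insert(2,1), of "\<lambda>j. if j = 0 then r else l" 1 y]
          h(1,2,5) that hom_polys_subset by (auto simp: evalp_add evalp_mult)
      then obtain s where s: "s \<in> hom_polys U k" "in_ot A (insert d U) W k (s + Var d * l)"
        using in_ot_lift[where A = A, OF A W w insert(2,1) ot[OF h(2)]] by fastforce
      have rs: "r - s \<in> hom_polys U k" using h(1) s(1) by (rule hom_polys_diff)
      have "evalp (r - s) y = 0" if "y \<in> ?E" for y
        using h(5)[OF that] in_ot_vanishes[OF s(2) _ that] insert(1) by (simp add: evalp_add evalp_diff add_eq_0_iff2)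
      then have "evalp (r - s) y = 0" if "y \<in> recip_points A U W" for y
        using vanishes_without[where A = A, OF A W w insert(2,1) hom_polys_subset[OF rs]] that by blast
      then have "in_ot A (insert d U) W k (r - s)"
        using insert.IH[OF W rs] in_ot_mono by (meson subset_insertI)
      moreover have "in_ot A (insert d U) W k (Var d * p')"
        using in_ot_mult[OF p' hom_polys_Var, of d] by simp
      ultimately have "in_ot A (insert d U) W k ((r - s) + (s + Var d * l) + Var d * p')"
        using s(2) by (blast intro: in_ot.add)
      then show ?case by (simp add: h(4))
    qed
    then show ?thesis using p insert.prems(3) by blast
  qed
qed

section \<open>Deletion and restriction\<close>

text \<open>The value 0 off \<open>E\<close> makes equality on \<open>E\<close> plain equality, and
  it places the rings of all arrangements in one function type.\<close>

definition poly_fun :: "(nat \<Rightarrow> complex) set \<Rightarrow> cpoly \<Rightarrow> (nat \<Rightarrow> complex) \<Rightarrow> complex" where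
  "poly_fun E p = (\<lambda>y. if y \<in> E then evalp p y else 0)"

definition coord_ring :: "nat set \<Rightarrow> (nat \<Rightarrow> complex) set \<Rightarrow> int \<Rightarrow> ((nat \<Rightarrow> complex) \<Rightarrow> complex) set" where
  "coord_ring V E k = poly_fun E ` hom_polys V k"

definition coord_op :: "nat \<Rightarrow> ((nat \<Rightarrow> complex) \<Rightarrow> complex) \<Rightarrow> (nat \<Rightarrow> complex) \<Rightarrow> complex" where
  "coord_op j f = (\<lambda>y. y j * f y)"

definition restr :: "(nat \<Rightarrow> complex) set \<Rightarrow> ((nat \<Rightarrow> complex) \<Rightarrow> complex) \<Rightarrow> (nat \<Rightarrow> complex) \<Rightarrow> complex" where
  "restr E f = (\<lambda>y. if y \<in> E then f y else 0)"

lemma commuting_coord_op: "commuting_ops coord_op"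
  by (auto simp: commuting_ops_def coord_op_def fun_eq_iff algebra_simps)

lemma poly_fun_0 [simp]: "poly_fun E 0 = 0" by (simp add: poly_fun_def fun_eq_iff)

lemma poly_fun_add: "poly_fun E (p + q) = poly_fun E p + poly_fun E q"
  by (auto simp: poly_fun_def fun_eq_iff evalp_add)

lemma poly_fun_diff: "poly_fun E (p - q) = poly_fun E p - poly_fun E q"
  by (auto simp: poly_fun_def fun_eq_iff evalp_diff)

lemma coord_op_poly_fun: "coord_op j (poly_fun E p) = poly_fun E (Var j * p)"
  by (auto simp: poly_fun_def coord_op_def fun_eq_iff evalp_mult)

lemma poly_fun_eq_0_iff: "poly_fun E p = 0 \<longleftrightarrow> (\<forall>y \<in> E. evalp p y = 0)"
  by (auto simp: poly_fun_def fun_eq_iff)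

lemma restr_poly_fun: "E' \<subseteq> E \<Longrightarrow> restr E' (poly_fun E p) = poly_fun E' p"
  by (auto simp: restr_def poly_fun_def fun_eq_iff)

lemma restr_add: "restr E (f + g) = restr E f + restr E g"
  and restr_diff: "restr E (f - g) = restr E f - restr E g"
  and restr_op: "restr E (coord_op j f) = coord_op j (restr E f)"
  and restr_0: "restr E 0 = 0"
  by (auto simp: restr_def coord_op_def fun_eq_iff)

lemma graded_submodule_coord_ring: "graded_submodule V coord_op (coord_ring V E)"
  unfolding graded_submodule_def coord_ring_def
proof (intro conjI allI ballI)
  show "0 \<in> poly_fun E ` hom_polys V t" for t by (rule image_eqI[of _ _ 0]) auto
  show "x - y \<in> poly_fun E ` hom_polys V t" if "x \<in> poly_fun E ` hom_polys V t" "y \<in> poly_fun E ` hom_polys V t" for x y t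
    using that by (auto simp flip: poly_fun_diff intro: hom_polys_diff)
  show "coord_op j x \<in> poly_fun E ` hom_polys V (t + 1)" if "j \<in> V" "x \<in> poly_fun E ` hom_polys V t" for j x t
    using that by (auto simp: coord_op_poly_fun intro!: imageI hom_polys_Var_mult)
qed

lemma coord_ring_empty: "coord_ring V {} t = {0}"
proof -
  have "poly_fun {} p = 0" for p by (simp add: poly_fun_eq_0_iff)
  then show ?thesis by (auto simp: coord_ring_def intro!: image_eqI[of _ _ 0])
qed

lemma coord_ring_mono: "U \<subseteq> V \<Longrightarrow> coord_ring U E t \<subseteq> coord_ring V E t"
  using hom_polys_mono by (auto simp: coord_ring_def)

lemma piecewise_hom_restr: "E' \<subseteq> E \<Longrightarrow> piecewise_hom V coord_op (coord_ring V E) coord_op (coord_ring V E') (restr E')"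
  by (auto simp: piecewise_hom_def coord_ring_def restr_poly_fun restr_op restr_add)

lemma restr_surj: "E' \<subseteq> E \<Longrightarrow> x \<in> coord_ring V E' t \<Longrightarrow> \<exists>y \<in> coord_ring V E t. restr E' y = x"
  by (auto simp: coord_ring_def restr_poly_fun)

lemma graded_submodule_kernel:
  assumes "graded_submodule V Y M" "piecewise_hom V Y M Y' N \<phi>" "commuting_ops Y'"
  shows "graded_submodule V Y (\<lambda>t. {x \<in> M t. \<phi> x = 0})"
  unfolding graded_submodule_def
  using graded_submoduleD[OF assms(1)] piecewise_homD[OF assms(2)] piecewise_homD_group[OF assms(2,1)]
  by (auto simp: commuting_opsD[OF assms(3)])

lemma koszul_exact_shift:
  assumes "koszul_exact js Y M i (t - 1)" shows "koszul_exact js Y (\<lambda>t. M (t - 1)) i t"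
proof -
  have "koszul_chains V (\<lambda>t. M (t - 1)) i t = koszul_chains V M i (t - 1)" for V i
    by (simp add: koszul_chains_def algebra_simps)
  then show ?thesis using assms by (simp add: koszul_exact_def)
qed

text \<open>Setting y_d = 0 isolates \<open>p\<close>, which is free of y_d. Then \<open>q\<close>,
  which may involve y_d, vanishes wherever y_d is nonzero, and by continuity also at y_d =
  0.\<close>

lemma poly_in_free_coord:
  assumes d: "d \<notin> U" and E: "\<And>y c. y(d := c) \<in> E \<longleftrightarrow> y \<in> E" and p: "p \<in> polys_in U"
    and van: "\<And>y. y \<in> E \<Longrightarrow> evalp p y + y d * evalp q y = 0" and y: "y \<in> E"
  shows "evalp p y = 0" "evalp q y = 0"
proof -
  have pc: "evalp p (y(d := s)) = evalp p y" for s
    using evalp_cong[OF p, of "y(d := s)" y] d by (metis fun_upd_other)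
  have v: "evalp p y + s * evalp q (y(d := s)) = 0" for s
    using van[of "y(d := s)"] y E pc by simp
  show p0: "evalp p y = 0" using v[of 0] by simp
  have q0: "evalp q (y(d := s)) = 0" if "s \<noteq> 0" for s using v[of s] p0 that by simp
  have "((\<lambda>s. evalp q (y(d := s))) \<longlongrightarrow> evalp q (y(d := y d))) (at (y d))"
  proof (rule tendsto_evalp[of _ UNIV])
    show "((\<lambda>s. (y(d := s)) i) \<longlongrightarrow> (y(d := y d)) i) (at (y d))" for i
      by (cases "i = d") (auto intro: tendsto_ident_at)
  qed (simp add: polys_in_def)
  moreover have "eventually (\<lambda>s. evalp q (y(d := s)) = 0) (at (y d))"
  proof (cases "y d = 0")
    case True
    then show ?thesis using q0 by (auto simp: eventually_at_filter)
  next
    case False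
    have "eventually (\<lambda>s::complex. s \<noteq> 0) (at (y d))"
      using tendsto_imp_eventually_ne[OF tendsto_ident_at False] .
    then show ?thesis by eventually_elim (use q0 in auto)
  qed
  ultimately show "evalp q y = 0"
    using tendsto_unique[OF _ _ tendsto_eventually, of "at (y d)" "\<lambda>s. evalp q (y(d := s))" "evalp q y" 0] by simp
qed

text \<open>One step of the induction. Write \<open>C\<close>, \<open>C'\<close>, \<open>C''\<close> for the coordinate rings of the arrangement, its
  deletion and its restriction at \<open>\<alpha>\<^sub>d\<close>. With \<open>L = ker (C' \<rightarrow> C'')\<close>, the kernel of \<open>C'[y\<^sub>d] \<rightarrow> C\<close> is
  \<open>(y\<^sub>d - 1/\<alpha>\<^sub>d) L[y\<^sub>d]\<close>, which is \<open>L[y\<^sub>d]\<close> with degrees shifted by one.\<close>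

lemma koszul_exact_deletion_restriction:
  assumes A: "\<And>i. linear_form (A i)" and W: "lin_subspace W" and w: "w \<in> W" "A d w = 1"
    and dist: "distinct (d # js)"
    and E'_def: "E' = recip_points A (set js) W"
    and E''_def: "E'' = recip_points A (set js) {v \<in> W. A d v = 0}"
    and E_def: "E = recip_points A (insert d (set js)) W"
    and exC': "\<And>i t. t > int i + n \<Longrightarrow> koszul_exact js coord_op (coord_ring (set js) E') i t"
    and exC'': "\<And>i t. t > int i + n \<Longrightarrow> koszul_exact js coord_op (coord_ring (set js) E'') (Suc i) t"
    and t: "t > int i + n"
  shows "koszul_exact (d # js) coord_op (coord_ring (insert d (set js)) E) i t"
proof -
  define U where "U = set js"
  let ?V = "insert d U"
  have d: "d \<notin> U" and U: "finite U" and dist': "distinct js" using dist by (auto simp: U_def)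
  note Edefs = E'_def[folded U_def] E''_def[folded U_def] E_def[folded U_def]
  have E'E: "E \<subseteq> E'" "E'' \<subseteq> E'" "\<And>y c. y(d := c) \<in> E' \<longleftrightarrow> y \<in> E'"
    using recip_points_insert[OF d] unfolding Edefs by auto
  note gC' = graded_submodule_coord_ring[of U E'] and gN = graded_submodule_coord_ring[of ?V E']
    and op = commuting_coord_op
  define L where "L t = {f \<in> coord_ring U E' t. restr E'' f = 0}" for t
  define J where "J t = {f \<in> coord_ring ?V E' t. restr E f = 0}" for t
  \<comment> \<open>On \<open>E\<close> these satisfy r = - l/\<alpha>_d, so they are the elements
    (y_d - 1/\<alpha>_d) l. They play for \<open>J\<close> the role that C' plays for C'[y_d]:
    \<open>J\<close> is the direct sum of \<open>M\<close> and y_d \<open>J\<close>.\<close>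
  define M where "M t = {poly_fun E' (r + Var d * l) | r l. r \<in> hom_polys U t \<and> l \<in> hom_polys U (t - 1) \<and>
    (\<forall>y \<in> E. evalp (r + Var d * l) y = 0)}" for t
  have ker: "lin_subspace {v \<in> W. A d v = 0}" by (rule lin_subspace_kernel[OF W A])
  have ot: "in_ot A U {v \<in> W. A d v = 0} k p" if "p \<in> hom_polys U k" "\<And>y. y \<in> E'' \<Longrightarrow> evalp p y = 0" for k p
    using vanishing_imp_in_ot[where A = A, OF A U ker that(1)] that(2) unfolding Edefs by blast
  have van': "evalp p y = 0" if "p \<in> hom_polys U k" "\<And>y. y \<in> E \<Longrightarrow> evalp p y = 0" "y \<in> E'" for p k y
    using vanishes_without[where A = A, OF A W w d U hom_polys_subset[OF that(1)]] that(2,3) unfolding Edefs by blast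
  have van'': "evalp l y = 0" if "r \<in> hom_polys U t" "l \<in> hom_polys U (t - 1)"
      "\<And>y. y \<in> E \<Longrightarrow> evalp (r + Var d * l) y = 0" "y \<in> E''" for r l t y
    using leading_coefficient_vanishes[where A = A, OF A W w d U, of "\<lambda>j. if j = 0 then r else l" 1 y] that hom_polys_subset
    by (auto simp: evalp_add evalp_mult Edefs)
  have free: "evalp p y = 0 \<and> evalp q y = 0" if "p \<in> hom_polys U k"
      "\<And>y. y \<in> E' \<Longrightarrow> evalp p y + y d * evalp q y = 0" "y \<in> E'" for p q k y
    using poly_in_free_coord[OF d E'E(3) hom_polys_subset[OF that(1)] that(2,3)] by blast

  \<comment> \<open>For C'' homology in degree i + 1 is used, where the bound (i + 1) + (n - 1) is
    again i + n.\<close>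
  have exL: "koszul_exact js coord_op L i t" if "t > int i + n" for i t
    unfolding L_def
    by (rule koszul_exact_kernel[OF U_def dist' op op gC' piecewise_hom_restr[OF E'E(2)] restr_surj[OF E'E(2)]
        exC''[folded U_def, OF that] exC'[folded U_def, OF that]])

  \<comment> \<open>The coordinate \<open>d\<close> is free on \<open>E'\<close>, so C'[y_d] is the
    direct sum of C' and y_d C'[y_d].\<close>
  have exN: "koszul_exact (d # js) coord_op (coord_ring ?V E') i t"
  proof (rule koszul_exact_adjoin[OF dist op gN[unfolded U_def] gC'[unfolded U_def], folded U_def])
    show "coord_ring U E' t \<subseteq> coord_ring ?V E' t" for t by (rule coord_ring_mono) auto
    show "\<exists>a\<in>coord_ring U E' t. \<exists>b\<in>coord_ring ?V E' (t - 1). x = a + coord_op d b"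
      if x: "x \<in> coord_ring ?V E' t" for t x
    proof -
      obtain p where p: "p \<in> hom_polys ?V t" "x = poly_fun E' p" using x by (auto simp: coord_ring_def)
      obtain a b where "a \<in> hom_polys U t" "b \<in> hom_polys ?V (t - 1)" "p = a + Var d * b"
        using hom_polys_split[OF p(1)] by blast
      then show ?thesis using p(2)
        by (intro bexI[of _ "poly_fun E' a"] bexI[of _ "poly_fun E' b"])
          (auto simp: coord_ring_def poly_fun_add coord_op_poly_fun)
    qed
    show "a = 0 \<and> b = 0" if ab: "a \<in> coord_ring U E' t" "b \<in> coord_ring ?V E' (t - 1)" "a + coord_op d b = 0" for t a b
    proof -
      obtain p q where pq: "p \<in> hom_polys U t" "a = poly_fun E' p" "b = poly_fun E' q"
        using ab by (auto simp: coord_ring_def)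
      have "poly_fun E' (p + Var d * q) = 0" using ab(3) pq by (simp add: poly_fun_add coord_op_poly_fun)
      then have "evalp p y + y d * evalp q y = 0" if "y \<in> E'" for y
        using that by (auto simp: poly_fun_eq_0_iff evalp_add evalp_mult)
      from free[OF pq(1) this] show ?thesis by (simp add: pq poly_fun_eq_0_iff)
    qed
    show "koszul_exact js coord_op (coord_ring U E') i t" using exC' t by (simp add: U_def)
  qed

  \<comment> \<open>For functions of degree at most one in y_d this difference is the coefficient of
    y_d. It is read off from the function, not from a representing polynomial, and membership in
    \<open>E'\<close> does not depend on the coordinate \<open>d\<close>.\<close>
  define \<phi> where "\<phi> f = (\<lambda>y. f (y(d := 1)) - f (y(d := 0)))" for f :: "(nat \<Rightarrow> complex) \<Rightarrow> complex"
  have \<phi>: "\<phi> (poly_fun E' (r + Var d * l)) = poly_fun E' l" if "r \<in> hom_polys U t" "l \<in> hom_polys U (t - 1)" for r l t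
  proof
    fix y
    have "evalp r (y(d := s)) = evalp r y" "evalp l (y(d := s)) = evalp l y" for s
      using evalp_cong[OF hom_polys_subset[OF that(1)], of "y(d := s)" y]
        evalp_cong[OF hom_polys_subset[OF that(2)], of "y(d := s)" y] d by (metis fun_upd_other)+
    then show "\<phi> (poly_fun E' (r + Var d * l)) y = poly_fun E' l y"
      using E'E(3) by (simp add: \<phi>_def poly_fun_def evalp_add evalp_mult)
  qed
  have gM: "graded_submodule U coord_op M"
    unfolding graded_submodule_def
  proof (intro conjI allI ballI)
    show "0 \<in> M t" for t unfolding M_def by (intro CollectI exI[of _ 0]) auto
    show "x - y \<in> M t" if xy: "x \<in> M t" "y \<in> M t" for x y t
    proof -
      obtain r l r' l' where rl: "r \<in> hom_polys U t" "l \<in> hom_polys U (t - 1)" "x = poly_fun E' (r + Var d * l)"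
        "\<forall>y\<in>E. evalp (r + Var d * l) y = 0" "r' \<in> hom_polys U t" "l' \<in> hom_polys U (t - 1)"
        "y = poly_fun E' (r' + Var d * l')" "\<forall>y\<in>E. evalp (r' + Var d * l') y = 0"
        using xy by (auto simp: M_def)
      have e: "(r - r') + Var d * (l - l') = (r + Var d * l) - (r' + Var d * l')" by (simp add: algebra_simps)
      have "x - y = poly_fun E' ((r - r') + Var d * (l - l'))" unfolding e poly_fun_diff by (simp add: rl)
      moreover have "\<forall>y\<in>E. evalp ((r - r') + Var d * (l - l')) y = 0" unfolding e evalp_diff using rl by simp
      ultimately show ?thesis unfolding M_def using rl by (auto intro: hom_polys_diff)
    qed
    show "coord_op j x \<in> M (t + 1)" if jx: "j \<in> U" "x \<in> M t" for j x t
    proof -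
      obtain r l where rl: "r \<in> hom_polys U t" "l \<in> hom_polys U (t - 1)" "x = poly_fun E' (r + Var d * l)"
        "\<forall>y\<in>E. evalp (r + Var d * l) y = 0" using jx by (auto simp: M_def)
      have e: "Var j * r + Var d * (Var j * l) = Var j * (r + Var d * l)" by (simp add: algebra_simps)
      have "coord_op j x = poly_fun E' (Var j * r + Var d * (Var j * l))" unfolding e rl(3) coord_op_poly_fun ..
      moreover have "\<forall>y\<in>E. evalp (Var j * r + Var d * (Var j * l)) y = 0" unfolding e evalp_mult using rl by simp
      ultimately show ?thesis
        unfolding M_def using rl jx by (intro CollectI exI[of _ "Var j * r"] exI[of _ "Var j * l"]) (auto intro: hom_polys_Var_mult)
    qed
  qed
  have exM: "koszul_exact js coord_op M i t" if t: "t > int i + n + 1" for i t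
  proof (rule koszul_exact_iso[OF U_def dist' op op gM])
    show "piecewise_hom U coord_op M coord_op (\<lambda>t. L (t - 1)) \<phi>"
      unfolding piecewise_hom_def
    proof (intro allI ballI conjI)
      show "\<phi> x \<in> L (t - 1)" if x: "x \<in> M t" for x t
      proof -
        obtain r l where rl: "r \<in> hom_polys U t" "l \<in> hom_polys U (t - 1)" "x = poly_fun E' (r + Var d * l)"
          "\<forall>y\<in>E. evalp (r + Var d * l) y = 0" using x by (auto simp: M_def)
        have "\<forall>y\<in>E''. evalp l y = 0" using van''[OF rl(1,2)] rl(4) by blast
        then show ?thesis unfolding rl(3) \<phi>[OF rl(1,2)] L_def
          using rl(2) E'E(2) by (auto simp: coord_ring_def restr_poly_fun poly_fun_eq_0_iff)
      qed
      show "\<phi> (x + y) = \<phi> x + \<phi> y" for x y by (simp add: \<phi>_def fun_eq_iff)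
      show "\<phi> (coord_op j x) = coord_op j (\<phi> x)" if "j \<in> U" for j x
      proof -
        have "j \<noteq> d" using that d by auto
        then show ?thesis by (simp add: \<phi>_def coord_op_def fun_eq_iff algebra_simps)
      qed
    qed
    \<comment> \<open>An l that vanishes on \<open>E''\<close> lies in the relation ideal of the
      restriction, and the lifted relation r + y_d l supplies the missing r.\<close>
    show "\<exists>y\<in>M t. \<phi> y = x" if x: "x \<in> L (t - 1)" for t x
    proof -
      obtain l where l: "l \<in> hom_polys U (t - 1)" "x = poly_fun E' l" "\<And>y. y \<in> E'' \<Longrightarrow> evalp l y = 0"
        using x E'E(2) by (auto simp: L_def coord_ring_def restr_poly_fun poly_fun_eq_0_iff)
      obtain r where r: "r \<in> hom_polys U t" "in_ot A ?V W t (r + Var d * l)"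
        using in_ot_lift[where A = A, OF A W w d U ot[OF l(1,3)]] by fastforce
      then have "poly_fun E' (r + Var d * l) \<in> M t"
        unfolding M_def using l(1) in_ot_vanishes[OF r(2)] U unfolding Edefs by blast
      with \<phi>[OF r(1) l(1)] l(2) show ?thesis by blast
    qed
    \<comment> \<open>If l vanishes on \<open>E'\<close>, then r vanishes on \<open>E\<close> and
      therefore, being free of y_d, on \<open>E'\<close>.\<close>
    show "x = 0" if x: "x \<in> M t" "\<phi> x = 0" for t x
    proof -
      obtain r l where rl: "r \<in> hom_polys U t" "l \<in> hom_polys U (t - 1)" "x = poly_fun E' (r + Var d * l)"
        "\<forall>y\<in>E. evalp (r + Var d * l) y = 0" using x by (auto simp: M_def)
      have l: "evalp l y = 0" if "y \<in> E'" for y using x(2) rl(3) \<phi>[OF rl(1,2)] that by (simp add: poly_fun_eq_0_iff)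
      have "evalp r y = 0" if y: "y \<in> E" for y
        using rl(4) y l[OF subsetD[OF E'E(1) y]] by (auto simp: evalp_add evalp_mult)
      from van'[OF rl(1) this] l show ?thesis by (simp add: rl(3) poly_fun_eq_0_iff evalp_add evalp_mult)
    qed
    show "koszul_exact js coord_op (\<lambda>t. L (t - 1)) i t" using t by (intro koszul_exact_shift exL) simp
  qed

  have gJ: "graded_submodule ?V coord_op J"
    unfolding J_def by (rule graded_submodule_kernel[OF gN piecewise_hom_restr[OF E'E(1)] op])
  have JI: "poly_fun E' p \<in> J t" if "p \<in> hom_polys ?V t" "\<And>y. y \<in> E \<Longrightarrow> evalp p y = 0" for p t
    using that E'E(1) by (auto simp: J_def coord_ring_def restr_poly_fun poly_fun_eq_0_iff)
  have JD: "\<exists>p. p \<in> hom_polys ?V t \<and> x = poly_fun E' p \<and> (\<forall>y \<in> E. evalp p y = 0)" if "x \<in> J t" for x t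
    using that E'E(1) by (auto simp: J_def coord_ring_def restr_poly_fun poly_fun_eq_0_iff)
  have exJ: "koszul_exact (d # js) coord_op J i t" if t: "t > int i + n + 1" for i t
  proof (rule koszul_exact_adjoin[OF dist op gJ[unfolded U_def] gM[unfolded U_def], folded U_def])
    show "M t \<subseteq> J t" for t
    proof
      fix x assume "x \<in> M t"
      then obtain r l where rl: "r \<in> hom_polys U t" "l \<in> hom_polys U (t - 1)" "x = poly_fun E' (r + Var d * l)"
        "\<forall>y\<in>E. evalp (r + Var d * l) y = 0" by (auto simp: M_def)
      have "r + Var d * l \<in> hom_polys ?V t"
        using rl(1,2) hom_polys_mono[OF _ subset_insertI] by (intro hom_polys_add hom_polys_Var_mult) auto
      with rl show "x \<in> J t" using JI by blast
    qed
    \<comment> \<open>\<open>vanishing_split\<close> is exactly this decomposition.\<close>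
    show "\<exists>a\<in>M t. \<exists>b\<in>J (t - 1). x = a + coord_op d b" if x: "x \<in> J t" for t x
    proof -
      obtain p where p: "p \<in> hom_polys ?V t" "x = poly_fun E' p" "\<And>y. y \<in> E \<Longrightarrow> evalp p y = 0"
        using JD[OF x] by blast
      obtain r l p' where h: "r \<in> hom_polys U t" "l \<in> hom_polys U (t - 1)" "p' \<in> hom_polys ?V (t - 1)"
        "p = r + Var d * l + Var d * p'" "\<And>y. y \<in> E \<Longrightarrow> evalp (r + Var d * l) y = 0 \<and> evalp p' y = 0"
        using vanishing_split[where A = A, OF A W w d U ot[unfolded Edefs] p(1) p(3)[unfolded Edefs]] unfolding Edefs by blast
      have "poly_fun E' (r + Var d * l) \<in> M t" using h unfolding M_def by blast
      moreover have "poly_fun E' p' \<in> J (t - 1)" using JI h(3,5) by blast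
      ultimately show ?thesis using p(2) h(4) by (metis coord_op_poly_fun poly_fun_add)
    qed
    show "a = 0 \<and> b = 0" if ab: "a \<in> M t" "b \<in> J (t - 1)" "a + coord_op d b = 0" for t a b
    proof -
      obtain r l where rl: "r \<in> hom_polys U t" "l \<in> hom_polys U (t - 1)" "a = poly_fun E' (r + Var d * l)"
        "\<forall>y\<in>E. evalp (r + Var d * l) y = 0" using ab by (auto simp: M_def)
      obtain q where q: "b = poly_fun E' q" "\<And>y. y \<in> E \<Longrightarrow> evalp q y = 0" using JD[OF ab(2)] by blast
      have "poly_fun E' (r + Var d * (l + q)) = a + coord_op d b"
        by (simp add: rl(3) q(1) coord_op_poly_fun poly_fun_add algebra_simps)
      then have "evalp r y + y d * evalp (l + q) y = 0" if "y \<in> E'" for y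
        using that ab(3) by (auto simp: poly_fun_eq_0_iff evalp_add evalp_mult)
      from free[OF rl(1) this] have z: "evalp r y = 0" "evalp (l + q) y = 0" if "y \<in> E'" for y
        using that by auto
      have "evalp l y = 0" if "y \<in> E" for y using z(2)[of y] q(2) E'E(1) that by (auto simp: evalp_add)
      from van'[OF rl(2) this] z show ?thesis
        by (auto simp: rl(3) q(1) poly_fun_eq_0_iff evalp_add evalp_mult)
    qed
    show "koszul_exact js coord_op M i t" using exM t .
  qed

  show ?thesis
    unfolding U_def[symmetric]
  proof (rule koszul_exact_cokernel[OF _ dist op op gN piecewise_hom_restr[OF E'E(1)] restr_surj[OF E'E(1)] exN])
    \<comment> \<open>The bound h + n + 1 for \<open>J\<close> equals i + n.\<close>
    show "koszul_exact (d # js) coord_op (\<lambda>t. {x \<in> coord_ring ?V E' t. restr E x = 0}) h t" if "i = Suc h" for h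
      using exJ[of h t] t that unfolding J_def by simp
  qed (simp add: U_def)
qed

text \<open>The number \<open>n\<close> is the projective dimension of the ambient space, hence
  \<open>Suc n\<close> in the bound on \<open>W\<close>. Forms are removed one at a time for all
  subspaces at once.\<close>

theorem koszul_exact_coord_ring:
  assumes A: "\<And>i. linear_form (A i)" and "distinct js" "dim_le (Suc n) W" "t > int i + int n"
  shows "koszul_exact js coord_op (coord_ring (set js) (recip_points A (set js) W)) i t"
  using assms(2-)
proof (induction js arbitrary: n W i t)
  case Nil
  show ?case
    unfolding koszul_exact_def
  proof (intro ballI impI)
    fix f assume f: "f \<in> koszul_chains (set []) (coord_ring (set []) (recip_points A (set []) W)) i t"
    \<comment> \<open>Without variables the ring consists of constants in degree 0, but the values
      of \<open>f\<close> have degree t - i > n.\<close>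
    have "f S = 0" for S
    proof (cases "S \<subseteq> set [] \<and> card S = i")
      case True
      then have "f S \<in> coord_ring {} (recip_points A {} W) (t - int i)" using koszul_chainsD(1)[OF f] by auto
      then obtain p where "p \<in> hom_polys {} (t - int i)" "f S = poly_fun (recip_points A {} W) p" by (auto simp: coord_ring_def)
      moreover from this have "p = 0" using hom_polys_empty Nil.prems(3) by fastforce
      ultimately show ?thesis by simp
    qed (rule koszul_chainsD(2)[OF f])
    then show "\<exists>g\<in>koszul_chains (set []) (coord_ring (set []) (recip_points A (set []) W)) (Suc i) t. \<forall>S. koszul [] coord_op g S = f S"
      using graded_submoduleD(1)[OF graded_submodule_coord_ring] by (intro bexI[of _ "\<lambda>_. 0"]) (auto simp: koszul_chains_def)
  qed
next
  case (Cons d js)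
  have W: "lin_subspace W" using dim_le_subspace[OF Cons.prems(2)] .
  show ?case
  proof (cases "\<forall>v\<in>W. A d v = 0")
    case True
    then have "recip_points A (set (d # js)) W = {}" by (auto simp: recip_points_def)
    then show ?thesis by (intro koszul_exact_zero_module commuting_coord_op) (simp add: coord_ring_empty)
  next
    case False
    then obtain w where w: "w \<in> W" "A d w = 1" using linear_form_normalize[OF A W] by blast
    let ?W = "{v \<in> W. A d v = 0}"
    have "dim_le n ?W" using dim_le_kernel[OF Cons.prems(2) A w(1)] w(2) by simp
    have ex'': "koszul_exact js coord_op (coord_ring (set js) (recip_points A (set js) ?W)) (Suc i) t"
      if "t > int i + int n" for i t
    proof (cases n)
      case 0
      \<comment> \<open>For n = 0 the induction hypothesis cannot be applied to the restriction. If
        a form is left, it vanishes at the only vector 0 and the ring is zero. If none is left, the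
        ring is the field of constants, but there are no chains in degree i + 1.\<close>
      then have W0: "?W = {0}" using \<open>dim_le n ?W\<close> dim_le_0 by simp
      show ?thesis
      proof (cases js)
        case Nil
        show ?thesis
          unfolding koszul_exact_def
        proof (intro ballI impI)
          fix f assume f: "f \<in> koszul_chains (set js) (coord_ring (set js) (recip_points A (set js) ?W)) (Suc i) t"
          have "f S = 0" for S by (rule koszul_chainsD(2)[OF f]) (auto simp: Nil)
          then show "\<exists>g\<in>koszul_chains (set js) (coord_ring (set js) (recip_points A (set js) ?W)) (Suc (Suc i)) t. \<forall>S. koszul js coord_op g S = f S"
            using graded_submoduleD(1)[OF graded_submodule_coord_ring] by (intro bexI[of _ "\<lambda>_. 0"]) (auto simp: koszul_chains_def Nil)
        qed
      next
        case (Cons j ks)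
        then have "recip_points A (set js) ?W = {}"
          unfolding W0 using linear_form_zero[OF A] by (auto simp: recip_points_def)
        then show ?thesis by (intro koszul_exact_zero_module commuting_coord_op) (simp add: coord_ring_empty)
      qed
    next
      case (Suc m)
      \<comment> \<open>With n = m + 1 the bound for degree i + 1 and dimension m is again i +
        n.\<close>
      then show ?thesis using Cons.IH[of m ?W "Suc i" t] Cons.prems(1) \<open>dim_le n ?W\<close> that by simp
    qed
    show ?thesis
      using koszul_exact_deletion_restriction[where A = A, OF A W w Cons.prems(1) refl refl refl _ ex'' Cons.prems(3)]
        Cons.IH[OF _ Cons.prems(2)] Cons.prems(1) by simp
  qed
qed

section \<open>Free modules and Tor\<close>

lemma lookup_map: "f 0 = 0 \<Longrightarrow> lookup (Poly_Mapping.map f x) b = f (lookup x b)"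
  by (auto simp: Poly_Mapping.map.rep_eq when_def)

text \<open>Reading the constant term as evaluation at the origin makes it multiplicative at
  once.\<close>

lemma evalp_at_0: "evalp p (\<lambda>_. 0) = lookup p 0"
proof -
  have "evalp p (\<lambda>_. 0) = (\<Sum>m \<in> keys p. if m = 0 then lookup p m else 0)"
    unfolding evalp_def
  proof (rule sum.cong)
    fix m :: "nat \<Rightarrow>\<^sub>0 nat"
    have "(\<Prod>i \<in> keys m. (0::complex) ^ lookup m i) = 0" if m: "m \<noteq> 0"
    proof -
      obtain i where "i \<in> keys m" using m by fastforce
      then show ?thesis by (intro prod_zero bexI[of _ i]) (auto simp: in_keys_iff)
    qed
    then show "lookup p m * (\<Prod>i \<in> keys m. 0 ^ lookup m i)
        = (if m = 0 then lookup p m else 0)" by auto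
  qed simp
  then show ?thesis by (simp add: in_keys_iff)
qed

lemma lookup_Var_0 [simp]: "lookup (Var j) 0 = 0"
  by (simp flip: evalp_at_0)

lemma lookup_mult_0: "lookup (p * q :: cpoly) 0 = lookup p 0 * lookup q 0"
  by (simp flip: evalp_at_0 add: evalp_mult)

lemma free_module_simps:
  "carrier (free_module V B bd) = {f. keys f \<subseteq> B \<and> (\<forall>b. lookup f b \<in> polys_in V)}"
  "piece (free_module V B bd) k = {f. keys f \<subseteq> B \<and> (\<forall>b. lookup f b \<in> hom_polys V (k - bd b))}"
  "x \<oplus>\<^bsub>free_module V B bd\<^esub> y = x + y" "\<zero>\<^bsub>free_module V B bd\<^esub> = 0"
  "p \<odot>\<^bsub>free_module V B bd\<^esub> x = Poly_Mapping.map (\<lambda>q. p * q) x"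
  by (simp_all add: free_module_def)

lemma residue_field_simps:
  "carrier residue_field = UNIV" "x \<oplus>\<^bsub>residue_field\<^esub> y = x + y"
  "p \<odot>\<^bsub>residue_field\<^esub> x = lookup p 0 * x" "piece residue_field k = (if k = 0 then UNIV else {0})"
  by (simp_all add: residue_field_def)

lemma free_module_carrier_closed:
  assumes "x \<in> carrier (free_module V B bd)"
  shows "y \<in> carrier (free_module V B bd) \<Longrightarrow> x + y \<in> carrier (free_module V B bd)"
    "- x \<in> carrier (free_module V B bd)"
    "p \<in> polys_in V \<Longrightarrow> Poly_Mapping.map (\<lambda>q. p * q) x \<in> carrier (free_module V B bd)"
proof -
  show "y \<in> carrier (free_module V B bd) \<Longrightarrow> x + y \<in> carrier (free_module V B bd)"
    using assms keys_add[of x y] by (auto simp: free_module_simps lookup_add intro: polys_in_add)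
  show "- x \<in> carrier (free_module V B bd)"
    using assms by (auto simp: free_module_simps in_keys_iff intro: polys_in_uminus)
  show "p \<in> polys_in V \<Longrightarrow> Poly_Mapping.map (\<lambda>q. p * q) x \<in> carrier (free_module V B bd)"
    using assms by (auto simp: free_module_simps lookup_map in_keys_iff intro: polys_in_mult)
qed

lemma zero_in_free_module: "0 \<in> carrier (free_module V B bd)" by (simp add: free_module_simps)

lemma free_module_piece_carrier: "x \<in> piece (free_module V B bd) k \<Longrightarrow> x \<in> carrier (free_module V B bd)"
  by (auto simp: free_module_simps intro: hom_polys_subset)

definition var_op :: "nat \<Rightarrow> ('b \<Rightarrow>\<^sub>0 cpoly) \<Rightarrow> 'b \<Rightarrow>\<^sub>0 cpoly" where
  "var_op j = Poly_Mapping.map (\<lambda>q. Var j * q)"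

lemma lookup_var_op [simp]: "lookup (var_op j x) b = Var j * lookup x b"
  by (simp add: var_op_def lookup_map)

lemma commuting_var_op: "commuting_ops var_op"
  by (auto simp: commuting_ops_def poly_mapping_eq_iff fun_eq_iff lookup_add algebra_simps)

lemma graded_submodule_free_module: "graded_submodule V var_op (piece (free_module V B bd))"
  unfolding graded_submodule_def
proof (intro conjI allI ballI)
  show "0 \<in> piece (free_module V B bd) t" for t by (simp add: free_module_simps)
  show "x - y \<in> piece (free_module V B bd) t" if "x \<in> piece (free_module V B bd) t" "y \<in> piece (free_module V B bd) t" for x y t
    using that order_trans[OF keys_diff[of x y]] by (auto simp: free_module_simps lookup_minus intro: hom_polys_diff)
  show "var_op j x \<in> piece (free_module V B bd) (t + 1)" if j: "j \<in> V" and x: "x \<in> piece (free_module V B bd) t" for j x t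
  proof -
    have "keys (var_op j x) \<subseteq> keys x" by (auto simp: in_keys_iff)
    moreover have "Var j * lookup x b \<in> hom_polys V (t + 1 - bd b)" for b
      using x by (intro hom_polys_Var_mult j) (simp add: free_module_simps algebra_simps)
    ultimately show ?thesis using x by (auto simp: free_module_simps)
  qed
qed

text \<open>Choices made at each basis element are assembled into elements of free modules; choosing
  0 wherever \<open>x\<close> has coefficient 0 keeps the support finite. The index \<open>i\<close>
  allows several elements to be chosen together.\<close>

lemma free_module_piece_choice:
  assumes x: "x \<in> piece (free_module V B bd) t"
    and ch: "\<And>b. \<exists>g. R (lookup x b) g \<and> (\<forall>i. g i \<in> hom_polys (U i) (s i - bd b))"
    and 0: "R 0 (\<lambda>_. 0)"
  obtains g where "\<And>i. g i \<in> piece (free_module (U i) B bd) (s i)"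
    "\<And>b. R (lookup x b) (\<lambda>i. lookup (g i) b)"
proof -
  have "\<exists>g. R (lookup x b) g \<and> (\<forall>i. g i \<in> hom_polys (U i) (s i - bd b)) \<and>
      (lookup x b = 0 \<longrightarrow> g = (\<lambda>_. 0))" for b
    using ch[of b] 0 hom_polys_0 by (cases "lookup x b = 0") auto
  then obtain g where g: "\<And>b. R (lookup x b) (g b)" "\<And>b i. g b i \<in> hom_polys (U i) (s i - bd b)"
    "\<And>b. lookup x b = 0 \<Longrightarrow> g b = (\<lambda>_. 0)" by metis
  have sub: "{b. g b i \<noteq> 0} \<subseteq> keys x" for i using g(3) by (auto simp: in_keys_iff fun_eq_iff)
  then have l: "lookup (Abs_poly_mapping (\<lambda>b. g b i)) = (\<lambda>b. g b i)" for i
    by (intro lookup_Abs_poly_mapping) (meson finite_keys finite_subset)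
  have "keys (Abs_poly_mapping (\<lambda>b. g b i)) \<subseteq> B" for i
    using sub[of i] x l by (auto simp: in_keys_iff free_module_simps)
  then show ?thesis using g by (intro that[of "\<lambda>i. Abs_poly_mapping (\<lambda>b. g b i)"]) (auto simp: free_module_simps l)
qed

lemma free_module_piece_split:
  assumes "x \<in> piece (free_module (insert d U) B bd) t"
  shows "\<exists>a \<in> piece (free_module U B bd) t. \<exists>b \<in> piece (free_module (insert d U) B bd) (t - 1). x = a + var_op d b"
proof -
  have "\<exists>g. lookup x b = g 0 + Var d * g (Suc 0) \<and>
      (\<forall>i. g i \<in> hom_polys (if i = 0 then U else insert d U) ((if i = 0 then t else t - 1) - bd b))" for b
  proof -
    have "lookup x b \<in> hom_polys (insert d U) (t - bd b)" using assms by (simp add: free_module_simps)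
    from hom_polys_split[OF this] obtain p q where pq: "p \<in> hom_polys U (t - bd b)" "q \<in> hom_polys (insert d U) (t - bd b - 1)"
      "lookup x b = p + Var d * q" by blast
    then show ?thesis by (intro exI[of _ "\<lambda>i. if i = 0 then p else q"]) (auto simp: algebra_simps)
  qed
  then obtain g where g: "\<And>i::nat. g i \<in> piece (free_module (if i = 0 then U else insert d U) B bd) (if i = 0 then t else t - 1)"
    "\<And>b. lookup x b = lookup (g 0) b + Var d * lookup (g (Suc 0)) b"
    using free_module_piece_choice[where R = "\<lambda>p g. p = g (0::nat) + Var d * g (Suc 0)"
      and U = "\<lambda>i. if i = 0 then U else insert d U" and s = "\<lambda>i. if i = 0 then t else t - 1", OF assms] by auto
  have "x = g 0 + var_op d (g (Suc 0))" by (auto simp: poly_mapping_eq_iff fun_eq_iff lookup_add g(2))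
  then show ?thesis using g(1)[of 0] g(1)[of "Suc 0"] by auto
qed

text \<open>Membership in \<open>\<mm>F\<close>, where \<open>\<mm>\<close> is the ideal generated by the variables.\<close>

definition const_terms_zero :: "('b \<Rightarrow>\<^sub>0 cpoly) \<Rightarrow> bool" where
  "const_terms_zero x \<longleftrightarrow> (\<forall>b. lookup (lookup x b) 0 = 0)"

lemma const_terms_zero_imp_sum:
  assumes "x \<in> piece (free_module V B bd) t" "const_terms_zero x" "finite V"
  obtains g where "\<And>j. g j \<in> piece (free_module V B bd) (t - 1)" "x = (\<Sum>j\<in>V. var_op j (g j))"
proof -
  have "\<exists>g. lookup x b = (\<Sum>j\<in>V. Var j * g j) \<and> (\<forall>j. g j \<in> hom_polys V (t - 1 - bd b))" for b
    using hom_polys_ideal_of_vars[of "lookup x b" V "t - bd b"] assms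
    by (auto simp: free_module_simps const_terms_zero_def algebra_simps)
  then obtain g where g: "\<And>j. g j \<in> piece (free_module V B bd) (t - 1)"
    "\<And>b. lookup x b = (\<Sum>j\<in>V. Var j * lookup (g j) b)"
    using free_module_piece_choice[OF assms(1), of "\<lambda>p g. p = (\<Sum>j\<in>V. Var j * g j)" "\<lambda>_. V" "\<lambda>_. t - 1"] by auto
  moreover have "x = (\<Sum>j\<in>V. var_op j (g j))" by (auto simp: poly_mapping_eq_iff fun_eq_iff lookup_sum g(2))
  ultimately show ?thesis using that by blast
qed

lemma const_terms_zero_op: "const_terms_zero (var_op j x)"
  by (simp add: const_terms_zero_def lookup_mult_0)

lemma const_terms_zero_add: "const_terms_zero x \<Longrightarrow> const_terms_zero y \<Longrightarrow> const_terms_zero (x + y)"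
  by (simp add: const_terms_zero_def lookup_add)

lemma const_terms_zero_0: "const_terms_zero 0" by (simp add: const_terms_zero_def)

lemma const_terms_zero_uminus: "const_terms_zero x \<Longrightarrow> const_terms_zero (- x)"
  by (simp add: const_terms_zero_def)

text \<open>Each variable is adjoined by \<open>koszul_exact_adjoin\<close>, since it acts
  injectively on polynomials. With no variables there are no chains in positive degree.\<close>

theorem koszul_exact_free_module:
  "distinct js \<Longrightarrow> koszul_exact js var_op (piece (free_module (set js) B bd)) (Suc i) t"
proof (induction js)
  case Nil
  show ?case
    unfolding koszul_exact_def
  proof (intro ballI impI)
    fix f :: "nat set \<Rightarrow> 'a \<Rightarrow>\<^sub>0 cpoly"
    assume f: "f \<in> koszul_chains (set []) (piece (free_module (set []) B bd)) (Suc i) t"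
    have "f S = 0" for S by (rule koszul_chainsD(2)[OF f]) auto
    then show "\<exists>g\<in>koszul_chains (set []) (piece (free_module (set []) B bd)) (Suc (Suc i)) t. \<forall>S. koszul [] var_op g S = f S"
      by (intro bexI[of _ "\<lambda>_. 0"]) (auto simp: koszul_chains_def)
  qed
next
  case (Cons d js)
  show ?case
    unfolding list.set
  proof (rule koszul_exact_adjoin[OF Cons.prems commuting_var_op graded_submodule_free_module graded_submodule_free_module])
    show "piece (free_module (set js) B bd) t \<subseteq> piece (free_module (insert d (set js)) B bd) t" for t
      using hom_polys_mono[OF _ subset_insertI] by (auto simp: free_module_simps)
    show "a = 0 \<and> b = 0" if ab: "a \<in> piece (free_module (set js) B bd) t"
      "b \<in> piece (free_module (insert d (set js)) B bd) (t - 1)" "a + var_op d b = 0" for t a b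
    proof -
      have "lookup a k = 0 \<and> lookup b k = 0" for k
      proof (rule Var_mult_indep)
        show "lookup a k \<in> polys_in (set js)" using ab(1) by (auto simp: free_module_simps intro: hom_polys_subset)
        show "d \<notin> set js" using Cons.prems by simp
        have "lookup (a + var_op d b) k = 0" using ab(3) by simp
        then show "lookup a k + Var d * lookup b k = 0" by (simp add: lookup_add)
      qed
      then show ?thesis by (auto simp: poly_mapping_eq_iff fun_eq_iff)
    qed
  qed (use Cons free_module_piece_split in auto)
qed

subsection \<open>Tensoring a free module with the residue field\<close>

context
  fixes V :: "nat set" and B :: "'b set" and bd :: "'b \<Rightarrow> int"
begin

private abbreviation (input) "F \<equiv> free_module V B bd"
private abbreviation (input) "G \<equiv> tensor_free F residue_field"
private abbreviation (input) "H \<equiv> tensor_relations V F residue_field"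
private abbreviation (input) "gens \<equiv> 
    ({frag_of (x \<oplus>\<^bsub>F\<^esub> x', y) - frag_of (x, y) - frag_of (x', y) | x x' y.
        x \<in> carrier F \<and> x' \<in> carrier F \<and> y \<in> carrier residue_field} \<union>
     {frag_of (x, y \<oplus>\<^bsub>residue_field\<^esub> y') - frag_of (x, y) - frag_of (x, y') | x y y'.
        x \<in> carrier F \<and> y \<in> carrier residue_field \<and> y' \<in> carrier residue_field} \<union>
     {frag_of (p \<odot>\<^bsub>F\<^esub> x, y) - frag_of (x, p \<odot>\<^bsub>residue_field\<^esub> y) | p x y.
        p \<in> polys_in V \<and> x \<in> carrier F \<and> y \<in> carrier residue_field})"

lemma tensor_free_simps:
  "z \<in> carrier G \<longleftrightarrow> keys z \<subseteq> carrier F \<times> UNIV" "a \<otimes>\<^bsub>G\<^esub> b = a + b" "\<one>\<^bsub>G\<^esub> = 0"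
  "z \<in> carrier G \<Longrightarrow> inv\<^bsub>G\<^esub> z = - z"
  by (simp_all add: tensor_free_def residue_field_simps)

lemma frag_of_in_tensor_free: "x \<in> carrier F \<Longrightarrow> frag_of (x, y) \<in> carrier G"
  by (auto simp: tensor_free_simps)

lemma comm_group_tensor_free: "comm_group G"
  by (simp add: tensor_free_def abelian_free_Abelian_group)

lemma tensor_free_diff: "a \<in> carrier G \<Longrightarrow> b \<in> carrier G \<Longrightarrow> a - b \<in> carrier G"
  using keys_diff[of a b] by (auto simp: tensor_free_simps)

lemma tensor_gens_carrier: "gens \<subseteq> carrier G"
  by (auto simp: free_module_simps(3,5) residue_field_simps
      intro!: tensor_free_diff frag_of_in_tensor_free free_module_carrier_closed(1,3))

lemma subgroup_tensor_relations: "subgroup H G"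
  unfolding tensor_relations_def
  using group.generate_is_subgroup[OF comm_group.axioms(2)[OF comm_group_tensor_free] tensor_gens_carrier] .

lemma tensor_relations_closed:
  shows "0 \<in> H" "a \<in> H \<Longrightarrow> b \<in> H \<Longrightarrow> a + b \<in> H" "a \<in> H \<Longrightarrow> - a \<in> H" "a \<in> H \<Longrightarrow> b \<in> H \<Longrightarrow> a - b \<in> H"
    "a \<in> H \<Longrightarrow> a \<in> carrier G"
proof -
  note s = subgroup_tensor_relations
  show "0 \<in> H" using subgroup.one_closed[OF s] by (simp add: tensor_free_simps)
  show a: "a \<in> H \<Longrightarrow> b \<in> H \<Longrightarrow> a + b \<in> H" for a b using subgroup.m_closed[OF s] by (simp add: tensor_free_simps)
  show c: "a \<in> H \<Longrightarrow> a \<in> carrier G" for a using subgroup.mem_carrier[OF s] .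
  show i: "a \<in> H \<Longrightarrow> - a \<in> H" for a using subgroup.m_inv_closed[OF s] c by (metis tensor_free_simps(4))
  show "a \<in> H \<Longrightarrow> b \<in> H \<Longrightarrow> a - b \<in> H" using a[of a "- b"] i by simp
qed

lemma tensor_gens_in_relations: "z \<in> gens \<Longrightarrow> z \<in> H"
  unfolding tensor_relations_def by (rule generate.incl)

lemma tensor_relation_add:
  "x \<in> carrier F \<Longrightarrow> x' \<in> carrier F \<Longrightarrow> frag_of (x + x', y) - frag_of (x, y) - frag_of (x', y) \<in> H"
  by (intro tensor_gens_in_relations UnI1) (auto simp: free_module_simps(3) residue_field_simps)

lemma tensor_relation_smult:
  "p \<in> polys_in V \<Longrightarrow> x \<in> carrier F \<Longrightarrow>
    frag_of (Poly_Mapping.map (\<lambda>q. p * q) x, y) - frag_of (x, lookup p 0 * y) \<in> H"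
  by (intro tensor_gens_in_relations UnI2) (auto simp: free_module_simps(5) residue_field_simps)

lemma tensor_relation_zero: "x \<in> carrier F \<Longrightarrow> frag_of (x, 0) \<in> H"
proof -
  assume x: "x \<in> carrier F"
  have "frag_of (x, 0 + 0) - frag_of (x, 0) - frag_of (x, 0 :: complex) \<in> H"
    by (rule tensor_gens_in_relations, rule UnI1, rule UnI2, intro CollectI exI[of _ x] exI[of _ 0])
      (use x in \<open>simp add: residue_field_simps\<close>)
  then show ?thesis using tensor_relations_closed(3) by fastforce
qed

lemma tensor_class_eq_iff:
  assumes "z \<in> carrier G" "z' \<in> carrier G"
  shows "tensor_class V F residue_field z = tensor_class V F residue_field z' \<longleftrightarrow> z - z' \<in> H"
proof -
  have c: "tensor_class V F residue_field z = {h + z | h. h \<in> H}" for z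
    by (auto simp: tensor_class_def r_coset_def tensor_free_simps)
  show ?thesis
  proof
    assume "tensor_class V F residue_field z = tensor_class V F residue_field z'"
    moreover have "z \<in> tensor_class V F residue_field z" unfolding c using tensor_relations_closed(1) by force
    ultimately obtain h where "h \<in> H" "z = h + z'" unfolding c by blast
    then show "z - z' \<in> H" by simp
  next
    assume h: "z - z' \<in> H"
    have "h' + z = (h' + (z - z')) + z'" "h' + z' = (h' - (z - z')) + z" for h' by simp_all
    then show "tensor_class V F residue_field z = tensor_class V F residue_field z'"
      unfolding c using h tensor_relations_closed by blast
  qed
qed

lemma normal_tensor_relations: "H \<lhd> G"
  using comm_group.subgroup_imp_normal[OF comm_group_tensor_free subgroup_tensor_relations] .

lemma group_tensor: "group (tensor V F residue_field)"
  unfolding tensor_def by (rule normal.factorgroup_is_group[OF normal_tensor_relations])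

text \<open>The class of x \<otimes> 1. Complex scalars can be moved into the free module, so these
  classes suffice and the tensor product is handled through elements of \<open>F\<close>
  alone.\<close>

definition pure_class :: "('b \<Rightarrow>\<^sub>0 cpoly) \<Rightarrow> (('b \<Rightarrow>\<^sub>0 cpoly) \<times> complex \<Rightarrow>\<^sub>0 int) set" where
  "pure_class x = tensor_class V F residue_field (frag_of (x, 1))"

lemma pure_class_carrier: "x \<in> carrier F \<Longrightarrow> pure_class x \<in> carrier (tensor V F residue_field)"
  using frag_of_in_tensor_free[of x 1]
  by (auto simp: pure_class_def tensor_def tensor_class_def FactGroup_def RCOSETS_def)

lemma pure_class_add:
  assumes "x \<in> carrier F" "y \<in> carrier F"
  shows "pure_class x \<otimes>\<^bsub>tensor V F residue_field\<^esub> pure_class y = pure_class (x + y)"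
proof -
  have "pure_class x \<otimes>\<^bsub>tensor V F residue_field\<^esub> pure_class y
      = tensor_class V F residue_field (frag_of (x, 1) + frag_of (y, 1))"
    using normal.rcos_sum[OF normal_tensor_relations frag_of_in_tensor_free[OF assms(1)] frag_of_in_tensor_free[OF assms(2)]]
    by (simp add: pure_class_def tensor_def tensor_class_def tensor_free_simps)
  also have "\<dots> = pure_class (x + y)"
    unfolding pure_class_def
  proof (subst tensor_class_eq_iff)
    show "frag_of (x, 1) + frag_of (y, 1) \<in> carrier G"
      using frag_of_in_tensor_free assms comm_group_tensor_free
      by (metis tensor_free_simps(2) comm_group_def group_def monoid.m_closed)
    show "frag_of (x + y, 1) \<in> carrier G" using assms by (intro frag_of_in_tensor_free free_module_carrier_closed)
    show "frag_of (x, 1) + frag_of (y, 1) - frag_of (x + y, 1) \<in> H"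
      using tensor_relations_closed(3)[OF tensor_relation_add[OF assms, of 1]] by (simp add: algebra_simps)
  qed
  finally show ?thesis .
qed

lemma pure_class_scale:
  assumes "x \<in> carrier F"
  shows "tensor_class V F residue_field (frag_of (x, c)) = pure_class (Poly_Mapping.map (\<lambda>q. Const c * q) x)"
proof -
  have "Poly_Mapping.map (\<lambda>q. Const c * q) x \<in> carrier F" using free_module_carrier_closed(3)[OF assms] by simp
  moreover have "frag_of (Poly_Mapping.map (\<lambda>q. Const c * q) x, 1) - frag_of (x, c) \<in> H"
    using tensor_relation_smult[OF polys_in_Const assms, of c 1] by (simp add: Const_def)
  then have "- (frag_of (Poly_Mapping.map (\<lambda>q. Const c * q) x, 1) - frag_of (x, c)) \<in> H"
    by (rule tensor_relations_closed(3))
  ultimately show ?thesis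
    unfolding pure_class_def using assms by (subst tensor_class_eq_iff) (auto intro: frag_of_in_tensor_free)
qed

text \<open>The class of 0 is idempotent, and in a group only the unit is.\<close>

lemma one_tensor: "\<one>\<^bsub>tensor V F residue_field\<^esub> = pure_class 0"
proof -
  interpret group "tensor V F residue_field" by (rule group_tensor)
  have c: "pure_class 0 \<in> carrier (tensor V F residue_field)" by (rule pure_class_carrier[OF zero_in_free_module])
  have "pure_class 0 \<otimes>\<^bsub>tensor V F residue_field\<^esub> pure_class 0 = pure_class 0"
    by (simp add: pure_class_add[OF zero_in_free_module zero_in_free_module])
  with c show ?thesis using l_cancel_one' by metis
qed

lemma inv_pure_class:
  assumes "x \<in> carrier F" shows "inv\<^bsub>tensor V F residue_field\<^esub> pure_class x = pure_class (- x)"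
  using pure_class_add[OF free_module_carrier_closed(2)[OF assms] assms] one_tensor
  by (intro group.inv_equality[OF group_tensor]) (auto intro: pure_class_carrier assms free_module_carrier_closed)

lemma pure_class_subgroup:
  assumes "P \<subseteq> carrier F" "0 \<in> P" "\<And>x y. x \<in> P \<Longrightarrow> y \<in> P \<Longrightarrow> x + y \<in> P" "\<And>x. x \<in> P \<Longrightarrow> - x \<in> P"
  shows "subgroup (pure_class ` P) (tensor V F residue_field)"
proof (rule group.subgroupI[OF group_tensor])
  show "pure_class ` P \<subseteq> carrier (tensor V F residue_field)" using assms(1) pure_class_carrier by auto
  show "pure_class ` P \<noteq> {}" using assms(2) by auto
  show "inv\<^bsub>tensor V F residue_field\<^esub> a \<in> pure_class ` P" if "a \<in> pure_class ` P" for a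
    using that assms(1,4) by (auto simp: inv_pure_class subset_iff)
  show "a \<otimes>\<^bsub>tensor V F residue_field\<^esub> b \<in> pure_class ` P" if "a \<in> pure_class ` P" "b \<in> pure_class ` P" for a b
    using that assms(1,3) by (auto simp: pure_class_add subset_iff)
qed

text \<open>The residue field lives in degree 0, where scalars move into \<open>F\<close>. In any
  other degree the second factor is 0 and gives the class of 0.\<close>

lemma tensor_piece_eq: "tensor_piece V F residue_field t = pure_class ` piece F t"
proof
  note c = graded_submoduleD[OF graded_submodule_free_module[of V B bd]]
  have sub: "subgroup (pure_class ` piece F t) (tensor V F residue_field)"
    using c free_module_piece_carrier by (intro pure_class_subgroup) auto
  show "tensor_piece V F residue_field t \<subseteq> pure_class ` piece F t"
    unfolding tensor_piece_def
  proof (rule group.generate_subgroup_incl[OF group_tensor _ sub], safe)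
    fix x y k l
    assume x: "x \<in> piece F k" and y: "y \<in> piece residue_field l" and t: "t = k + l"
    show "tensor_class V F residue_field (frag_of (x, y)) \<in> pure_class ` piece F (k + l)"
    proof (cases "l = 0")
      case True
      have "Poly_Mapping.map (\<lambda>q. Const y * q) x \<in> piece F k"
        using x by (auto simp: free_module_simps lookup_map in_keys_iff intro: hom_polys_Const_mult)
      then show ?thesis using pure_class_scale[OF free_module_piece_carrier[OF x]] True by auto
    next
      case False
      then have "y = 0" using y by (simp add: residue_field_simps)
      moreover have "Poly_Mapping.map (\<lambda>q. Const 0 * q) x = 0"
        by (auto simp: poly_mapping_eq_iff fun_eq_iff lookup_map Const_def)
      ultimately show ?thesis using pure_class_scale[OF free_module_piece_carrier[OF x], of 0] c(1) by auto
    qed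
  qed
  show "pure_class ` piece F t \<subseteq> tensor_piece V F residue_field t"
    unfolding tensor_piece_def pure_class_def
    by (auto intro!: generate.incl) (use add_0_right in \<open>fastforce simp: residue_field_simps\<close>)
qed

text \<open>The coefficient at \<open>b\<close> of the isomorphism \<open>F \<otimes> \<complex> \<cong> F/\<mm>F\<close>, on representatives.\<close>

private definition pairing :: "'b \<Rightarrow> (('b \<Rightarrow>\<^sub>0 cpoly) \<times> complex \<Rightarrow>\<^sub>0 int) \<Rightarrow> complex" where
  "pairing b z = (\<Sum>q \<in> keys z. of_int (lookup z q) *
    (lookup (lookup (fst q) b) 0 * snd q))"

text \<open>The pairing is additive and kills the three kinds of generators, the balancing relations
  because constant terms multiply. Hence it factors through the tensor product.\<close>

lemma pairing_relations:
  assumes "z \<in> H" shows "pairing b z = 0"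
proof -
  have add: "pairing b (z + z') = pairing b z + pairing b z'" for z z'
    unfolding pairing_def by (rule setsum_keys_plus_distrib) (auto simp: algebra_simps)
  have m: "pairing b (- z) = - pairing b z" for z
    using add[of z "- z"] by (simp add: pairing_def sum_negf)
  have d: "pairing b (z - z') = pairing b z - pairing b z'" for z z' using add[of z "- z'"] m by simp
  have f: "pairing b (frag_of (x, c)) = lookup (lookup x b) 0 * c" for x c
    by (simp add: pairing_def)
  have "subgroup {z \<in> carrier G. pairing b z = 0} G"
  proof (rule group.subgroupI[OF comm_group.axioms(2)[OF comm_group_tensor_free]])
    show "{z \<in> carrier G. pairing b z = 0} \<noteq> {}"
      by (auto simp: tensor_free_simps pairing_def intro!: exI[of _ 0])
    show "inv\<^bsub>G\<^esub> a \<in> {z \<in> carrier G. pairing b z = 0}" if "a \<in> {z \<in> carrier G. pairing b z = 0}" for a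
      using that by (auto simp: tensor_free_simps m)
    show "a \<otimes>\<^bsub>G\<^esub> a' \<in> {z \<in> carrier G. pairing b z = 0}"
      if "a \<in> {z \<in> carrier G. pairing b z = 0}" "a' \<in> {z \<in> carrier G. pairing b z = 0}" for a a'
      using that keys_add[of a a'] by (auto simp: tensor_free_simps add)
  qed auto
  moreover have "pairing b (frag_of (x + x', c) - frag_of (x, c) - frag_of (x', c)) = 0" for x x' c
    by (simp only: d f lookup_add) (simp add: algebra_simps)
  moreover have "pairing b (frag_of (x, c + c') - frag_of (x, c) - frag_of (x, c')) = 0" for x c c'
    by (simp only: d f) (simp add: algebra_simps)
  moreover have "pairing b (frag_of (Poly_Mapping.map (\<lambda>q. p * q) x, c) - frag_of (x, lookup p 0 * c)) = 0" for p x c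
    by (simp only: d f) (simp add: lookup_map lookup_mult_0)
  ultimately have "H \<subseteq> {z \<in> carrier G. pairing b z = 0}"
    unfolding tensor_relations_def
    by (intro group.generate_subgroup_incl[OF comm_group.axioms(2)[OF comm_group_tensor_free]])
      (auto simp: free_module_simps(3,5) residue_field_simps
        intro!: tensor_free_diff frag_of_in_tensor_free free_module_carrier_closed(1,3))
  with assms show ?thesis by blast
qed

text \<open>The pairing detects constant terms. Conversely, if they all vanish, then
  \<open>x\<close> is a sum of multiples X_j g_j, and X_j g_j \<otimes> 1 = g_j \<otimes> 0.\<close>

lemma pure_class_eq_one_iff:
  assumes V: "finite V" and x: "x \<in> piece F t"
  shows "pure_class x = \<one>\<^bsub>tensor V F residue_field\<^esub> \<longleftrightarrow> const_terms_zero x"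
proof -
  have xF: "x \<in> carrier F" by (rule free_module_piece_carrier[OF x])
  have H0: "pure_class y = \<one>\<^bsub>tensor V F residue_field\<^esub> \<longleftrightarrow> frag_of (y, 1) \<in> H" if y: "y \<in> carrier F" for y
  proof -
    have "frag_of (0, 1 :: complex) \<in> H"
      using tensor_relations_closed(3)[OF tensor_relation_add[OF zero_in_free_module zero_in_free_module, of 1]] by simp
    moreover have "pure_class y = pure_class 0 \<longleftrightarrow> frag_of (y, 1) - frag_of (0, 1) \<in> H"
      unfolding pure_class_def using y zero_in_free_module by (intro tensor_class_eq_iff frag_of_in_tensor_free)
    ultimately show ?thesis unfolding one_tensor
      using tensor_relations_closed(2,4) by (metis diff_add_cancel)
  qed
  show ?thesis
  proof
    assume "pure_class x = \<one>\<^bsub>tensor V F residue_field\<^esub>"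
    then have "frag_of (x, 1) \<in> H" using H0[OF xF] by simp
    from pairing_relations[OF this] show "const_terms_zero x" by (simp add: pairing_def const_terms_zero_def)
  next
    assume "const_terms_zero x"
    then obtain g where g: "\<And>j. g j \<in> piece F (t - 1)" "x = (\<Sum>j\<in>V. var_op j (g j))"
      using const_terms_zero_imp_sum[OF x _ V] by blast
    interpret group "tensor V F residue_field" by (rule group_tensor)
    have one: "var_op j (g j) \<in> carrier F \<and> pure_class (var_op j (g j)) = \<one>\<^bsub>tensor V F residue_field\<^esub>" if j: "j \<in> V" for j
    proof -
      have gF: "g j \<in> carrier F" by (rule free_module_piece_carrier[OF g(1)])
      have c: "var_op j (g j) \<in> carrier F"
        unfolding var_op_def by (rule free_module_carrier_closed(3)[OF gF polys_in_Var[OF j]])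
      have "frag_of (var_op j (g j), 1) - frag_of (g j, 0) \<in> H"
        using tensor_relation_smult[OF polys_in_Var[OF j] gF, of 1] by (simp add: var_op_def)
      then have "frag_of (var_op j (g j), 1) \<in> H"
        using tensor_relations_closed(2) tensor_relation_zero[OF gF] by fastforce
      with c show ?thesis using H0[OF c] by blast
    qed
    have "(\<Sum>j\<in>U. var_op j (g j)) \<in> carrier F \<and> pure_class (\<Sum>j\<in>U. var_op j (g j)) = \<one>\<^bsub>tensor V F residue_field\<^esub>" if "U \<subseteq> V" for U
      using finite_subset[OF that V] that
    proof (induction U rule: finite_induct)
      case empty
      then show ?case using zero_in_free_module one_tensor by simp
    next
      case (insert j U)
      have "pure_class (var_op j (g j) + (\<Sum>j\<in>U. var_op j (g j)))
          = pure_class (var_op j (g j)) \<otimes>\<^bsub>tensor V F residue_field\<^esub> pure_class (\<Sum>j\<in>U. var_op j (g j))"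
        using insert one[of j] by (intro pure_class_add[symmetric]) auto
      also have "\<dots> = \<one>\<^bsub>tensor V F residue_field\<^esub>" using insert one[of j] by simp
      moreover have "var_op j (g j) + (\<Sum>j\<in>U. var_op j (g j)) \<in> carrier F"
        using insert one[of j] by (intro free_module_carrier_closed(1)) auto
      ultimately show ?case using insert(1,2) by simp
    qed
    then show "pure_class x = \<one>\<^bsub>tensor V F residue_field\<^esub>" unfolding g(2) by blast
  qed
qed

end

text \<open>Since \<open>tensor_map\<close> applies \<open>the_elem\<close>, the image of the coset
  has to be a singleton: representatives differ by relations, and relations are sent to
  relations.\<close>

lemma tensor_map_pure_class:
  fixes f :: "('b \<Rightarrow>\<^sub>0 cpoly) \<Rightarrow> ('c \<Rightarrow>\<^sub>0 cpoly)"
  assumes f: "f \<in> graded_hom V (free_module V B bd) (free_module V B' bd')" and x: "x \<in> carrier (free_module V B bd)"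
  shows "tensor_map V (free_module V B' bd') residue_field f (pure_class V B bd x) = pure_class V B' bd' (f x)"
proof -
  let ?F = "free_module V B bd" and ?F' = "free_module V B' bd'"
  let ?G = "tensor_free ?F residue_field" and ?G' = "tensor_free ?F' residue_field"
  let ?H = "tensor_relations V ?F residue_field" and ?H' = "tensor_relations V ?F' residue_field"
  let ?e = "frag_extend (\<lambda>(x, y). frag_of (f x, y :: complex))"
  have fc: "f y \<in> carrier ?F'" if "y \<in> carrier ?F" for y using f that by (auto simp: graded_hom_def)
  have fa: "f (y + z) = f y + f z" if "y \<in> carrier ?F" "z \<in> carrier ?F" for y z
    using f that by (auto simp: graded_hom_def free_module_simps(3))
  have fs: "f (Poly_Mapping.map (\<lambda>q. p * q) y) = Poly_Mapping.map (\<lambda>q. p * q) (f y)" if "y \<in> carrier ?F" "p \<in> polys_in V" for y p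
    using f that by (auto simp: graded_hom_def free_module_simps(5))
  note G = comm_group.axioms(2)[OF comm_group_tensor_free]
  have "subgroup {z \<in> carrier ?G. ?e z \<in> ?H'} ?G"
  proof (rule group.subgroupI[OF G])
    show "{z \<in> carrier ?G. ?e z \<in> ?H'} \<noteq> {}"
      using tensor_relations_closed(1) by (auto simp: tensor_free_simps intro!: exI[of _ 0])
    show "inv\<^bsub>?G\<^esub> a \<in> {z \<in> carrier ?G. ?e z \<in> ?H'}" if "a \<in> {z \<in> carrier ?G. ?e z \<in> ?H'}" for a
      using that tensor_relations_closed(3) by (auto simp: tensor_free_simps frag_extend_minus)
    show "a \<otimes>\<^bsub>?G\<^esub> a' \<in> {z \<in> carrier ?G. ?e z \<in> ?H'}"
      if "a \<in> {z \<in> carrier ?G. ?e z \<in> ?H'}" "a' \<in> {z \<in> carrier ?G. ?e z \<in> ?H'}" for a a'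
      using that tensor_relations_closed(2) keys_add[of a a'] by (auto simp: tensor_free_simps frag_extend_add)
  qed auto
  moreover have "?e (frag_of (y + y', c) - frag_of (y, c) - frag_of (y', c)) \<in> ?H'"
    if "y \<in> carrier ?F" "y' \<in> carrier ?F" for y y' c
    using that by (simp add: frag_extend_diff fa tensor_relation_add fc)
  moreover have "?e (frag_of (y, c + c') - frag_of (y, c) - frag_of (y, c')) \<in> ?H'" if "y \<in> carrier ?F" for y c c'
  proof -
    have "frag_of (f y, c + c') - frag_of (f y, c) - frag_of (f y, c') \<in> ?H'"
      by (rule tensor_gens_in_relations, rule UnI1, rule UnI2) (use fc[OF that] in \<open>auto simp: residue_field_simps\<close>)
    then show ?thesis by (simp add: frag_extend_diff)
  qed
  moreover have "?e (frag_of (Poly_Mapping.map (\<lambda>q. p * q) y, c) - frag_of (y, lookup p 0 * c)) \<in> ?H'"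
    if "p \<in> polys_in V" "y \<in> carrier ?F" for p y c
    using that by (simp add: frag_extend_diff fs tensor_relation_smult fc)
  ultimately have "?H \<subseteq> {z \<in> carrier ?G. ?e z \<in> ?H'}"
    unfolding tensor_relations_def
    by (intro group.generate_subgroup_incl[OF G])
      (auto simp: free_module_simps(3,5) residue_field_simps
        intro!: tensor_free_diff frag_of_in_tensor_free free_module_carrier_closed(1,3))
  then have eH: "?e h \<in> ?H' \<and> h \<in> carrier ?G" if "h \<in> ?H" for h using that by blast
  have "tensor_class V ?F' residue_field (?e z) = pure_class V B' bd' (f x)" if "z \<in> pure_class V B bd x" for z
  proof -
    obtain h where h: "h \<in> ?H" "z = h + frag_of (x, 1)"
      using \<open>z \<in> pure_class V B bd x\<close> by (auto simp: pure_class_def tensor_class_def r_coset_def tensor_free_simps)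
    have e: "?e z = ?e h + frag_of (f x, 1)" by (simp add: h(2) frag_extend_add)
    have c: "frag_of (f x, 1) \<in> carrier ?G'" by (rule frag_of_in_tensor_free[OF fc[OF x]])
    have hc: "?e h \<in> carrier ?G'" using tensor_relations_closed(5) eH[OF h(1)] by blast
    have "?e z \<in> carrier ?G'" unfolding e
      using c hc keys_add[of "?e h" "frag_of (f x, 1)"] by (auto simp: tensor_free_simps)
    with c show ?thesis unfolding pure_class_def
      using eH[OF h(1)] by (subst tensor_class_eq_iff) (auto simp: e)
  qed
  moreover have "frag_of (x, 1) \<in> pure_class V B bd x"
    unfolding pure_class_def tensor_class_def r_coset_def using tensor_relations_closed(1)
    by (auto simp: tensor_free_simps intro!: bexI[of _ 0])
  ultimately have "(\<lambda>z. tensor_class V ?F' residue_field (?e z)) ` pure_class V B bd x = {pure_class V B' bd' (f x)}"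
    by (auto intro!: image_eqI[of _ _ "frag_of (x, 1)"])
  then show ?thesis by (simp add: tensor_map_def)
qed

section \<open>A criterion for vanishing Tor\<close>

lemma trivial_group_Mod_carrier:
  assumes "group K" shows "trivial_group (K Mod carrier K)"
proof -
  interpret group K by fact
  have "carrier K \<lhd> K" by (simp add: normal_invI subgroup_self)
  then have "group (K Mod carrier K)" by (rule normal.factorgroup_is_group)
  moreover have "carrier K #>\<^bsub>K\<^esub> a = carrier K" if "a \<in> carrier K" for a
    using that coset_join2 subgroup_self by blast
  then have "rcosets\<^bsub>K\<^esub> carrier K = {carrier K}" using one_closed by (auto simp: RCOSETS_def)
  ultimately show ?thesis by (simp add: trivial_group_def FactGroup_def)
qed

text \<open>Under F \<otimes> \<complex> = F/\<mm>F the cycles are the classes of those x whose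
  image lies in \<mm>F. Hypothesis \<open>ex\<close> says that modulo \<mm>F each of them is a
  boundary, so cycles and boundaries are the same subgroup.\<close>

theorem trivial_Tor:
  fixes B :: "nat \<Rightarrow> 'b set" and bd :: "nat \<Rightarrow> 'b \<Rightarrow> int"
  assumes V: "finite V"
    and \<delta>: "\<And>i. \<delta> i \<in> graded_hom V (free_module V (B (Suc i)) (bd (Suc i))) (free_module V (B i) (bd i))"
    and comp: "\<And>h w. i = Suc h \<Longrightarrow> w \<in> carrier (free_module V (B (Suc i)) (bd (Suc i))) \<Longrightarrow> \<delta> h (\<delta> i w) = 0"
    and ex: "\<And>x. x \<in> piece (free_module V (B i) (bd i)) t \<Longrightarrow> (\<And>h. i = Suc h \<Longrightarrow> const_terms_zero (\<delta> h x)) \<Longrightarrow>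
      \<exists>w \<in> piece (free_module V (B (Suc i)) (bd (Suc i))) t. const_terms_zero (x - \<delta> i w)"
  shows "trivial_group (Tor V B bd \<delta> residue_field i t)"
proof -
  define P where "P i = piece (free_module V (B i) (bd i)) t" for i
  define \<tau> where "\<tau> i = pure_class V (B i) (bd i)" for i
  define T where "T = tensor V (free_module V (B i) (bd i)) residue_field"
  define Z where "Z = {x \<in> P i. \<forall>h. i = Suc h \<longrightarrow> const_terms_zero (\<delta> h x)}"
  note c = graded_submoduleD[OF graded_submodule_free_module]
  have PF: "x \<in> P i \<Longrightarrow> x \<in> carrier (free_module V (B i) (bd i))" for x i
    unfolding P_def by (rule free_module_piece_carrier)
  have \<delta>P: "x \<in> P (Suc i) \<Longrightarrow> \<delta> i x \<in> P i" for x i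
    using \<delta>[of i] unfolding P_def graded_hom_def by blast
  have \<delta>a: "\<delta> i (x + y) = \<delta> i x + \<delta> i y" if "x \<in> P (Suc i)" "y \<in> P (Suc i)" for x y i
    using \<delta>[of i] PF that by (auto simp: graded_hom_def free_module_simps(3))
  have P0: "0 \<in> P i" "x \<in> P i \<Longrightarrow> y \<in> P i \<Longrightarrow> x + y \<in> P i" "x \<in> P i \<Longrightarrow> - x \<in> P i" for x y i
    by (simp_all add: P_def c)
  have \<delta>0: "\<delta> i 0 = 0" for i using \<delta>a[OF P0(1) P0(1), of i] by simp
  have \<delta>m: "\<delta> i (- x) = - \<delta> i x" if "x \<in> P (Suc i)" for x i
    using \<delta>a[OF that P0(3)[OF that]] \<delta>0[of i] by (simp add: eq_neg_iff_add_eq_0 add.commute)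
  have map: "tensor_map V (free_module V (B i) (bd i)) residue_field (\<delta> i) (\<tau> (Suc i) x) = \<tau> i (\<delta> i x)" if "x \<in> P (Suc i)" for x i
    unfolding \<tau>_def by (rule tensor_map_pure_class[OF \<delta> PF[OF that]])
  have cyc: "Tor_cycles V B bd \<delta> residue_field i t = \<tau> i ` Z"
  proof (cases i)
    case 0
    then show ?thesis by (simp add: Tor_cycles_def tensor_piece_eq Z_def P_def \<tau>_def)
  next
    case (Suc h)
    have "tensor_map V (free_module V (B h) (bd h)) residue_field (\<delta> h) (\<tau> (Suc h) x)
        = \<one>\<^bsub>tensor V (free_module V (B h) (bd h)) residue_field\<^esub> \<longleftrightarrow> const_terms_zero (\<delta> h x)" if "x \<in> P (Suc h)" for x
      unfolding map[OF that] using pure_class_eq_one_iff[OF V] \<delta>P[OF that] by (simp add: P_def \<tau>_def)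
    then show ?thesis
      by (auto simp: Tor_cycles_def tensor_piece_eq Z_def Suc Let_def simp flip: P_def \<tau>_def)
  qed
  have bnd: "Tor_boundaries V B bd \<delta> residue_field i t = (\<lambda>w. \<tau> i (\<delta> i w)) ` P (Suc i)"
  proof -
    have "Tor_boundaries V B bd \<delta> residue_field i t =
        tensor_map V (free_module V (B i) (bd i)) residue_field (\<delta> i) ` \<tau> (Suc i) ` P (Suc i)"
      by (simp add: Tor_boundaries_def tensor_piece_eq P_def \<tau>_def)
    also have "\<dots> = (\<lambda>w. \<tau> i (\<delta> i w)) ` P (Suc i)"
      unfolding image_image by (rule image_cong) (simp_all add: map)
    finally show ?thesis .
  qed
  have Z: "subgroup (\<tau> i ` Z) T"
    unfolding \<tau>_def T_def
  proof (rule pure_class_subgroup)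
    show "Z \<subseteq> carrier (free_module V (B i) (bd i))" using PF by (auto simp: Z_def)
    show "0 \<in> Z" using P0 \<delta>0 by (simp add: Z_def const_terms_zero_0)
    show "x + y \<in> Z" if "x \<in> Z" "y \<in> Z" for x y
      using that P0 \<delta>a by (auto simp: Z_def const_terms_zero_add)
    show "- x \<in> Z" if "x \<in> Z" for x using that P0 \<delta>m by (auto simp: Z_def const_terms_zero_uminus)
  qed
  have "\<tau> i ` Z = (\<lambda>w. \<tau> i (\<delta> i w)) ` P (Suc i)"
  proof
    show "(\<lambda>w. \<tau> i (\<delta> i w)) ` P (Suc i) \<subseteq> \<tau> i ` Z"
      using \<delta>P comp PF by (auto simp: Z_def const_terms_zero_0 intro!: imageI)
    show "\<tau> i ` Z \<subseteq> (\<lambda>w. \<tau> i (\<delta> i w)) ` P (Suc i)"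
    proof
      fix a assume "a \<in> \<tau> i ` Z"
      then obtain x where x: "x \<in> P i" "\<And>h. i = Suc h \<Longrightarrow> const_terms_zero (\<delta> h x)" "a = \<tau> i x"
        by (auto simp: Z_def)
      obtain w where w: "w \<in> P (Suc i)" "const_terms_zero (x - \<delta> i w)"
        using ex[OF x(1)[unfolded P_def] x(2)] unfolding P_def by blast
      have d: "x - \<delta> i w \<in> P i" using c(2) x(1) \<delta>P[OF w(1)] unfolding P_def by blast
      have "\<tau> i x = \<tau> i ((x - \<delta> i w) + \<delta> i w)" by simp
      also have "\<dots> = \<tau> i (x - \<delta> i w) \<otimes>\<^bsub>T\<^esub> \<tau> i (\<delta> i w)"
        unfolding \<tau>_def T_def by (rule pure_class_add[symmetric, OF PF[OF d] PF[OF \<delta>P[OF w(1)]]])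
      also have "\<tau> i (x - \<delta> i w) = \<one>\<^bsub>T\<^esub>"
        unfolding \<tau>_def T_def using pure_class_eq_one_iff[OF V d[unfolded P_def]] w(2) by simp
      also have "\<one>\<^bsub>T\<^esub> \<otimes>\<^bsub>T\<^esub> \<tau> i (\<delta> i w) = \<tau> i (\<delta> i w)"
        unfolding T_def \<tau>_def
        by (rule monoid.l_one[OF group.is_monoid[OF group_tensor] pure_class_carrier[OF PF[OF \<delta>P[OF w(1)]]]])
      finally show "a \<in> (\<lambda>w. \<tau> i (\<delta> i w)) ` P (Suc i)" using w(1) x(3) by blast
    qed
  qed
  then have "Tor V B bd \<delta> residue_field i t = T\<lparr>carrier := \<tau> i ` Z\<rparr> Mod carrier (T\<lparr>carrier := \<tau> i ` Z\<rparr>)"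
    unfolding Tor_def cyc bnd T_def by simp
  moreover have "group (T\<lparr>carrier := \<tau> i ` Z\<rparr>)"
    using group.subgroup_imp_group[OF group_tensor] Z unfolding T_def by blast
  ultimately show ?thesis using trivial_group_Mod_carrier by metis
qed

section \<open>Koszul homology along a resolution\<close>

text \<open>The empty set contains no head variable, so the branch with the sign is never
  taken.\<close>

lemma koszul_empty:
  assumes "commuting_ops Y" "distinct js"
  shows "koszul js Y f {} = (\<Sum>j\<in>set js. Y j (f {j}))"
  using assms(2) by (induction js) (auto simp: add.commute)

lemma const_terms_zero_koszul: "const_terms_zero (koszul js var_op f S)"
  by (induction js) (auto simp: const_terms_zero_0 const_terms_zero_uminus const_terms_zero_add const_terms_zero_op)

lemma piecewise_hom_graded_hom:
  assumes "f \<in> graded_hom V (free_module V B bd) (free_module V B' bd')"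
  shows "piecewise_hom V var_op (piece (free_module V B bd)) var_op (piece (free_module V B' bd')) f"
  unfolding piecewise_hom_def
proof (intro allI ballI conjI)
  fix t x assume x: "x \<in> piece (free_module V B bd) t"
  note xc = free_module_piece_carrier[OF x]
  show "f x \<in> piece (free_module V B' bd') t" using assms x unfolding graded_hom_def by blast
  show "f (x + y) = f x + f y" if "y \<in> piece (free_module V B bd) t" for y
    using assms xc free_module_piece_carrier[OF that] by (auto simp: graded_hom_def free_module_simps(3))
  show "f (var_op j x) = var_op j (f x)" if "j \<in> V" for j
    using assms xc polys_in_Var[OF that] unfolding graded_hom_def free_module_simps(5) var_op_def by blast
qed

lemma koszul_boundary_lift:
  assumes N: "graded_submodule (set js) Y N" and hom: "piecewise_hom (set js) Y N Y' P \<psi>"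
    and surj: "\<And>t x. x \<in> P t \<Longrightarrow> \<exists>y \<in> N t. \<psi> y = x" and g: "g \<in> koszul_chains (set js) P (Suc 0) t"
  obtains k where "k \<in> koszul_chains (set js) N (Suc 0) t" "\<psi> (koszul js Y k {}) = koszul js Y' g {}"
proof -
  obtain k where k: "k \<in> koszul_chains (set js) N (Suc 0) t" "\<And>S. \<psi> (k S) = g S"
    using koszul_chains_lift[where M = N and N = P and \<phi> = \<psi>, OF g surj piecewise_homD_group(1)[OF hom N]] by blast
  have "\<psi> (koszul js Y k {}) = koszul js Y' (\<lambda>S. \<psi> (k S)) {}"
    by (rule koszul_hom[OF N hom order_refl koszul_chains_mem[OF N k(1)]])
  with k show ?thesis using that by simp
qed

text \<open>Koszul homology of the resolved module computes Tor: syzygies shift the homological degree by one,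
  because free modules have no higher Koszul homology.\<close>

theorem trivial_Tor_of_koszul_exact:
  fixes B :: "nat \<Rightarrow> 'b set" and bd :: "nat \<Rightarrow> 'b \<Rightarrow> int" and \<psi> :: "('b \<Rightarrow>\<^sub>0 cpoly) \<Rightarrow> 'n::ab_group_add" and js :: "nat list"
  defines "F \<equiv> \<lambda>i. free_module (set js) (B i) (bd i)"
  assumes dist: "distinct js"
    and \<delta>: "\<And>i. \<delta> i \<in> graded_hom (set js) (F (Suc i)) (F i)"
    and Y': "commuting_ops Y'" and \<psi>: "piecewise_hom (set js) var_op (piece (F 0)) Y' P \<psi>"
    and surj: "\<And>t x. x \<in> P t \<Longrightarrow> \<exists>y \<in> piece (F 0) t. \<psi> y = x"
    and \<psi>\<delta>: "\<And>t x. x \<in> piece (F 1) t \<Longrightarrow> \<psi> (\<delta> 0 x) = 0"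
    and \<delta>\<delta>: "\<And>i x. x \<in> carrier (F (Suc (Suc i))) \<Longrightarrow> \<delta> i (\<delta> (Suc i) x) = 0"
    and ex0: "\<And>t x. x \<in> piece (F 0) t \<Longrightarrow> \<psi> x = 0 \<Longrightarrow> \<exists>w \<in> piece (F 1) t. \<delta> 0 w = x"
    and ex1: "\<And>i t x. x \<in> piece (F (Suc i)) t \<Longrightarrow> \<delta> i x = 0 \<Longrightarrow> \<exists>w \<in> piece (F (Suc (Suc i))) t. \<delta> (Suc i) w = x"
    and P: "koszul_exact js Y' P i t"
  shows "trivial_group (Tor (set js) B bd \<delta> residue_field i t)"
proof -
  let ?V = "set js"
  note op = commuting_var_op
  have N: "graded_submodule ?V var_op (piece (F h))" for h unfolding F_def by (rule graded_submodule_free_module)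
  have hom: "piecewise_hom ?V var_op (piece (F (Suc h))) var_op (piece (F h)) (\<delta> h)" for h
    using piecewise_hom_graded_hom \<delta> unfolding F_def by blast
  have free: "koszul_exact js var_op (piece (F h)) (Suc i) t" for h i t
    unfolding F_def by (rule koszul_exact_free_module[OF dist])
  \<comment> \<open>The syzygy modules, indexed so that \<open>\<delta> h\<close> maps the pieces of
    \<open>F (Suc h)\<close> onto those of \<open>Z h\<close>.\<close>
  define Z where "Z h t = (case h of 0 \<Rightarrow> {x \<in> piece (F 0) t. \<psi> x = 0} | Suc g \<Rightarrow> {x \<in> piece (F h) t. \<delta> g x = 0})" for h t
  have homZ: "piecewise_hom ?V var_op (piece (F (Suc h))) var_op (Z h) (\<delta> h)" for h
  proof -
    have "\<delta> h x \<in> Z h t" if x: "x \<in> piece (F (Suc h)) t" for x t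
    proof (cases h)
      case 0
      then show ?thesis using piecewise_homD(1)[OF hom x] \<psi>\<delta> x by (simp add: Z_def)
    next
      case (Suc g)
      have "x \<in> carrier (F (Suc (Suc g)))" using x free_module_piece_carrier unfolding F_def Suc by blast
      then show ?thesis using piecewise_homD(1)[OF hom x] \<delta>\<delta> Suc by (simp add: Z_def)
    qed
    then show ?thesis using hom[of h] unfolding piecewise_hom_def by blast
  qed
  have surjZ: "\<exists>w \<in> piece (F (Suc h)) t. \<delta> h w = x" if "x \<in> Z h t" for h t x
    using that ex0 ex1 unfolding Z_def by (cases h) auto
  \<comment> \<open>Free modules have no homology in positive degrees, so each passage from
    \<open>Z h\<close> to the kernel \<open>Z (Suc h)\<close> of F(h+1) \<rightarrow> Z h costs one
    homological degree, and so does the passage from \<open>P\<close> to \<open>Z 0\<close>.\<close>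
  have Zex: "koszul_exact js Y' P (Suc (Suc i) + h) t \<Longrightarrow> koszul_exact js var_op (Z h) (Suc i) t" for h i
  proof (induction h arbitrary: i)
    case 0
    then show ?case
      unfolding Z_def using koszul_exact_kernel[OF refl dist op Y' N \<psi> surj _ free] by simp
  next
    case (Suc h)
    then have "koszul_exact js var_op (Z h) (Suc (Suc i)) t" by simp
    from koszul_exact_kernel[OF refl dist op op N homZ surjZ this free] show ?case
      unfolding Z_def by simp
  qed

  show ?thesis
  proof (rule trivial_Tor)
    fix x assume x: "x \<in> piece (free_module ?V (B i) (bd i)) t"
      and cx: "\<And>h. i = Suc h \<Longrightarrow> const_terms_zero (\<delta> h x)"
    have xF: "x \<in> piece (F i) t" using x by (simp add: F_def)
    \<comment> \<open>It suffices to correct \<open>x\<close> by an element of \<mm>F to a syzygy,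
      since syzygies are images. For i = 0, homology in degree 0 puts \<psi> x into \<mm>P, and the
      coefficients are lifted to \<open>F 0\<close>.\<close>
    have "\<exists>y \<in> piece (F i) t. const_terms_zero y \<and> x - y \<in> Z i t"
    proof (cases i)
      case 0
      define f where "f S = (if S = {} then \<psi> x else 0)" for S :: "nat set"
      have x0: "x \<in> piece (F 0) t" using xF 0 by simp
      have f: "f \<in> koszul_chains ?V P 0 t"
        using piecewise_homD(1)[OF \<psi> x0] by (auto simp: koszul_chains_def f_def finite_subset)
      have "koszul_exact js Y' P 0 t" using P 0 by simp
      then obtain g where g: "g \<in> koszul_chains ?V P (Suc 0) t" "koszul js Y' g {} = \<psi> x"
        using koszul_exactD[OF _ f koszul_chains_0[OF Y' f]] by (metis (mono_tags, lifting) f_def)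
      obtain k where k: "k \<in> koszul_chains ?V (piece (F 0)) (Suc 0) t" "\<psi> (koszul js var_op k {}) = \<psi> x"
        using koszul_boundary_lift[OF N \<psi> surj g(1)] g(2) by metis
      have y: "koszul js var_op k {} \<in> piece (F 0) t"
        using koszul_chains_mem[OF N koszul_chain[OF op N order_refl k(1)], of "{}"] by simp
      then show ?thesis
        using x0 k(2) piecewise_homD_group(3)[OF \<psi> N x0 y] graded_submoduleD(2)[OF N x0 y] const_terms_zero_koszul 0
        by (intro bexI[of _ "koszul js var_op k {}"]) (auto simp: Z_def)
    next
      case (Suc h)
      have xh: "x \<in> piece (F (Suc h)) t" using xF Suc by simp
      have dx: "\<delta> h x \<in> Z h t" by (rule piecewise_homD(1)[OF homZ xh])
      have dxF: "\<delta> h x \<in> piece (F h) t" by (rule piecewise_homD(1)[OF hom xh])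
      obtain g where g: "\<And>j. g j \<in> piece (F h) (t - 1)" "\<delta> h x = (\<Sum>j\<in>?V. var_op j (g j))"
        using const_terms_zero_imp_sum[of "\<delta> h x" ?V "B h" "bd h" t] dxF cx[OF Suc] unfolding F_def by auto
      \<comment> \<open>The coefficients of \<delta> x as an element of \<mm>F form a 1-chain whose
        differential is \<delta> x.\<close>
      define f where "f S = (if \<exists>j\<in>?V. S = {j} then g (the_elem S) else 0)" for S
      have f: "f \<in> koszul_chains ?V (piece (F h)) (Suc 0) t"
        using g(1) by (auto simp: koszul_chains_def f_def card_Suc_eq)
      have kf0: "koszul js var_op f {} = \<delta> h x"
        unfolding koszul_empty[OF op dist] g(2) by (intro sum.cong) (auto simp: f_def)
      have kf: "koszul js var_op f S = (if S = {} then \<delta> h x else 0)" for S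
      proof (cases "S = {}")
        case False
        then have "\<not> (S \<subseteq> ?V \<and> card S = 0)" by (metis card_0_eq List.finite_set finite_subset)
        then show ?thesis using False koszul_chainsD(2)[OF koszul_chain[OF op N order_refl f]] by simp
      qed (simp add: kf0)
      \<comment> \<open>Since \<delta> x is a syzygy, the 1-chain can be moved into the syzygies if
        the degree 1 homology of \<open>P\<close> (for h = 0) or of \<open>Z h'\<close> vanishes.
        Either follows from the hypothesis on \<open>P\<close> in degree i. The new coefficients
        then lift along \<open>\<delta> h\<close>.\<close>
      have "\<exists>g' \<in> koszul_chains ?V (Z h) (Suc 0) t. koszul js var_op g' {} = \<delta> h x"
      proof (cases h)
        case 0
        have "koszul_exact js Y' P (Suc 0) t" using P Suc 0 by simp
        moreover have "\<psi> (koszul js var_op f S) = 0" for S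
          using dx piecewise_homD_group(1)[OF \<psi> N] by (simp add: kf Z_def 0)
        ultimately obtain g' where "g' \<in> koszul_chains ?V (\<lambda>t. {x \<in> piece (F 0) t. \<psi> x = 0}) (Suc 0) t"
          "\<And>S. koszul js var_op g' S = koszul js var_op f S"
          using koszul_boundary_in_kernel[OF refl dist op Y' N \<psi> surj _ f[unfolded 0]] by blast
        then show ?thesis using kf0 by (intro bexI[of _ g']) (auto simp: Z_def[abs_def] 0)
      next
        case (Suc h')
        have "koszul_exact js var_op (Z h') (Suc 0) t" using Zex[of 0 h'] P \<open>i = Suc h\<close> Suc by simp
        moreover have "\<delta> h' (koszul js var_op f S) = 0" for S
          using dx piecewise_homD_group(1)[OF hom N] by (simp add: kf Z_def Suc)
        ultimately obtain g' where "g' \<in> koszul_chains ?V (\<lambda>t. {x \<in> piece (F (Suc h')) t. \<delta> h' x = 0}) (Suc 0) t"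
          "\<And>S. koszul js var_op g' S = koszul js var_op f S"
          using koszul_boundary_in_kernel[OF refl dist op op N homZ surjZ _ f[unfolded Suc]] by blast
        then show ?thesis using kf0 by (intro bexI[of _ g']) (auto simp: Z_def[abs_def] Suc)
      qed
      then obtain g' where g': "g' \<in> koszul_chains ?V (Z h) (Suc 0) t" "koszul js var_op g' {} = \<delta> h x" by blast
      obtain k where k: "k \<in> koszul_chains ?V (piece (F (Suc h))) (Suc 0) t" "\<delta> h (koszul js var_op k {}) = \<delta> h x"
        using koszul_boundary_lift[OF N homZ surjZ g'(1)] g'(2) by metis
      have y: "koszul js var_op k {} \<in> piece (F (Suc h)) t"
        using koszul_chains_mem[OF N koszul_chain[OF op N order_refl k(1)], of "{}"] by simp
      then show ?thesis
        using xh k(2) piecewise_homD_group(3)[OF hom N xh y] graded_submoduleD(2)[OF N xh y] const_terms_zero_koszul Suc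
        by (intro bexI[of _ "koszul js var_op k {}"]) (auto simp: Z_def)
    qed
    then obtain y where y: "const_terms_zero y" "x - y \<in> Z i t" by blast
    obtain w where w: "w \<in> piece (F (Suc i)) t" "\<delta> i w = x - y" using surjZ[OF y(2)] by blast
    then show "\<exists>w \<in> piece (free_module ?V (B (Suc i)) (bd (Suc i))) t. const_terms_zero (x - \<delta> i w)"
      using y(1) by (intro bexI[of _ w]) (auto simp: F_def)
  next
    show "\<delta> h (\<delta> i w) = 0" if "i = Suc h" "w \<in> carrier (free_module ?V (B (Suc i)) (bd (Suc i)))" for h w
      using \<delta>\<delta> that by (simp add: F_def)
  qed (use \<delta> in \<open>auto simp: F_def\<close>)
qed

subsection \<open>Homogeneous components\<close>

definition hom_part :: "int \<Rightarrow> cpoly \<Rightarrow> cpoly" where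
  "hom_part k p = Abs_poly_mapping (\<lambda>m. lookup p m when int (mdeg m) = k)"

lemma lookup_hom_part: "lookup (hom_part k p) m = (lookup p m when int (mdeg m) = k)"
proof -
  have "{m. (lookup p m when int (mdeg m) = k) \<noteq> 0} \<subseteq> keys p"
    by (auto simp: in_keys_iff)
  then show ?thesis unfolding hom_part_def
    by (subst lookup_Abs_poly_mapping) (meson finite_keys finite_subset, simp)
qed

lemma keys_hom_part: "keys (hom_part k p) = {m \<in> keys p. int (mdeg m) = k}"
  by (auto simp: in_keys_iff lookup_hom_part)

definition free_part :: "('b \<Rightarrow> int) \<Rightarrow> int \<Rightarrow> ('b \<Rightarrow>\<^sub>0 cpoly) \<Rightarrow> 'b \<Rightarrow>\<^sub>0 cpoly" where
  "free_part bd k x = Abs_poly_mapping (\<lambda>b. hom_part (k - bd b) (lookup x b))"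

lemma lookup_free_part: "lookup (free_part bd k x) b = hom_part (k - bd b) (lookup x b)"
proof -
  have "hom_part l 0 = 0" for l by (simp add: poly_mapping_eq_iff fun_eq_iff lookup_hom_part)
  then have "{b. hom_part (k - bd b) (lookup x b) \<noteq> 0} \<subseteq> keys x"
    by (auto simp: in_keys_iff)
  then show ?thesis unfolding free_part_def
    by (subst lookup_Abs_poly_mapping) (meson finite_keys finite_subset, simp)
qed

lemma lookup2_free_part:
  "lookup (lookup (free_part bd k x) b) m =
    (lookup (lookup x b) m when int (mdeg m) + bd b = k)"
  by (auto simp: lookup_free_part lookup_hom_part when_def)

lemma free_module_eqI:
  fixes x y :: "'b \<Rightarrow>\<^sub>0 cpoly"
  assumes "\<And>b m. lookup (lookup x b) m = lookup (lookup y b) m"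
  shows "x = y"
  using assms by (simp add: poly_mapping_eq_iff fun_eq_iff)

lemma free_part_piece:
  assumes "x \<in> carrier (free_module V B bd)" shows "free_part bd k x \<in> piece (free_module V B bd) k"
proof -
  have "hom_part (k - bd b) (lookup x b) \<in> hom_polys V (k - bd b)" for b
    using assms unfolding hom_polys_def polys_in_def free_module_simps mem_Collect_eq keys_hom_part by blast
  moreover have "keys (free_part bd k x) \<subseteq> keys x"
  proof
    fix b assume "b \<in> keys (free_part bd k x)"
    then have "lookup (free_part bd k x) b \<noteq> 0" by (simp add: in_keys_iff)
    then obtain m where "lookup (lookup (free_part bd k x) b) m \<noteq> 0"
      by (auto simp: poly_mapping_eq_iff fun_eq_iff)
    then show "b \<in> keys x" by (auto simp: lookup2_free_part when_def in_keys_iff split: if_splits)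
  qed
  ultimately show ?thesis using assms by (auto simp: free_module_simps lookup_free_part)
qed

lemma free_part_of_piece:
  assumes "x \<in> piece (free_module V B bd) l" shows "free_part bd k x = (if k = l then x else 0)"
proof (rule free_module_eqI)
  fix b m
  have "lookup (lookup x b) m \<noteq> 0 \<Longrightarrow> int (mdeg m) + bd b = l"
    using assms by (auto simp: free_module_simps hom_polys_def in_keys_iff)
  then show "lookup (lookup (free_part bd k x) b) m =
      lookup (lookup (if k = l then x else 0) b) m"
    by (auto simp: lookup2_free_part when_def)
qed

lemma free_part_sum: "free_part bd k (sum f T) = (\<Sum>t\<in>T. free_part bd k (f t))"
  by (rule free_module_eqI) (simp add: lookup2_free_part lookup_sum when_def)

lemma free_part_expand:
  fixes x :: "'b \<Rightarrow>\<^sub>0 cpoly"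
  obtains T where "finite T" "k \<in> T" "x = (\<Sum>t\<in>T. free_part bd t x)"
proof
  \<comment> \<open>The degree \<open>k\<close> is included even if that component is zero, so that
    it can be singled out of the sum.\<close>
  let ?T = "insert k (\<Union>b\<in>keys x. (\<lambda>m. int (mdeg m) + bd b) ` keys (lookup x b))"
  show "finite ?T" "k \<in> ?T" by auto
  show "x = (\<Sum>t\<in>?T. free_part bd t x)"
  proof (rule free_module_eqI)
    fix b m
    let ?c = "lookup (lookup x b) m"
    have "(\<Sum>t\<in>?T. ?c when int (mdeg m) + bd b = t) = ?c"
    proof (cases "?c = 0")
      case False
      then have "b \<in> keys x" "m \<in> keys (lookup x b)" by (auto simp: in_keys_iff)
      then have "int (mdeg m) + bd b \<in> ?T" by blast
      then show ?thesis using \<open>finite ?T\<close> by (simp only: when_def sum.delta) simp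
    qed simp
    then show "?c = lookup (lookup (\<Sum>t\<in>?T. free_part bd t x) b) m"
      by (simp add: lookup2_free_part lookup_sum)
  qed
qed

lemma additive_sum:
  fixes g :: "('b \<Rightarrow>\<^sub>0 cpoly) \<Rightarrow> 'c::ab_group_add"
  assumes add: "\<And>x y. x \<in> carrier (free_module V B bd) \<Longrightarrow> y \<in> carrier (free_module V B bd) \<Longrightarrow> g (x + y) = g x + g y"
    and f: "\<And>t. t \<in> T \<Longrightarrow> f t \<in> carrier (free_module V B bd)"
  shows "g (sum f T) = (\<Sum>t\<in>T. g (f t))"
proof -
  have 0: "g 0 = 0" using add[OF zero_in_free_module zero_in_free_module] by simp
  have "sum f T \<in> carrier (free_module V B bd) \<and> g (sum f T) = (\<Sum>t\<in>T. g (f t))"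
    using f
  proof (induction T rule: infinite_finite_induct)
    case (insert t T)
    then have IH: "sum f T \<in> carrier (free_module V B bd)" "g (sum f T) = (\<Sum>t\<in>T. g (f t))" by auto
    have ft: "f t \<in> carrier (free_module V B bd)" by (rule insert.prems) simp
    have "sum f (insert t T) = f t + sum f T" using insert(1,2) by simp
    moreover have "(\<Sum>t\<in>insert t T. g (f t)) = g (f t) + (\<Sum>t\<in>T. g (f t))" using insert(1,2) by simp
    ultimately show ?case using add[OF ft IH(1)] IH free_module_carrier_closed(1)[OF ft IH(1)] by simp
  qed (auto simp: zero_in_free_module 0)
  then show ?thesis by blast
qed

text \<open>Exactness of a resolution concerns whole modules. The degree \<open>k\<close> component
  of any preimage is a homogeneous preimage, because the components of the image are the images of
  the components.\<close>

lemma graded_hom_homogeneous_preimage: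
  assumes f: "f \<in> graded_hom V (free_module V B bd) (free_module V B' bd')"
    and x: "x \<in> carrier (free_module V B bd)" and y: "f x \<in> piece (free_module V B' bd') k"
  shows "\<exists>w \<in> piece (free_module V B bd) k. f w = f x"
proof
  let ?w = "free_part bd k x"
  show "?w \<in> piece (free_module V B bd) k" by (rule free_part_piece[OF x])
  obtain T where T: "finite T" "k \<in> T" "x = (\<Sum>t\<in>T. free_part bd t x)" by (rule free_part_expand)
  have p: "f (free_part bd t x) \<in> piece (free_module V B' bd') t" for t
    using f free_part_piece[OF x] unfolding graded_hom_def by blast
  have "f x = (\<Sum>t\<in>T. f (free_part bd t x))"
    using additive_sum[of V B bd f T "\<lambda>t. free_part bd t x"] f free_module_piece_carrier[OF free_part_piece[OF x]] T(3)
    by (auto simp: graded_hom_def free_module_simps(3))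
  then have "free_part bd' k (f x) = (\<Sum>t\<in>T. free_part bd' k (f (free_part bd t x)))" by (simp only: free_part_sum)
  also have "\<dots> = (\<Sum>t\<in>T. if k = t then f (free_part bd t x) else 0)" by (simp add: free_part_of_piece[OF p])
  also have "\<dots> = f ?w" using T(1,2) by simp
  finally show "f ?w = f x" by (simp add: free_part_of_piece[OF y])
qed

lemma cring_poly_ring: "cring (poly_ring V)"
proof (rule cringI)
  show "abelian_group (poly_ring V)"
  proof (rule abelian_groupI)
    show "\<exists>y\<in>carrier (poly_ring V). y \<oplus>\<^bsub>poly_ring V\<^esub> x = \<zero>\<^bsub>poly_ring V\<^esub>" if "x \<in> carrier (poly_ring V)" for x
      using that by (intro bexI[of _ "- x"]) (auto simp: poly_ring_def polys_in_uminus)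
  qed (auto simp: poly_ring_def algebra_simps polys_in_add)
  show "comm_monoid (poly_ring V)"
    by (rule comm_monoidI) (auto simp: poly_ring_def algebra_simps polys_in_mult)
qed (auto simp: poly_ring_def algebra_simps)

lemma poly_ring_simps:
  "carrier (poly_ring V) = polys_in V" "x \<otimes>\<^bsub>poly_ring V\<^esub> y = x * y" "x \<oplus>\<^bsub>poly_ring V\<^esub> y = x + y"
  "\<zero>\<^bsub>poly_ring V\<^esub> = 0"
  by (simp_all add: poly_ring_def)

text \<open>On the line through a point of the cone both sides are polynomials in the scaling factor
  s. They agree for all nonzero s, so their coefficients agree.\<close>

lemma graded_independent:
  assumes cone: "\<And>y s. y \<in> E \<Longrightarrow> s \<noteq> 0 \<Longrightarrow> (\<lambda>i. s * y i) \<in> E"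
    and T: "finite T" "k \<in> T" and f: "\<And>t. t \<in> T \<Longrightarrow> f t \<in> coord_ring V E t" and g: "g \<in> coord_ring V E k"
    and eq: "g = (\<Sum>t\<in>T. f t)"
  shows "f k = g"
proof
  fix y
  obtain p where p: "\<And>t. t \<in> T \<Longrightarrow> p t \<in> hom_polys V t \<and> f t = poly_fun E (p t)"
    using f unfolding coord_ring_def image_iff by metis
  obtain q where q: "q \<in> hom_polys V k" "g = poly_fun E q" using g by (auto simp: coord_ring_def)
  show "f k y = g y"
  proof (cases "y \<in> E")
    case True
    define c where "c t = (if t = k then evalp (p k) y - evalp q y else evalp (p t) y)" for t
    define h where "h = (\<Sum>t\<in>T. Polynomial.monom (c t) (nat t))"
    have fun_sum: "(sum f T) z = (\<Sum>t\<in>T. f t z)" for z by (induction T rule: infinite_finite_induct) auto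
    have "poly h s = 0" if s: "s \<noteq> 0" for s
    proof -
      have ys: "(\<lambda>i. s * y i) \<in> E" by (rule cone[OF True s])
      have "s ^ nat k * evalp q y = (\<Sum>t\<in>T. s ^ nat t * evalp (p t) y)"
      proof -
        have "g (\<lambda>i. s * y i) = (\<Sum>t\<in>T. f t (\<lambda>i. s * y i))" by (simp add: eq fun_sum)
        moreover have "(\<Sum>t\<in>T. f t (\<lambda>i. s * y i)) = (\<Sum>t\<in>T. s ^ nat t * evalp (p t) y)"
        proof (rule sum.cong)
          fix t assume "t \<in> T"
          then show "f t (\<lambda>i. s * y i) = s ^ nat t * evalp (p t) y"
            using p ys evalp_scale[of "p t" V t s y] by (simp add: poly_fun_def)
        qed simp
        ultimately show ?thesis using ys by (simp add: q(2) poly_fun_def evalp_scale[OF q(1)])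
      qed
      moreover have "poly h s = (\<Sum>t\<in>T. s ^ nat t * evalp (p t) y) - s ^ nat k * evalp q y"
      proof -
        have "poly h s = (\<Sum>t\<in>T. s ^ nat t * evalp (p t) y - (if t = k then s ^ nat k * evalp q y else 0))"
          unfolding h_def poly_sum poly_monom c_def by (intro sum.cong) (auto simp: algebra_simps)
        then show ?thesis using T by (simp add: sum_subtractf)
      qed
      ultimately show ?thesis by simp
    qed
    then have "UNIV \<subseteq> insert 0 {s. poly h s = 0}" by blast
    then have "\<not> finite {s. poly h s = 0}"
      using infinite_UNIV_char_0[where ?'a = complex] finite_subset finite_insert by metis
    then have h0: "h = 0" using poly_roots_finite by blast
    \<comment> \<open>All negative degrees become 0 under \<open>nat\<close>, so they are treated
      separately; their pieces are zero.\<close>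
    show ?thesis
    proof (cases "k < 0")
      case True
      then show ?thesis
        using p[OF T(2)] q hom_polys_neg[OF conjunct1[OF p[OF T(2)]]] hom_polys_neg[OF q(1)] by simp
    next
      case False
      have z: "c t = 0" if "t \<in> T" "t < 0" for t
        using that hom_polys_neg[OF conjunct1[OF p[OF that(1)]]] False by (auto simp: c_def)
      have "coeff h (nat k) = (\<Sum>t\<in>T. if t = k then c t else 0)"
        unfolding h_def coeff_sum using z False by (intro sum.cong) (auto simp: nat_eq_iff2 not_less)
      then have "c k = 0" using h0 T by simp
      then show ?thesis using p[OF T(2)] q True by (simp add: c_def poly_fun_def)
    qed
  qed (use p[OF T(2)] q in \<open>auto simp: poly_fun_def\<close>)
qed

lemma recip_points_cone:
  assumes "lin_subspace W" "\<And>i. linear_form (A i)" "y \<in> recip_points A V W" "s \<noteq> 0"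
  shows "(\<lambda>i. s * y i) \<in> recip_points A V W"
proof -
  obtain v where v: "v \<in> W" "\<And>i. i \<in> V \<Longrightarrow> A i v \<noteq> 0 \<and> y i = inverse (A i v)" using assms(3) by (auto simp: recip_points_def)
  have "A i (\<lambda>k. inverse s * v k) = inverse s * A i v" for i using assms(2)[of i] by (auto simp: linear_form_def)
  with v assms(4) lin_subspaceD(3)[OF assms(1) v(1), of "inverse s"] show ?thesis
    unfolding recip_points_def by (intro CollectI bexI[of _ "\<lambda>k. inverse s * v k"]) auto
qed

section \<open>The Orlik--Terao algebra\<close>

context
  fixes n d :: nat and \<alpha> :: "nat \<Rightarrow> cpoly"
  assumes \<alpha>: "\<And>i. i \<in> {1..d} \<Longrightarrow> \<alpha> i \<in> hom_polys {0..n} 1"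
begin

private definition "V = {1..d}"
private definition "W = fin_span {0..n} (\<lambda>x k. if k = x then 1 else 0)"
text \<open>Reading off the coefficients makes \<open>A i\<close> linear for every index, also
  outside \<open>V\<close>, as the general lemmas demand. On \<open>V\<close> it is evaluation of
  the form.\<close>

private definition "A i v = (\<Sum>x\<in>{0..n}. lookup (\<alpha> i) (Poly_Mapping.single x 1) * v x)"
private definition "E = recip_points A V W"
private abbreviation (input) "R \<equiv> poly_ring V"
private abbreviation (input) "I \<equiv> orlik_terao_ideal d \<alpha>"
private abbreviation (input) "M \<equiv> orlik_terao_algebra d \<alpha>"

lemma linear_form_A: "linear_form (A i)"
  by (auto simp: linear_form_def A_def algebra_simps sum.distrib sum_distrib_left)

lemma A_evalp: "i \<in> V \<Longrightarrow> A i v = evalp (\<alpha> i) v"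
  using evalp_linear(1)[OF \<alpha>, of i v] by (simp add: A_def V_def)

lemma dim_le_W: "dim_le (Suc n) W"
  unfolding dim_le_def W_def by (intro exI[of _ "{0..n}"] exI[of _ "\<lambda>x k. if k = x then 1 else 0"]) auto

lemma ring_poly_ring: "ring R" using cring_poly_ring cring.axioms(1) by blast

lemma ot_gens_carrier: "{ot_relation S c | S c. S \<subseteq> {1..d} \<and> (\<Sum>i\<in>S. Const (c i) * \<alpha> i) = 0} \<subseteq> carrier R"
proof clarify
  fix S c assume "S \<subseteq> {1..d}"
  then show "ot_relation S c \<in> carrier R"
    using hom_polys_subset[OF ot_relation_hom[of S V c]] by (simp add: poly_ring_simps V_def)
qed

lemma ideal_orlik_terao_ideal: "ideal I R"
  unfolding orlik_terao_ideal_def using ring.genideal_ideal[OF ring_poly_ring] ot_gens_carrier by (simp add: V_def)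

lemma ot_relation_in_orlik_terao_ideal:
  assumes "S \<subseteq> V" "(\<Sum>i\<in>S. Const (c i) * \<alpha> i) = 0" shows "ot_relation S c \<in> I"
  using ring.genideal_self[OF ring_poly_ring ot_gens_carrier] assms unfolding orlik_terao_ideal_def V_def by blast

lemma orlik_terao_ideal_vanishes:
  assumes "p \<in> I" "y \<in> E" shows "evalp p y = 0"
proof -
  let ?J = "{p \<in> polys_in V. \<forall>y\<in>E. evalp p y = 0}"
  have "ideal ?J R"
  proof (rule idealI[OF ring_poly_ring])
    have inv: "inv\<^bsub>add_monoid R\<^esub> p = - p" if "p \<in> polys_in V" for p
      using that polys_in_uminus ring_poly_ring
      by (intro group.inv_equality[OF abelian_group.a_group[OF ring.is_abelian_group[OF ring_poly_ring]]]) (auto simp: poly_ring_simps)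
    show "subgroup ?J (add_monoid R)"
    proof (rule subgroup.intro)
      show "inv\<^bsub>add_monoid R\<^esub> p \<in> ?J" if "p \<in> ?J" for p
      proof -
        have "p \<in> polys_in V" using that by simp
        show ?thesis unfolding inv[OF \<open>p \<in> polys_in V\<close>] using that polys_in_uminus by auto
      qed
    qed (auto simp: poly_ring_simps polys_in_add evalp_add)
  qed (auto simp: poly_ring_simps polys_in_mult evalp_mult)
  moreover have "{ot_relation S c | S c. S \<subseteq> {1..d} \<and> (\<Sum>i\<in>S. Const (c i) * \<alpha> i) = 0} \<subseteq> ?J"
  proof clarify
    fix S c assume S: "S \<subseteq> {1..d}" and dep: "(\<Sum>i\<in>S. Const (c i) * \<alpha> i) = 0"
    have "(\<Sum>i\<in>S. c i * A i v) = 0" for v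
    proof -
      have "(\<Sum>i\<in>S. c i * A i v) = evalp (\<Sum>i\<in>S. Const (c i) * \<alpha> i) v"
        unfolding evalp_sum evalp_mult using S by (intro sum.cong) (auto simp: A_evalp V_def)
      then show ?thesis by (simp add: dep)
    qed
    moreover have "1 \<in> hom_polys V 0" using hom_polys_Const[of 1] by (simp add: Const_def)
    ultimately have "in_ot A V W (int (card S) - 1) (1 * ot_relation S c)"
      using S by (intro in_ot.gen) (auto simp: V_def)
    then have "evalp (ot_relation S c) y = 0" if "y \<in> E" for y
      using in_ot_vanishes[of A V W _ _ y] that by (simp add: E_def V_def)
    moreover have "ot_relation S c \<in> polys_in V"
      using ot_relation_hom[of S V c] S hom_polys_subset by (auto simp: V_def)
    ultimately show "ot_relation S c \<in> polys_in V \<and> (\<forall>y\<in>E. evalp (ot_relation S c) y = 0)" by blast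
  qed
  ultimately have "I \<subseteq> ?J"
    unfolding orlik_terao_ideal_def V_def[symmetric] using ring.genideal_minimal[OF ring_poly_ring] by blast
  with assms show ?thesis by blast
qed

text \<open>\<open>in_ot\<close> asks for dependencies as functions on \<open>W\<close>. Tested on
  unit vectors they become identities of polynomials, as the generators of the ideal
  require.\<close>

lemma in_ot_imp_orlik_terao_ideal: "in_ot A V W k p \<Longrightarrow> p \<in> I"
proof (induction rule: in_ot.induct)
  case (zero k)
  then show ?case using additive_subgroup.zero_closed[OF ideal.axioms(1)[OF ideal_orlik_terao_ideal]] by (simp add: poly_ring_simps)
next
  case (add k p q)
  then show ?case using additive_subgroup.a_closed[OF ideal.axioms(1)[OF ideal_orlik_terao_ideal]] by (simp add: poly_ring_simps)
next
  case (gen S c p k)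
  let ?q = "\<Sum>i\<in>S. Const (c i) * \<alpha> i"
  have "?q \<in> hom_polys {0..n} 1" using gen(1) \<alpha> by (intro hom_polys_sum hom_polys_Const_mult) (auto simp: V_def)
  moreover have "lookup ?q (Poly_Mapping.single x 1) = 0" if x: "x \<in> {0..n}" for x
  proof -
    let ?e = "\<lambda>k. if k = x then 1 else 0 :: complex"
    have "?e \<in> W"
      unfolding W_def fin_span_def using x
      by (intro CollectI exI[of _ ?e]) (simp add: fun_eq_iff if_distrib[of "\<lambda>a. a * _"] cong: if_cong)
    have "lookup ?q (Poly_Mapping.single x 1) = evalp ?q ?e"
      unfolding evalp_linear(1)[OF \<open>?q \<in> hom_polys {0..n} 1\<close> finite_atLeastAtMost]
      using x by (simp add: if_distrib[of "\<lambda>a. _ * a"] cong: if_cong)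
    also have "\<dots> = (\<Sum>i\<in>S. c i * A i ?e)"
      unfolding evalp_sum evalp_mult using gen(1) by (intro sum.cong) (auto simp: A_evalp)
    also have "\<dots> = 0" by (rule gen(2)[OF \<open>?e \<in> W\<close>])
    finally show ?thesis .
  qed
  ultimately have "?q = 0" by (rule evalp_linear(2)[OF _ finite_atLeastAtMost])
  then show ?case
    using ideal.I_l_closed[OF ideal_orlik_terao_ideal ot_relation_in_orlik_terao_ideal[OF gen(1)], of c p] gen(3) hom_polys_subset by (simp add: poly_ring_simps)
qed

private definition "coset_fun Y = poly_fun E (SOME p. p \<in> Y)"

text \<open>Representatives of a coset differ by elements of the ideal, which vanish on
  \<open>E\<close>, so the choice does not matter.\<close>

lemma coset_fun:
  assumes "p \<in> polys_in V" shows "coset_fun (I +>\<^bsub>R\<^esub> p) = poly_fun E p"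
proof -
  have c: "I +>\<^bsub>R\<^esub> p = {i + p | i. i \<in> I}" by (auto simp: a_r_coset_def' poly_ring_simps)
  have "0 \<in> I" using additive_subgroup.zero_closed[OF ideal.axioms(1)[OF ideal_orlik_terao_ideal]] by (simp add: poly_ring_simps)
  then have "\<exists>q. q \<in> I +>\<^bsub>R\<^esub> p" unfolding c by blast
  then obtain i where "i \<in> I" "(SOME q. q \<in> I +>\<^bsub>R\<^esub> p) = i + p" using someI_ex unfolding c by (metis (mono_tags, lifting) mem_Collect_eq)
  then show ?thesis using orlik_terao_ideal_vanishes by (simp add: coset_fun_def poly_fun_add) (auto simp: poly_fun_eq_0_iff)
qed

lemma orlik_terao_algebra_eq: "M = quotient_module V I"
  by (simp add: orlik_terao_algebra_def V_def)

lemma orlik_terao_algebra_simps: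
  "carrier M = {I +>\<^bsub>R\<^esub> p | p. p \<in> polys_in V}" "\<zero>\<^bsub>M\<^esub> = I" "piece M k = (\<lambda>p. I +>\<^bsub>R\<^esub> p) ` hom_polys V k"
  by (auto simp: orlik_terao_algebra_eq quotient_module_def Let_def FactRing_def A_RCOSETS_def' poly_ring_simps)

lemma orlik_terao_algebra_add:
  assumes "p \<in> polys_in V" "q \<in> polys_in V"
  shows "(I +>\<^bsub>R\<^esub> p) \<oplus>\<^bsub>M\<^esub> (I +>\<^bsub>R\<^esub> q) = I +>\<^bsub>R\<^esub> (p + q)"
proof -
  interpret ideal I R by (rule ideal_orlik_terao_ideal)
  show ?thesis using a_rcos_sum assms
    by (simp add: orlik_terao_algebra_eq quotient_module_def Let_def FactRing_def poly_ring_simps)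
qed

lemma orlik_terao_algebra_smult:
  assumes "p \<in> polys_in V" "q \<in> polys_in V"
  shows "p \<odot>\<^bsub>M\<^esub> (I +>\<^bsub>R\<^esub> q) = I +>\<^bsub>R\<^esub> (p * q)"
  using ideal.rcoset_mult_add[OF ideal_orlik_terao_ideal] assms
  by (simp add: orlik_terao_algebra_eq quotient_module_def Let_def FactRing_def poly_ring_simps)

theorem orlik_terao_Tor_vanishes:
  assumes res: "graded_free_resolution {1..d} M B bdeg \<delta> \<epsilon>" and t: "t > int i + int n"
  shows "trivial_group (Tor {1..d} B bdeg \<delta> residue_field i t)"
proof -
  define F where "F i = free_module V (B i) (bdeg i)" for i
  define js where "js = [1..<Suc d]"
  have js: "set js = V" "distinct js" by (auto simp: js_def V_def)
  note res' = res[folded V_def, unfolded graded_free_resolution_def Let_def orlik_terao_algebra_simps(2) free_module_simps(4),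
      folded F_def]
  have \<epsilon>: "\<epsilon> \<in> graded_hom V (F 0) M" and \<delta>: "\<And>i. \<delta> i \<in> graded_hom V (F (Suc i)) (F i)"
    and onto: "\<epsilon> ` carrier (F 0) = carrier M" and im0: "\<delta> 0 ` carrier (F 1) = {x \<in> carrier (F 0). \<epsilon> x = I}"
    and im1: "\<And>i. \<delta> (Suc i) ` carrier (F (Suc (Suc i))) = {x \<in> carrier (F (Suc i)). \<delta> i x = 0}"
    using res' by blast+
  \<comment> \<open>This replaces cosets by functions, whose type is an abelian group as the Koszul
    lemmas need.\<close>
  define \<psi> where "\<psi> x = coset_fun (\<epsilon> x)" for x
  have \<epsilon>c: "\<exists>p \<in> polys_in V. \<epsilon> x = I +>\<^bsub>R\<^esub> p" if "x \<in> carrier (F 0)" for x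
  proof -
    have "\<epsilon> x \<in> carrier M" using \<epsilon> that by (auto simp: graded_hom_def)
    then show ?thesis unfolding orlik_terao_algebra_simps(1) by blast
  qed
  have \<epsilon>p: "\<exists>p \<in> hom_polys V t. \<epsilon> x = I +>\<^bsub>R\<^esub> p" if "x \<in> piece (F 0) t" for x t
  proof -
    have "\<epsilon> ` piece (F 0) t \<subseteq> piece M t" using \<epsilon> by (simp add: graded_hom_def)
    then have "\<epsilon> x \<in> piece M t" using that by blast
    then show ?thesis unfolding orlik_terao_algebra_simps(3) by (rule imageE) blast
  qed
  have FP: "x \<in> piece (F i) t \<Longrightarrow> x \<in> carrier (F i)" for x i t unfolding F_def by (rule free_module_piece_carrier)
  have \<psi>add: "\<psi> (x + y) = \<psi> x + \<psi> y" if xy: "x \<in> carrier (F 0)" "y \<in> carrier (F 0)" for x y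
  proof -
    obtain p q where pq: "p \<in> polys_in V" "\<epsilon> x = I +>\<^bsub>R\<^esub> p" "q \<in> polys_in V" "\<epsilon> y = I +>\<^bsub>R\<^esub> q"
      using \<epsilon>c xy by metis
    have "\<epsilon> (x + y) = \<epsilon> x \<oplus>\<^bsub>M\<^esub> \<epsilon> y" using \<epsilon> xy by (auto simp: graded_hom_def F_def free_module_simps(3))
    then show ?thesis by (simp add: \<psi>_def pq orlik_terao_algebra_add coset_fun polys_in_add poly_fun_add)
  qed
  have \<psi>piece: "\<psi> x \<in> coord_ring V E t" if x: "x \<in> piece (F 0) t" for x t
    using \<epsilon>p[OF x] hom_polys_subset by (auto simp: \<psi>_def coset_fun coord_ring_def)
  have I0: "coset_fun I = 0"
  proof -
    have "I = I +>\<^bsub>R\<^esub> 0" by (simp add: a_r_coset_def' poly_ring_simps)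
    then show ?thesis using coset_fun[of 0] by simp
  qed
  \<comment> \<open>Passing to functions loses nothing: a homogeneous polynomial vanishing on
    \<open>E\<close> lies in the ideal.\<close>
  have \<psi>0: "\<epsilon> x = I" if x: "x \<in> piece (F 0) t" "\<psi> x = 0" for x t
  proof -
    obtain p where p: "p \<in> hom_polys V t" "\<epsilon> x = I +>\<^bsub>R\<^esub> p" using \<epsilon>p[OF x(1)] by blast
    have "evalp p y = 0" if "y \<in> E" for y
      using x(2) p that by (auto simp: \<psi>_def coset_fun[OF hom_polys_subset] poly_fun_eq_0_iff)
    then have "in_ot A V W t p"
      using vanishing_imp_in_ot[where A = A, OF linear_form_A _ dim_le_subspace[OF dim_le_W] p(1)] by (auto simp: V_def E_def)
    then have "p \<in> I" by (rule in_ot_imp_orlik_terao_ideal)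
    interpret ideal I R by (rule ideal_orlik_terao_ideal)
    show ?thesis using p(2) a_coset_join2[OF _ a_subgroup \<open>p \<in> I\<close>] hom_polys_subset[OF p(1)] by (simp add: poly_ring_simps)
  qed
  have "trivial_group (Tor (set js) B bdeg \<delta> residue_field i t)"
  proof (rule trivial_Tor_of_koszul_exact[where \<psi> = \<psi> and P = "coord_ring V E" and Y' = coord_op, OF js(2)], unfold js(1) F_def[symmetric])
    show "\<delta> i \<in> graded_hom V (F (Suc i)) (F i)" for i by (rule \<delta>)
    show "commuting_ops coord_op" by (rule commuting_coord_op)
    show "piecewise_hom V var_op (piece (F 0)) coord_op (coord_ring V E) \<psi>"
      unfolding piecewise_hom_def
    proof (intro allI ballI conjI)
      fix t x assume x: "x \<in> piece (F 0) t"
      show "\<psi> x \<in> coord_ring V E t" by (rule \<psi>piece[OF x])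
      show "\<psi> (x + y) = \<psi> x + \<psi> y" if "y \<in> piece (F 0) t" for y by (rule \<psi>add[OF FP[OF x] FP[OF that]])
      show "\<psi> (var_op j x) = coord_op j (\<psi> x)" if j: "j \<in> V" for j
      proof -
        obtain p where p: "p \<in> polys_in V" "\<epsilon> x = I +>\<^bsub>R\<^esub> p" using \<epsilon>c[OF FP[OF x]] by blast
        have "\<epsilon> (Var j \<odot>\<^bsub>F 0\<^esub> x) = Var j \<odot>\<^bsub>M\<^esub> \<epsilon> x"
          using \<epsilon> FP[OF x] polys_in_Var[OF j] unfolding graded_hom_def by blast
        then have "\<epsilon> (var_op j x) = I +>\<^bsub>R\<^esub> (Var j * p)"
          by (simp add: var_op_def F_def free_module_simps(5) p orlik_terao_algebra_smult polys_in_Var[OF j])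
        then show ?thesis
          by (simp add: \<psi>_def p coset_fun coord_op_poly_fun polys_in_mult polys_in_Var[OF j])
      qed
    qed
    show "\<exists>y\<in>piece (F 0) t. \<psi> y = x" if x: "x \<in> coord_ring V E t" for t x
    proof -
      obtain p where p: "p \<in> hom_polys V t" "x = poly_fun E p" using x by (auto simp: coord_ring_def)
      have "I +>\<^bsub>R\<^esub> p \<in> carrier M" using hom_polys_subset[OF p(1)] by (auto simp: orlik_terao_algebra_simps(1))
      then obtain z where z: "z \<in> carrier (F 0)" "\<epsilon> z = I +>\<^bsub>R\<^esub> p" using onto by (metis (no_types, lifting) image_iff)
      \<comment> \<open>The preimage \<open>z\<close> may be inhomogeneous. Its component of degree
        t has the same image, since functions of different degrees on the cone \<open>E\<close> are
        independent.\<close>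
      obtain T where T: "finite T" "t \<in> T" "z = (\<Sum>s\<in>T. free_part (bdeg 0) s z)" by (rule free_part_expand)
      have fp: "free_part (bdeg 0) s z \<in> piece (F 0) s" for s using free_part_piece z(1) unfolding F_def by blast
      have "x = \<psi> z" by (simp add: \<psi>_def z(2) coset_fun[OF hom_polys_subset[OF p(1)]] p(2))
      also have "\<dots> = (\<Sum>s\<in>T. \<psi> (free_part (bdeg 0) s z))"
        using additive_sum[of V "B 0" "bdeg 0" \<psi> T "\<lambda>s. free_part (bdeg 0) s z"] \<psi>add FP[OF fp] T(3) unfolding F_def by simp
      finally have eq: "x = (\<Sum>s\<in>T. \<psi> (free_part (bdeg 0) s z))" .
      have cone: "(\<lambda>i. s * y i) \<in> E" if "y \<in> E" "s \<noteq> 0" for y s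
        unfolding E_def
        by (rule recip_points_cone[where A = A, OF dim_le_subspace[OF dim_le_W] linear_form_A that(1)[unfolded E_def] that(2)])
      have "\<psi> (free_part (bdeg 0) t z) = x"
        by (rule graded_independent[where f = "\<lambda>s. \<psi> (free_part (bdeg 0) s z)", OF cone T(1,2) \<psi>piece[OF fp] x eq])
      with fp show ?thesis by blast
    qed
    show "\<psi> (\<delta> 0 x) = 0" if x: "x \<in> piece (F 1) t" for t x
    proof -
      have "\<delta> 0 x \<in> \<delta> 0 ` carrier (F 1)" using FP[OF x] by blast
      then have "\<epsilon> (\<delta> 0 x) = I" unfolding im0 by blast
      then show ?thesis by (simp add: \<psi>_def I0)
    qed
    show "\<delta> i (\<delta> (Suc i) x) = 0" if "x \<in> carrier (F (Suc (Suc i)))" for i x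
    proof -
      have "\<delta> (Suc i) x \<in> \<delta> (Suc i) ` carrier (F (Suc (Suc i)))" using that by blast
      then show ?thesis unfolding im1 by blast
    qed
    show "\<exists>w\<in>piece (F 1) t. \<delta> 0 w = x" if x: "x \<in> piece (F 0) t" "\<psi> x = 0" for t x
    proof -
      have "x \<in> \<delta> 0 ` carrier (F 1)" unfolding im0 using \<psi>0[OF x] FP[OF x(1)] by blast
      then obtain z where "z \<in> carrier (F 1)" "x = \<delta> 0 z" by blast
      then show ?thesis using graded_hom_homogeneous_preimage \<delta>[of 0] x(1) unfolding F_def by fastforce
    qed
    show "\<exists>w\<in>piece (F (Suc (Suc i))) t. \<delta> (Suc i) w = x" if x: "x \<in> piece (F (Suc i)) t" "\<delta> i x = 0" for i t x
    proof -
      have "x \<in> \<delta> (Suc i) ` carrier (F (Suc (Suc i)))" unfolding im1 using x(2) FP[OF x(1)] by blast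
      then obtain z where "z \<in> carrier (F (Suc (Suc i)))" "x = \<delta> (Suc i) z" by blast
      then show ?thesis using graded_hom_homogeneous_preimage \<delta>[of "Suc i"] x(1) unfolding F_def by blast
    qed
    show "koszul_exact js coord_op (coord_ring V E) i t"
      using koszul_exact_coord_ring[where A = A, OF linear_form_A js(2) dim_le_W t] by (simp add: js(1) E_def)
  qed
  then show ?thesis by (simp add: js(1) V_def)
qed

end

theorem theorem3p7:
  fixes n d :: nat
    and \<alpha> :: "nat \<Rightarrow> cpoly"
    and B :: "nat \<Rightarrow> 'b set"
    and bdeg :: "nat \<Rightarrow> 'b \<Rightarrow> int"
    and \<delta> :: "nat \<Rightarrow> ('b \<Rightarrow>\<^sub>0 cpoly) \<Rightarrow> ('b \<Rightarrow>\<^sub>0 cpoly)"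
    and \<epsilon> :: "('b \<Rightarrow>\<^sub>0 cpoly) \<Rightarrow> cpoly set"
  assumes "d \<ge> 1"
    and "hyperplane_arrangement n d \<alpha>"
    and "graded_free_resolution {1..d} (orlik_terao_algebra d \<alpha>) B bdeg \<delta> \<epsilon>"
  shows "\<forall>i :: nat. \<forall>j :: int. j > int n \<longrightarrow>
    trivial_group (Tor {1..d} B bdeg \<delta> residue_field i (int i + j))"
proof (intro allI impI)
  fix i :: nat and j :: int assume "j > int n"
  moreover have "\<alpha> k \<in> hom_polys {0..n} 1" if "k \<in> {1..d}" for k
    using assms(2) that by (simp add: hyperplane_arrangement_def)
  ultimately show "trivial_group (Tor {1..d} B bdeg \<delta> residue_field i (int i + j))"
    by (intro orlik_terao_Tor_vanishes[OF _ assms(3)]) auto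
qed

end
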